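(* For any $n\ge2$ there exists an $n$-dimensional compact complex manifold $X$ with $c_1(X)\ge0$ such that $X$ admits three different Gauduchon metrics $\omega_1,\omega_2,\omega_3$ with the following properties: (1) $[\omega_1]=[\omega_2]=[\omega_3]\in H^{1,1}_A(X)$; (2) they have the same semi-positive Chern-Ricci curvature, i.e. $\Theta^{(1)}(\omega_1)=\Theta^{(1)}(\omega_2)=\Theta^{(1)}(\omega_3)\ge0$; (3) they have constant positive Chern scalar curvatures. Moreover: (i) $\omega_1$ has positive constant Riemannian scalar curvature; (ii) $\omega_2$ has zero Riemannian scalar curvature; (iii) $\omega_3$ has negative constant Riemannian scalar curvature.
   Context: A Hermitian metric on a complex manifold $X$ of complex dimension $n$ is given by its form $\omega=\sqrt{-1}\,h_{i\bar j}dz^i\wedge d\bar z^j$, with background $J$-invariant Riemannian metric $g$ such that $h_{i\bar j}=g(\partial/\partial z^i,\partial/\partial\bar z^j)$ ($g$ extended $\mathbb C$-bilinearly); $h^{i\bar\ell}h_{k\bar\ell}=\delta_k^i$. It is Gauduchon if $\partial\bar\partial\omega^{n-1}=0$. The (first) Chern-Ricci curvature is $\Theta^{(1)}(\omega)=-\sqrt{-1}\,\partial\bar\partial\log\det(h_{k\bar\ell})=\sqrt{-1}\,\Theta^{(1)}_{i\bar j}dz^i\wedge d\bar z^j$, the Chern scalar curvature is $s_C=h^{i\bar j}\Theta^{(1)}_{i\bar j}$, and the Riemannian scalar curvature is the scalar curvature of $g$. The Aeppli cohomology is $H^{1,1}_A(X)=\dfrac{\ker\partial\bar\partial\cap\Omega^{1,1}(X)}{\operatorname{Im}\partial\cap\Omega^{1,1}(X)+\operatorname{Im}\bar\partial\cap\Omega^{1,1}(X)}$;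 property (1) includes that the $\omega_i$ are $\partial\bar\partial$-closed. $c_1(X)\ge0$ means that the first Chern class of $X$ (represented by $\Theta^{(1)}$, up to the factor $2\pi$) is represented by a semi-positive real $(1,1)$-form. *)

theory Defs
  imports "HOL-Analysis.Analysis" "HOL-Combinatorics.Permutations"
begin

section \<open>Smooth functions on open subsets of Euclidean space\<close>

definition dderiv :: "'a::euclidean_space \<Rightarrow> ('a \<Rightarrow> 'b::real_normed_vector) \<Rightarrow> 'a \<Rightarrow> 'b" where
  "dderiv v f x = frechet_derivative f (at x) v"

fun Ck_on :: "nat \<Rightarrow> ('a::euclidean_space \<Rightarrow> 'b::real_normed_vector) \<Rightarrow> 'a set \<Rightarrow> bool" where
  "Ck_on 0 f S \<longleftrightarrow> continuous_on S f"
| "Ck_on (Suc k) f S \<longleftrightarrow> (\<forall>x\<in>S. f differentiable (at x)) \<and> (\<forall>v. Ck_on k (dderiv v f) S)"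

definition smooth_on :: "('a::euclidean_space \<Rightarrow> 'b::real_normed_vector) \<Rightarrow> 'a set \<Rightarrow> bool" where
  "smooth_on f S \<longleftrightarrow> (\<forall>k. Ck_on k f S)"


section \<open>Complex manifolds\<close>

text \<open>A chart is a pair of its domain U and a coordinate map, which is only relevant on U.
  The complex dimension is the cardinality of the index type \<^typ>\<open>'n\<close>.\<close>

type_synonym ('a, 'n) chart = "'a set \<times> ('a \<Rightarrow> complex ^ 'n)"

definition chart_range :: "('a, 'n::finite) chart \<Rightarrow> (complex ^ 'n) set" where
  "chart_range c = snd c ` fst c"

definition overlap :: "('a, 'n::finite) chart \<Rightarrow> ('a, 'n) chart \<Rightarrow> (complex ^ 'n) set" where
  "overlap c d = snd c ` (fst c \<inter> fst d)"

definition transition ::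
    "('a, 'n::finite) chart \<Rightarrow> ('a, 'n) chart \<Rightarrow> complex ^ 'n \<Rightarrow> complex ^ 'n" where
  "transition c d = snd d \<circ> inv_into (fst c) (snd c)"

definition holomorphic_map_on ::
    "(complex ^ 'n::finite \<Rightarrow> complex ^ 'm::finite) \<Rightarrow> (complex ^ 'n) set \<Rightarrow> bool" where
  "holomorphic_map_on f S \<longleftrightarrow>
     (\<forall>x\<in>S. \<exists>D. (f has_derivative D) (at x) \<and> Vector_Spaces.linear (*s) (*s) D)"

definition complex_manifold :: "'a topology \<Rightarrow> ('a, 'n::finite) chart set \<Rightarrow> bool" where
  "complex_manifold X A \<longleftrightarrow>
     Hausdorff_space X \<and> second_countable X \<and> connected_space X \<and> topspace X \<noteq> {} \<and>
     (\<forall>c\<in>A. openin X (fst c) \<and> open (chart_range c) \<and>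
        homeomorphic_map (subtopology X (fst c)) (top_of_set (chart_range c)) (snd c)) \<and>
     (\<Union>c\<in>A. fst c) = topspace X \<and>
     (\<forall>c\<in>A. \<forall>d\<in>A. holomorphic_map_on (transition c d) (overlap c d))"


section \<open>Differential forms\<close>

text \<open>The value at a point of a complex-valued k-form on an open subset of \<^typ>\<open>complex ^ 'n\<close>
  is an alternating real-multilinear function of the first k entries of a sequence of tangent
  vectors. A real tangent vector is identified with the vector v of its values under the
  forms dz^i, so that the complex structure J acts as multiplication by \<open>\<i>\<close>.\<close>

type_synonym 'n altform = "(nat \<Rightarrow> complex ^ 'n) \<Rightarrow> complex"

definition alternating_form :: "nat \<Rightarrow> 'n::finite altform \<Rightarrow> bool" where
  "alternating_form k a \<longleftrightarrow>
     (\<forall>v w. (\<forall>i<k. v i = w i) \<longrightarrow> a v = a w) \<and>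
     (\<forall>i<k. \<forall>v. linear (\<lambda>u. a (v(i := u)))) \<and>
     (\<forall>i<k. \<forall>j<k. i \<noteq> j \<longrightarrow> (\<forall>v. v i = v j \<longrightarrow> a v = 0))"

definition wedge :: "nat \<Rightarrow> nat \<Rightarrow> 'n::finite altform \<Rightarrow> 'n altform \<Rightarrow> 'n altform" where
  "wedge p q a b v =
     (\<Sum>\<sigma> | \<sigma> permutes {..<p + q}.
        of_int (sign \<sigma>) * a (\<lambda>i. v (\<sigma> i)) * b (\<lambda>i. v (\<sigma> (p + i)))) / (fact p * fact q)"

text \<open>The k-th exterior power of a 2-form.\<close>

fun wedge_power :: "'n::finite altform \<Rightarrow> nat \<Rightarrow> 'n altform" where
  "wedge_power a 0 = (\<lambda>v. 1)"
| "wedge_power a (Suc k) = wedge 2 (2 * k) a (wedge_power a k)"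

text \<open>The derivative along v splits into its complex linear and antilinear parts in v:
  the derivatives along the (1,0)-part and the (0,1)-part of v, that is
  the sums of \<open>v $ i * (\<partial>f/\<partial>z\<^sup>i)\<close> and of \<open>cnj (v $ i) * (\<partial>f/\<partial>z\<^sup>i\<^sup>-)\<close> over i.\<close>

definition dz_deriv ::
    "complex ^ 'n::finite \<Rightarrow> (complex ^ 'n \<Rightarrow> complex) \<Rightarrow> complex ^ 'n \<Rightarrow> complex" where
  "dz_deriv v f x = (dderiv v f x - \<i> * dderiv (\<i> *s v) f x) / 2"

definition dzbar_deriv ::
    "complex ^ 'n::finite \<Rightarrow> (complex ^ 'n \<Rightarrow> complex) \<Rightarrow> complex ^ 'n \<Rightarrow> complex" where
  "dzbar_deriv v f x = (dderiv v f x + \<i> * dderiv (\<i> *s v) f x) / 2"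

text \<open>For a first-order operator D v, this sends the k-form f * (dz^I /\ dzbar^J) to
  (D f) /\ dz^I /\ dzbar^J. It yields the exterior derivative d and its parts
  del and delbar.\<close>

definition ext_deriv_by ::
    "(complex ^ 'n \<Rightarrow> (complex ^ 'n \<Rightarrow> complex) \<Rightarrow> complex ^ 'n \<Rightarrow> complex) \<Rightarrow>
     nat \<Rightarrow> (complex ^ 'n::finite \<Rightarrow> 'n altform) \<Rightarrow> complex ^ 'n \<Rightarrow> 'n altform" where
  "ext_deriv_by D k \<alpha> x v =
     (\<Sum>i\<le>k. (-1) ^ i * D (v i) (\<lambda>y. \<alpha> y (\<lambda>j. if j < i then v j else v (Suc j))) x)"

definition ext_deriv :: "nat \<Rightarrow> (complex ^ 'n::finite \<Rightarrow> 'n altform) \<Rightarrow> complex ^ 'n \<Rightarrow> 'n altform"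
  where "ext_deriv = ext_deriv_by dderiv"

definition del :: "nat \<Rightarrow> (complex ^ 'n::finite \<Rightarrow> 'n altform) \<Rightarrow> complex ^ 'n \<Rightarrow> 'n altform"
  where "del = ext_deriv_by dz_deriv"

definition delbar :: "nat \<Rightarrow> (complex ^ 'n::finite \<Rightarrow> 'n altform) \<Rightarrow> complex ^ 'n \<Rightarrow> 'n altform"
  where "delbar = ext_deriv_by dzbar_deriv"

definition del_delbar ::
    "nat \<Rightarrow> (complex ^ 'n::finite \<Rightarrow> 'n altform) \<Rightarrow> complex ^ 'n \<Rightarrow> 'n altform"
  where "del_delbar k \<alpha> = del (Suc k) (delbar k \<alpha>)"

text \<open>A global form is given by its expressions in the charts of the atlas. The value of such a
  family outside the charts' ranges is irrelevant.\<close>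

type_synonym ('a, 'n) form_family = "('a, 'n) chart \<Rightarrow> complex ^ 'n \<Rightarrow> 'n altform"

definition smooth_form :: "('a, 'n::finite) chart set \<Rightarrow> nat \<Rightarrow> ('a, 'n) form_family \<Rightarrow> bool" where
  "smooth_form A k \<alpha> \<longleftrightarrow>
     (\<forall>c\<in>A. \<forall>x\<in>chart_range c. alternating_form k (\<alpha> c x)) \<and>
     (\<forall>c\<in>A. \<forall>v. smooth_on (\<lambda>x. \<alpha> c x v) (chart_range c)) \<and>
     (\<forall>c\<in>A. \<forall>d\<in>A. \<forall>x\<in>overlap c d. \<forall>v.
        \<alpha> c x v = \<alpha> d (transition c d x) (\<lambda>i. frechet_derivative (transition c d) (at x) (v i)))"

definition agree_on_charts ::
    "('a, 'n::finite) chart set \<Rightarrow> (('a, 'n) chart \<Rightarrow> complex ^ 'n \<Rightarrow> 'b) \<Rightarrow>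
     (('a, 'n) chart \<Rightarrow> complex ^ 'n \<Rightarrow> 'b) \<Rightarrow> bool" where
  "agree_on_charts A \<alpha> \<beta> \<longleftrightarrow> (\<forall>c\<in>A. \<forall>x\<in>chart_range c. \<alpha> c x = \<beta> c x)"

text \<open>The (1,1)-form with coefficient \<open>m $ i $ j\<close> of dz^i /\ dzbar^j.\<close>

definition form11 :: "complex ^ 'n ^ 'n \<Rightarrow> 'n::finite altform" where
  "form11 m v =
     (\<Sum>i\<in>UNIV. \<Sum>j\<in>UNIV. m $ i $ j * (v 0 $ i * cnj (v 1 $ j) - v 1 $ i * cnj (v 0 $ j)))"

definition type11 :: "('a, 'n::finite) chart set \<Rightarrow> ('a, 'n) form_family \<Rightarrow> bool" where
  "type11 A \<alpha> \<longleftrightarrow> (\<forall>c\<in>A. \<forall>x\<in>chart_range c. \<exists>m. \<alpha> c x = form11 m)"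


section \<open>Aeppli cohomology\<close>

definition aeppli_closed :: "('a, 'n::finite) chart set \<Rightarrow> ('a, 'n) form_family \<Rightarrow> bool" where
  "aeppli_closed A \<alpha> \<longleftrightarrow>
     smooth_form A 2 \<alpha> \<and> type11 A \<alpha> \<and> agree_on_charts A (\<lambda>c. del_delbar 2 (\<alpha> c)) (\<lambda>c x v. 0)"

text \<open>Both forms represent classes in the Aeppli cohomology of bidegree (1,1), and these classes
  are equal.\<close>

definition same_aeppli_class ::
    "('a, 'n::finite) chart set \<Rightarrow> ('a, 'n) form_family \<Rightarrow> ('a, 'n) form_family \<Rightarrow> bool" where
  "same_aeppli_class A \<alpha> \<beta> \<longleftrightarrow>
     aeppli_closed A \<alpha> \<and> aeppli_closed A \<beta> \<and>
     (\<exists>\<sigma> \<tau>. smooth_form A 1 \<sigma> \<and> type11 A (\<lambda>c. del 1 (\<sigma> c)) \<and>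
            smooth_form A 1 \<tau> \<and> type11 A (\<lambda>c. delbar 1 (\<tau> c)) \<and>
            agree_on_charts A (\<lambda>c x v. \<alpha> c x v - \<beta> c x v)
              (\<lambda>c x v. del 1 (\<sigma> c) x v + delbar 1 (\<tau> c) x v))"


section \<open>Hermitian metrics and their curvatures\<close>

text \<open>A real (1,1)-form \<open>\<i>\<close> * (h_ij dz^i /\ dzbar^j) is represented by the family of its
  coefficient matrices h in the charts.\<close>

type_synonym ('a, 'n) matrix_family = "('a, 'n) chart \<Rightarrow> complex ^ 'n \<Rightarrow> complex ^ 'n ^ 'n"

definition form_of :: "('a, 'n::finite) matrix_family \<Rightarrow> ('a, 'n) form_family" where
  "form_of h c x v = \<i> * form11 (h c x) v"

definition hermitian_matrix :: "complex ^ 'n ^ 'n::finite \<Rightarrow> bool" where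
  "hermitian_matrix m \<longleftrightarrow> (\<forall>i j. m $ i $ j = cnj (m $ j $ i))"

definition sesq :: "complex ^ 'n ^ 'n \<Rightarrow> complex ^ 'n::finite \<Rightarrow> complex ^ 'n \<Rightarrow> complex" where
  "sesq m v w = (\<Sum>i\<in>UNIV. \<Sum>j\<in>UNIV. m $ i $ j * v $ i * cnj (w $ j))"

definition pos_matrix :: "complex ^ 'n ^ 'n::finite \<Rightarrow> bool" where
  "pos_matrix m \<longleftrightarrow> hermitian_matrix m \<and> (\<forall>v. v \<noteq> 0 \<longrightarrow> 0 < Re (sesq m v v))"

definition semipos_matrix :: "complex ^ 'n ^ 'n::finite \<Rightarrow> bool" where
  "semipos_matrix m \<longleftrightarrow> hermitian_matrix m \<and> (\<forall>v. 0 \<le> Re (sesq m v v))"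

definition semipositive :: "('a, 'n::finite) chart set \<Rightarrow> ('a, 'n) matrix_family \<Rightarrow> bool" where
  "semipositive A m \<longleftrightarrow> (\<forall>c\<in>A. \<forall>x\<in>chart_range c. semipos_matrix (m c x))"

definition hermitian_metric :: "('a, 'n::finite) chart set \<Rightarrow> ('a, 'n) matrix_family \<Rightarrow> bool" where
  "hermitian_metric A h \<longleftrightarrow>
     smooth_form A 2 (form_of h) \<and> (\<forall>c\<in>A. \<forall>x\<in>chart_range c. pos_matrix (h c x))"

definition gauduchon :: "('a, 'n::finite) chart set \<Rightarrow> ('a, 'n) matrix_family \<Rightarrow> bool" where
  "gauduchon A h \<longleftrightarrow>
     hermitian_metric A h \<and>
     agree_on_charts A
       (\<lambda>c. del_delbar (2 * (CARD('n) - 1)) (\<lambda>x. wedge_power (form_of h c x) (CARD('n) - 1)))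
       (\<lambda>c x v. 0)"

text \<open>The coefficients of the Chern-Ricci form. For a Hermitian metric the determinant is a positive
  real, so that the principal branch of the complex logarithm is the real logarithm.\<close>

definition chern_ricci :: "('a, 'n::finite) matrix_family \<Rightarrow> ('a, 'n) matrix_family" where
  "chern_ricci h c x =
     (\<chi> i j. - dz_deriv (axis i 1) (dzbar_deriv (axis j 1) (\<lambda>y. Ln (det (h c y)))) x)"

text \<open>The inverse \<open>h\<^sup>i\<^sup>j\<close> in the index convention of the trace below satisfies
  \<open>(\<Sum>l. h\<^sup>i\<^sup>l * h $ k $ l) = \<delta>\<^sup>i\<^sub>k\<close>, hence the transpose.\<close>

definition chern_scalar ::
    "('a, 'n::finite) matrix_family \<Rightarrow> ('a, 'n) chart \<Rightarrow> complex ^ 'n \<Rightarrow> complex" where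
  "chern_scalar h c x =
     (\<Sum>i\<in>UNIV. \<Sum>j\<in>UNIV. matrix_inv (transpose (h c x)) $ i $ j * chern_ricci h c x $ i $ j)"


section \<open>Riemannian scalar curvature\<close>

text \<open>A metric on an open subset of a Euclidean space is a field g of bilinear forms; all tensors
  below are evaluated on constant vector fields.\<close>

definition sharp :: "('a::euclidean_space \<Rightarrow> 'a \<Rightarrow> real) \<Rightarrow> ('a \<Rightarrow> real) \<Rightarrow> 'a" where
  "sharp b \<phi> = (THE u. \<forall>z. b u z = \<phi> z)"

text \<open>The Levi-Civita covariant derivative of the constant field w along v, by the Koszul
  formula.\<close>

definition levi_civita :: "('a::euclidean_space \<Rightarrow> 'a \<Rightarrow> 'a \<Rightarrow> real) \<Rightarrow> 'a \<Rightarrow> 'a \<Rightarrow> 'a \<Rightarrow> 'a" where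
  "levi_civita g x v w =
     sharp (g x) (\<lambda>z. (dderiv v (\<lambda>y. g y w z) x + dderiv w (\<lambda>y. g y v z) x
                       - dderiv z (\<lambda>y. g y v w) x) / 2)"

definition riemann_curv ::
    "('a::euclidean_space \<Rightarrow> 'a \<Rightarrow> 'a \<Rightarrow> real) \<Rightarrow> 'a \<Rightarrow> 'a \<Rightarrow> 'a \<Rightarrow> 'a \<Rightarrow> 'a" where
  "riemann_curv g x u v w =
     dderiv u (\<lambda>y. levi_civita g y v w) x - dderiv v (\<lambda>y. levi_civita g y u w) x
     + levi_civita g x u (levi_civita g x v w) - levi_civita g x v (levi_civita g x u w)"

definition ricci_curv :: "('a::euclidean_space \<Rightarrow> 'a \<Rightarrow> 'a \<Rightarrow> real) \<Rightarrow> 'a \<Rightarrow> 'a \<Rightarrow> 'a \<Rightarrow> real" where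
  "ricci_curv g x v w = (\<Sum>b\<in>Basis. riemann_curv g x b v w \<bullet> b)"

definition scalar_curv :: "('a::euclidean_space \<Rightarrow> 'a \<Rightarrow> 'a \<Rightarrow> real) \<Rightarrow> 'a \<Rightarrow> real" where
  "scalar_curv g x = (\<Sum>b\<in>Basis. sharp (g x) (ricci_curv g x b) \<bullet> b)"

text \<open>The J-invariant real metric g whose complex bilinear extension takes the value
  \<open>h $ i $ j\<close> on the pair \<open>\<partial>/\<partial>z\<^sup>i\<close>, \<open>\<partial>/\<partial>z\<^sup>j\<^sup>-\<close>. For g extended bilinearly,
  J-invariance makes it vanish on pairs of vectors of the same type, and the real vector v is
  the sum of \<open>v $ i * (\<partial>/\<partial>z\<^sup>i)\<close> and its conjugate, hence the factor 2.\<close>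

definition real_metric :: "complex ^ 'n ^ 'n \<Rightarrow> complex ^ 'n::finite \<Rightarrow> complex ^ 'n \<Rightarrow> real" where
  "real_metric m v w = 2 * Re (sesq m v w)"

lemma real_metric_J: "real_metric m (\<i> *s v) (\<i> *s w) = real_metric m v w"
  by (simp add: real_metric_def sesq_def algebra_simps)

lemma sesq_axis: "sesq m (a *s axis i 1) (b *s axis j 1) = m $ i $ j * a * cnj b"
proof -
  have "(\<Sum>l\<in>UNIV. m $ k $ l * (a *s axis i 1) $ k * cnj ((b *s axis j 1) $ l)) =
        m $ k $ j * (a *s axis i 1) $ k * cnj b" for k
    by (subst sum.remove[of _ j]) (auto simp: axis_def intro!: sum.neutral)
  then show ?thesis
    unfolding sesq_def
    by (simp, subst sum.remove[of _ i]) (auto simp: axis_def intro!: sum.neutral)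
qed

text \<open>The value of the bilinear extension on \<open>\<partial>/\<partial>z\<^sup>i = (e - \<i> J e) / 2\<close> and
  \<open>\<partial>/\<partial>z\<^sup>j\<^sup>- = (f + \<i> J f) / 2\<close>, where e and f are the coordinate vectors with
  indices i and j.\<close>

lemma real_metric_coefficients:
  fixes m :: "complex ^ 'n ^ 'n::finite" and i j :: 'n
  defines "e \<equiv> axis i 1 :: complex ^ 'n" and "f \<equiv> axis j 1 :: complex ^ 'n"
  shows "m $ i $ j =
    (real_metric m e f + real_metric m (\<i> *s e) (\<i> *s f)
      + \<i> * (real_metric m e (\<i> *s f) - real_metric m (\<i> *s e) f)) / 4"
  using sesq_axis[of m 1 i 1 j] sesq_axis[of m \<i> i 1 j] sesq_axis[of m 1 i \<i> j]
    sesq_axis[of m \<i> i \<i> j]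
  by (simp add: e_def f_def real_metric_def complex_eq_iff)

definition riemannian_scalar ::
    "('a, 'n::finite) matrix_family \<Rightarrow> ('a, 'n) chart \<Rightarrow> complex ^ 'n \<Rightarrow> real" where
  "riemannian_scalar h c = scalar_curv (\<lambda>x. real_metric (h c x))"


section \<open>Semi-positivity of the first Chern class\<close>

text \<open>The first Chern class is the de Rham class of the Chern-Ricci form of a Hermitian metric,
  divided by \<open>2 * pi\<close>; it does not depend on the metric. The family m represents c1 if
  the real (1,1)-form with coefficients m is closed and lies in this class.\<close>

definition represents_c1 :: "('a, 'n::finite) chart set \<Rightarrow> ('a, 'n) matrix_family \<Rightarrow> bool" where
  "represents_c1 A m \<longleftrightarrow>
     smooth_form A 2 (form_of m) \<and>
     (\<forall>c\<in>A. \<forall>x\<in>chart_range c. hermitian_matrix (m c x)) \<and>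
     agree_on_charts A (\<lambda>c. ext_deriv 2 (form_of m c)) (\<lambda>c x v. 0) \<and>
     (\<exists>h \<gamma>. hermitian_metric A h \<and> smooth_form A 1 \<gamma> \<and>
        (\<forall>c\<in>A. \<forall>x\<in>chart_range c. \<forall>v. \<gamma> c x v \<in> \<real>) \<and>
        agree_on_charts A
          (\<lambda>c x v. form_of m c x v - form_of (chern_ricci h) c x v / (2 * pi))
          (\<lambda>c. ext_deriv 1 (\<gamma> c)))"

definition c1_nonneg :: "('a, 'n::finite) chart set \<Rightarrow> bool" where
  "c1_nonneg A \<longleftrightarrow> (\<exists>m. represents_c1 A m \<and> semipositive A m)"

end

theory Submission
  imports Defs
begin

text \<open>The manifold is the product of the Hopf surface \<open>(\<complex>\<^sup>2 - 0) / (z \<sim> e z)\<close> with the torus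
  \<open>(\<complex> / \<int>[\<i>])\<^sup>n\<^sup>-\<^sup>2\<close>. Write r for the Euclidean norm on the Hopf plane. On the universal cover,
  consider for a > 0 the invariant Hermitian form \<open>\<omega>_a\<close> which is the sum of
  \<open>r\<^sup>-\<^sup>2\<close> times the flat form of the Hopf plane, of (a - 1) times the form
  \<open>\<i> \<partial>dbar log r\<^sup>2\<close>, and of the flat form of the torus. The form \<open>\<i> \<partial>dbar log r\<^sup>2\<close> is semi-positive
  and, on the Hopf plane, degenerates exactly along the complex line through the base point, so the
  parameter a rescales the orthogonal complement of this line: on the Riemannian side, the Hopf factor is the
  product of a line with a Berger sphere whose Hopf fibres are kept and whose base is rescaled by a.

  The function \<open>log r\<^sup>2\<close> is defined on the quotient up to an additive constant, hence
  \<open>dbar log r\<^sup>2\<close> is a global form and \<open>\<omega>_a - \<omega>_a'\<close> is the image under \<open>\<partial>\<close> of a multiple of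
  it: all these metrics have the same Aeppli class (\<open>del_dbar_log\<close>). The determinant of \<open>\<omega>_a\<close> is
  \<open>a r\<^sup>-\<^sup>4\<close> (\<open>det_metric\<close>), so the Chern-Ricci form is \<open>2 \<i> \<partial>dbar log r\<^sup>2\<close> for every a. It is
  semi-positive, and its trace with respect to \<open>\<omega>_a\<close> is 2 / a (\<open>chern_ricci_metric\<close>,
  \<open>chern_scalar_metric\<close>).

  The metrics are Gauduchon for two reasons. First, \<open>\<partial>dbar \<omega>_a = 0\<close>, because \<open>r\<^sup>-\<^sup>2\<close> is
  harmonic on \<open>\<complex>\<^sup>2 - 0\<close> and \<open>\<partial>dbar log r\<^sup>2\<close> is closed (\<open>herm_dz_dzbar_antisymmetric\<close>). Second,
  \<open>\<partial>\<omega>_a \<and> dbar \<omega>_a\<close> is a form of type (3,3) in the coordinates of the two-dimensional Hopf plane and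
  vanishes (\<open>herm_dz_dzbar_alternating_product\<close>). By the product rule every summand of
  \<open>\<partial>dbar \<omega>_a\<^sup>n\<^sup>-\<^sup>1\<close> contains one of these two factors (\<open>del_delbar_wedge_power\<close>). The algebra of
  forms rests on writing every form as an antisymmetrised function of its arguments: the wedge product
  and the operators d, \<open>\<partial>\<close>, dbar then act on the function before antisymmetrisation
  (\<open>wedge_alternation\<close>, \<open>ext_deriv_by_alternation\<close>), and a form vanishes as soon as the function has
  the right symmetry.

  Finally, the Levi-Civita connection has a closed form (\<open>levi_civita_riem_metric\<close>). Taking
  traces, the scalar curvature of \<open>\<omega>_a\<close> is the constant \<open>(4 a - 1) / a\<^sup>2\<close>
  (\<open>scalar_curv_riem_metric\<close>), which is positive, zero and negative for a = 1, 1/4 and 1/8.\<close>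

section \<open>Alternation and the exterior calculus\<close>

text \<open>Unlike the usual antisymmetrisation, this sum is not divided by the factorial of N. With this
  normalisation, wedge products and exterior derivatives of alternations carry no combinatorial
  factors.\<close>

definition alternation :: "nat \<Rightarrow> ((nat \<Rightarrow> 'v) \<Rightarrow> complex) \<Rightarrow> (nat \<Rightarrow> 'v) \<Rightarrow> complex" where
  "alternation N F v = (\<Sum>\<sigma> | \<sigma> permutes {..<N}. of_int (sign \<sigma>) * F (v \<circ> \<sigma>))"

lemma finite_permutes_lessThan: "finite {\<sigma>. \<sigma> permutes {..<N::nat}}"
  by (rule finite_permutations) simp

lemma alternation_permute:
  assumes t: "\<tau> permutes {..<N}"
  shows "alternation N (\<lambda>w. F (w \<circ> \<tau>)) v = of_int (sign \<tau>) * alternation N F v"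
proof -
  have pt: "permutation \<tau>"
    by (rule permutation_permutes[THEN iffD2]) (use t in blast)
  have sg: "sign (\<sigma> \<circ> \<tau>) = sign \<sigma> * sign \<tau>" if "\<sigma> permutes {..<N}" for \<sigma>
  proof -
    have "permutation \<sigma>"
      by (rule permutation_permutes[THEN iffD2]) (use that in blast)
    then show ?thesis using pt by (rule sign_compose)
  qed
  have "alternation N F v =
      (\<Sum>\<sigma> | \<sigma> permutes {..<N}. of_int (sign (\<sigma> \<circ> \<tau>)) * F (v \<circ> (\<sigma> \<circ> \<tau>)))"
    unfolding alternation_def
    by (rule sum_permutations_compose_right[OF t])
  also have "\<dots> = (\<Sum>\<sigma> | \<sigma> permutes {..<N}. of_int (sign \<tau>) * (of_int (sign \<sigma>) * F ((v \<circ> \<sigma>) \<circ> \<tau>)))"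
    by (rule sum.cong) (auto simp: sg o_assoc)
  also have "\<dots> = of_int (sign \<tau>) * alternation N (\<lambda>w. F (w \<circ> \<tau>)) v"
    by (simp add: alternation_def sum_distrib_left)
  finally have "of_int (sign \<tau>) * alternation N F v =
      of_int (sign \<tau> * sign \<tau>) * alternation N (\<lambda>w. F (w \<circ> \<tau>)) v"
    by (simp only: of_int_mult mult.assoc)
  then show ?thesis by (simp only: sign_idempotent of_int_1 mult_1_left)
qed

lemma alternation_transpose:
  assumes "i < N" "j < N" "i \<noteq> j"
  shows "alternation N (\<lambda>w. F (w \<circ> Transposition.transpose i j)) v = - alternation N F v"
  using assms by (subst alternation_permute) (auto intro!: permutes_swap_id simp: sign_swap_id)

lemma alternation_symmetric:
  assumes "i < N" "j < N" "i \<noteq> j" "\<And>w. F (w \<circ> Transposition.transpose i j) = F w"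
  shows "alternation N F v = 0"
proof -
  have "alternation N F v = - alternation N F v"
    using alternation_transpose[OF assms(1-3), of F v] assms(4) by simp
  then show ?thesis by simp
qed

lemma alternation_add: "alternation N (\<lambda>w. F w + G w) v = alternation N F v + alternation N G v"
  by (simp add: alternation_def sum.distrib algebra_simps)

lemma alternation_cmult: "alternation N (\<lambda>w. c * F w) v = c * alternation N F v"
  by (simp add: alternation_def sum_distrib_left algebra_simps)

lemma alternation_diff: "alternation N (\<lambda>w. F w - G w) v = alternation N F v - alternation N G v"
  by (simp add: alternation_def sum_subtractf algebra_simps)

lemma alternation_sum:
  "alternation N (\<lambda>w. \<Sum>l\<in>L. F l w) v = (\<Sum>l\<in>L. alternation N (F l) v)"
  unfolding alternation_def by (simp add: sum_distrib_left) (rule sum.swap)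

lemma alternation_zero: "(\<And>w. F w = 0) \<Longrightarrow> alternation N F v = 0"
  by (simp add: alternation_def)

lemma alternation_cong: "(\<And>w. F w = G w) \<Longrightarrow> alternation N F v = alternation N G v"
  by (simp add: alternation_def)

lemma alternation_0: "alternation 0 F v = F v"
  by (simp add: alternation_def)

lemma alternation_1: "alternation (Suc 0) F v = F v"
proof -
  have "{\<sigma>. \<sigma> permutes {..<Suc 0}} = {id}"
    by (auto simp: lessThan_Suc permutes_sing)
  then show ?thesis by (simp add: alternation_def)
qed

lemma alternation_2: "alternation 2 F v = F v - F (v \<circ> Transposition.transpose 0 1)"
proof -
  have e: "{..<2} = {0, 1::nat}" by auto
  have "{\<sigma>. \<sigma> permutes {..<2::nat}} = {id, Transposition.transpose 0 1}"
    unfolding e by (auto simp: permutes_doubleton_iff)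
  moreover have "id \<noteq> Transposition.transpose 0 (1::nat)" by (metis id_apply transpose_apply_first zero_neq_one)
  ultimately show ?thesis by (simp add: alternation_def sign_swap_id)
qed

lemma sign_comp_permutes:
  fixes N :: nat
  assumes "\<sigma> permutes {..<N}" "\<tau> permutes {..<N}"
  shows "sign (\<sigma> \<circ> \<tau>) = sign \<sigma> * sign \<tau>"
  by (rule sign_compose; rule permutation_permutes[THEN iffD2]) (use assms in blast)+

text \<open>The product of the two inner antisymmetrisations over p and q entries is absorbed by the outer one
  over p + q entries: extending permutations of the two blocks to all entries, each of the p! q! pairs
  contributes the same alternation, which cancels the denominator in the wedge product.\<close>

lemma wedge_alternation:
  fixes F G :: "'n::finite altform"
  assumes F: "\<And>v w. (\<And>i. i < p \<Longrightarrow> v i = w i) \<Longrightarrow> F v = F w"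
  shows "wedge p q (alternation p F) (alternation q G) v =
    alternation (p + q) (\<lambda>w. F w * G (\<lambda>i. w (p + i))) v"
proof -
  let ?P = "\<lambda>n. {\<sigma>. \<sigma> permutes {..<n::nat}}"
  let ?K = "\<lambda>w. F w * G (\<lambda>i. w (p + i))"
  define sh where "sh \<rho> = map_permutation {..<q} ((+) p) \<rho>" for \<rho> :: "nat \<Rightarrow> nat"
  have bij: "bij_betw ((+) p) {..<q} {p..<p+q}"
    by (rule bij_betwI[where g="\<lambda>x. x - p"]) auto
  have shp: "sh \<rho> permutes {p..<p+q}" if "\<rho> permutes {..<q}" for \<rho>
    unfolding sh_def by (rule map_permutation_permutes[OF bij that])
  have shp': "sh \<rho> permutes {..<p+q}" if "\<rho> permutes {..<q}" for \<rho>
    by (rule permutes_subset[OF shp[OF that]]) auto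
  have shs: "sign (sh \<rho>) = sign \<rho>" if "\<rho> permutes {..<q}" for \<rho>
    unfolding sh_def by (rule sign_map_permutation) (use that in auto)
  have sha: "sh \<rho> (p + i) = p + \<rho> i" if r: "\<rho> permutes {..<q}" for \<rho> i
  proof (cases "i < q")
    case True
    then show ?thesis
      unfolding sh_def using map_permutation_apply[of "(+) p" "{..<q}" i \<rho>] by simp
  next
    case False
    then show ?thesis using permutes_not_in[OF shp[OF r], of "p + i"] permutes_not_in[OF r, of i] by simp
  qed
  have shl: "sh \<rho> i = i" if r: "\<rho> permutes {..<q}" and "i < p" for \<rho> i
    using permutes_not_in[OF shp[OF r], of i] that by simp
  have tp: "\<tau> permutes {..<p+q}" if "\<tau> permutes {..<p}" for \<tau>
    by (rule permutes_subset[OF that]) auto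
  have key: "(\<Sum>\<sigma>\<in>?P (p+q). of_int (sign \<sigma>) * (of_int (sign \<tau>) * F ((v \<circ> \<sigma>) \<circ> \<tau>)) *
        (of_int (sign \<rho>) * G ((\<lambda>i. v (\<sigma> (p + i))) \<circ> \<rho>))) = alternation (p + q) ?K v"
    if t: "\<tau> permutes {..<p}" and r: "\<rho> permutes {..<q}" for \<tau> \<rho>
  proof -
    let ?t = "\<tau> \<circ> sh \<rho>"
    have tt: "?t permutes {..<p+q}" by (rule permutes_compose[OF shp'[OF r] tp[OF t]])
    have st: "sign ?t = sign \<tau> * sign \<rho>"
      using sign_comp_permutes[OF tp[OF t] shp'[OF r]] shs[OF r] by simp
    have e: "F ((v \<circ> \<sigma>) \<circ> \<tau>) * G ((\<lambda>i. v (\<sigma> (p + i))) \<circ> \<rho>) = ?K ((v \<circ> \<sigma>) \<circ> ?t)" for \<sigma>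
    proof -
      have "F ((v \<circ> \<sigma>) \<circ> \<tau>) = F ((v \<circ> \<sigma>) \<circ> ?t)"
        by (rule F) (simp add: shl[OF r])
      moreover have "(\<lambda>i. v (\<sigma> (p + i))) \<circ> \<rho> = (\<lambda>i. ((v \<circ> \<sigma>) \<circ> ?t) (p + i))"
        using permutes_not_in[OF t] by (auto simp: fun_eq_iff sha[OF r])
      ultimately show ?thesis by simp
    qed
    have "(\<Sum>\<sigma>\<in>?P (p+q). of_int (sign \<sigma>) * (of_int (sign \<tau>) * F ((v \<circ> \<sigma>) \<circ> \<tau>)) *
        (of_int (sign \<rho>) * G ((\<lambda>i. v (\<sigma> (p + i))) \<circ> \<rho>))) =
       (\<Sum>\<sigma>\<in>?P (p+q). of_int (sign ?t) * (of_int (sign \<sigma>) * ?K ((v \<circ> \<sigma>) \<circ> ?t)))"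
      by (rule sum.cong[OF refl]) (simp only: e[symmetric] st of_int_mult mult_ac)
    also have "\<dots> = of_int (sign ?t) * alternation (p+q) (\<lambda>w. ?K (w \<circ> ?t)) v"
      by (simp only: alternation_def sum_distrib_left)
    also have "\<dots> = of_int (sign ?t * sign ?t) * alternation (p+q) ?K v"
      by (subst alternation_permute[OF tt, of ?K]) (simp only: of_int_mult mult_ac)
    finally show ?thesis by (simp only: sign_idempotent of_int_1 mult_1_left)
  qed
  have "(\<Sum>\<sigma>\<in>?P (p+q). of_int (sign \<sigma>) * alternation p F (\<lambda>i. v (\<sigma> i)) *
            alternation q G (\<lambda>i. v (\<sigma> (p + i)))) =
      (\<Sum>\<sigma>\<in>?P (p+q). \<Sum>\<tau>\<in>?P p. \<Sum>\<rho>\<in>?P q. of_int (sign \<sigma>) * (of_int (sign \<tau>) * F ((v \<circ> \<sigma>) \<circ> \<tau>)) *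
        (of_int (sign \<rho>) * G ((\<lambda>i. v (\<sigma> (p + i))) \<circ> \<rho>)))"
    unfolding alternation_def o_def
    by (simp only: sum_distrib_left[of "of_int _" _ "{\<tau>. \<tau> permutes {..<p}}"]) (simp only: sum_product)
  also have "\<dots> = (\<Sum>\<tau>\<in>?P p. \<Sum>\<sigma>\<in>?P (p+q). \<Sum>\<rho>\<in>?P q. of_int (sign \<sigma>) * (of_int (sign \<tau>) * F ((v \<circ> \<sigma>) \<circ> \<tau>)) *
        (of_int (sign \<rho>) * G ((\<lambda>i. v (\<sigma> (p + i))) \<circ> \<rho>)))"
    by (rule sum.swap)
  also have "\<dots> = (\<Sum>\<tau>\<in>?P p. \<Sum>\<rho>\<in>?P q. \<Sum>\<sigma>\<in>?P (p+q). of_int (sign \<sigma>) * (of_int (sign \<tau>) * F ((v \<circ> \<sigma>) \<circ> \<tau>)) *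
        (of_int (sign \<rho>) * G ((\<lambda>i. v (\<sigma> (p + i))) \<circ> \<rho>)))"
    by (rule sum.cong[OF refl], rule sum.swap)
  also have "\<dots> = (\<Sum>\<tau>\<in>?P p. \<Sum>\<rho>\<in>?P q. alternation (p + q) ?K v)"
    by (intro sum.cong refl) (use key in blast)
  also have "\<dots> = fact p * fact q * alternation (p + q) ?K v"
    by (simp add: card_permutations[OF refl])
  finally show ?thesis
    by (simp add: wedge_def)
qed

text \<open>The cycle that moves entry i to the front and keeps the order of the others: composing a sequence with
  it gives the arguments in the i-th summand of the exterior derivative.\<close>

definition front_cycle :: "nat \<Rightarrow> nat \<Rightarrow> nat" where
  "front_cycle i m = (case m of 0 \<Rightarrow> i | Suc j \<Rightarrow> if j < i then j else Suc j)"

lemma front_cycle_simps [simp]: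
  "front_cycle i 0 = i" "front_cycle i (Suc j) = (if j < i then j else Suc j)"
  by (simp_all add: front_cycle_def)

lemma front_cycle_Suc: "front_cycle (Suc i) = Transposition.transpose i (Suc i) \<circ> front_cycle i"
proof
  fix m show "front_cycle (Suc i) m = (Transposition.transpose i (Suc i) \<circ> front_cycle i) m"
    by (cases m) (auto simp: Transposition.transpose_def)
qed

lemma front_cycle_permutes: "i < N \<Longrightarrow> front_cycle i permutes {..<N} \<and> sign (front_cycle i) = (-1) ^ i"
proof (induction i)
  case 0
  have "front_cycle 0 = id"
    by (auto simp: front_cycle_def fun_eq_iff split: nat.splits)
  then show ?case by (simp add: permutes_id[unfolded id_def] id_def)
next
  case (Suc i)
  have t: "Transposition.transpose i (Suc i) permutes {..<N}"
    using Suc.prems by (intro permutes_swap_id) auto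
  have f: "front_cycle i permutes {..<N}" "sign (front_cycle i) = (-1) ^ i" using Suc by auto
  show ?case unfolding front_cycle_Suc
    using permutes_compose[OF f(1) t] sign_comp_permutes[OF t f(1)] f(2) by (simp add: sign_swap_id del: o_apply)
qed

text \<open>The common properties of the derivative d and of its parts \<open>\<partial>\<close> and dbar that allow moving them
  past the sum over permutations.\<close>

definition linear_operator ::
    "(complex ^ 'n \<Rightarrow> (complex ^ 'n \<Rightarrow> complex) \<Rightarrow> complex ^ 'n::finite \<Rightarrow> complex) \<Rightarrow> bool" where
  "linear_operator D \<longleftrightarrow>
     (\<forall>u f g x. f differentiable (at x) \<longrightarrow> g differentiable (at x) \<longrightarrow>
        D u (\<lambda>y. f y + g y) x = D u f x + D u g x) \<and>
     (\<forall>u f c x. f differentiable (at x) \<longrightarrow> D u (\<lambda>y. c * f y) x = c * D u f x)"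

lemma linear_operator_sum:
  assumes D: "linear_operator D" and "finite T"
    and f: "\<And>t. t \<in> T \<Longrightarrow> f t differentiable (at x)"
  shows "D u (\<lambda>y. \<Sum>t\<in>T. c t * f t y) x = (\<Sum>t\<in>T. c t * D u (f t) x)"
  using \<open>finite T\<close> f
proof (induction T)
  case empty
  have "(\<lambda>y. 0) differentiable (at x)" by simp
  then have "D u (\<lambda>y. 0 * 0) x = 0 * D u (\<lambda>y. 0) x"
    using D unfolding linear_operator_def by fast
  then show ?case by simp
next
  case (insert t T)
  have ft: "(\<lambda>y. c t * f t y) differentiable (at x)" by (intro differentiable_mult differentiable_const insert.prems) simp
  have fT: "(\<lambda>y. \<Sum>t\<in>T. c t * f t y) differentiable (at x)"
    by (intro differentiable_sum ballI differentiable_mult differentiable_const insert.prems insert.hyps) simp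
  have "D u (\<lambda>y. c t * f t y + (\<Sum>t\<in>T. c t * f t y)) x = c t * D u (f t) x + D u (\<lambda>y. \<Sum>t\<in>T. c t * f t y) x"
    using D ft fT insert.prems unfolding linear_operator_def by simp
  then show ?case using insert by simp
qed

text \<open>Every permutation of k + 1 entries is uniquely the composition of a front cycle, which selects the entry in
  which the derivative is taken, with a permutation of the remaining k entries. The signs of the
  front cycles are the signs in the definition of the exterior derivative.\<close>

lemma ext_deriv_by_alternation:
  fixes F :: "complex ^ 'n \<Rightarrow> 'n::finite altform"
  assumes D: "linear_operator D"
    and F: "\<And>w. (\<lambda>y. F y w) differentiable at x"
  shows "ext_deriv_by D k (\<lambda>y. alternation k (F y)) x v =
    alternation (Suc k) (\<lambda>w. D (w 0) (\<lambda>y. F y (\<lambda>i. w (Suc i))) x) v"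
proof -
  let ?P = "\<lambda>n. {\<sigma>. \<sigma> permutes {..<n::nat}}"
  let ?K = "\<lambda>w. D (w 0) (\<lambda>y. F y (\<lambda>i. w (Suc i))) x"
  define up where "up \<tau> = map_permutation {..<k} Suc \<tau>" for \<tau> :: "nat \<Rightarrow> nat"
  have bij: "bij_betw Suc {..<k} {1..<Suc k}"
    by (rule bij_betwI[where g="\<lambda>x. x - 1"]) auto
  have upp: "up \<tau> permutes {1..<Suc k}" if "\<tau> permutes {..<k}" for \<tau>
    unfolding up_def by (rule map_permutation_permutes[OF bij that])
  have upp': "up \<tau> permutes {..<Suc k}" if "\<tau> permutes {..<k}" for \<tau>
    by (rule permutes_subset[OF upp[OF that]]) auto
  have ups: "sign (up \<tau>) = sign \<tau>" if "\<tau> permutes {..<k}" for \<tau>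
    unfolding up_def by (rule sign_map_permutation) (use that in auto)
  have upa: "up \<tau> (Suc i) = Suc (\<tau> i)" if r: "\<tau> permutes {..<k}" for \<tau> i
  proof (cases "i < k")
    case True
    then show ?thesis
      unfolding up_def using map_permutation_apply[of Suc "{..<k}" i \<tau>] by simp
  next
    case False
    then show ?thesis using permutes_not_in[OF upp[OF r], of "Suc i"] permutes_not_in[OF r, of i] by simp
  qed
  have up0: "up \<tau> 0 = 0" if r: "\<tau> permutes {..<k}" for \<tau>
    using permutes_not_in[OF upp[OF r], of 0] by simp
  define \<Phi> where "\<Phi> = (\<lambda>(i, \<tau>). front_cycle i \<circ> up \<tau>)"
  have inj: "inj_on \<Phi> ({..k} \<times> ?P k)"
  proof (rule inj_onI, clarify)
    fix i \<tau> i' \<tau>'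
    assume a: "\<tau> permutes {..<k}" "\<tau>' permutes {..<k}" "i \<le> k" "i' \<le> k" "\<Phi> (i, \<tau>) = \<Phi> (i', \<tau>')"
    have ii: "i = i'"
      using fun_cong[OF a(5), of 0] by (simp add: \<Phi>_def up0 a)
    have injc: "inj (front_cycle i)"
      using front_cycle_permutes[of i "Suc k"] a(3) permutes_inj by fastforce
    have "\<tau> j = \<tau>' j" for j
      using fun_cong[OF a(5), of "Suc j"] injD[OF injc, of "Suc (\<tau> j)" "Suc (\<tau>' j)"]
      by (simp add: \<Phi>_def upa a ii del: front_cycle_simps)
    with ii show "i = i' \<and> \<tau> = \<tau>'" by auto
  qed
  have sub: "\<Phi> ` ({..k} \<times> ?P k) \<subseteq> ?P (Suc k)"
    using front_cycle_permutes[of _ "Suc k"] upp'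
    by (auto simp: \<Phi>_def intro!: permutes_compose)
  \<comment> \<open>Injectivity suffices for surjectivity, as both sides have (k + 1)! elements.\<close>
  have "card (\<Phi> ` ({..k} \<times> ?P k)) = card (?P (Suc k))"
    by (simp add: card_image[OF inj] card_cartesian_product card_permutations[OF refl])
  then have img: "\<Phi> ` ({..k} \<times> ?P k) = ?P (Suc k)"
    by (intro card_subset_eq finite_permutes_lessThan sub)
  have summand: "(-1) ^ i * (of_int (sign \<tau>) *
        D (v i) (\<lambda>y. F y ((\<lambda>j. if j < i then v j else v (Suc j)) \<circ> \<tau>)) x) =
      of_int (sign (\<Phi> (i, \<tau>))) * ?K (v \<circ> \<Phi> (i, \<tau>))"
    if i: "i \<le> k" and t: "\<tau> permutes {..<k}" for i \<tau>
  proof -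
    have fc: "front_cycle i permutes {..<Suc k}" "sign (front_cycle i) = (-1) ^ i"
      using front_cycle_permutes[of i "Suc k"] i by auto
    have s: "sign (\<Phi> (i, \<tau>)) = (-1) ^ i * sign \<tau>"
      by (simp add: \<Phi>_def sign_comp_permutes[OF fc(1) upp'[OF t]] fc(2) ups[OF t])
    have a: "(\<lambda>j. (v \<circ> \<Phi> (i, \<tau>)) (Suc j)) = (\<lambda>j. if j < i then v j else v (Suc j)) \<circ> \<tau>"
      by (auto simp: \<Phi>_def upa[OF t])
    have b: "(v \<circ> \<Phi> (i, \<tau>)) 0 = v i" by (simp add: \<Phi>_def up0[OF t])
    show ?thesis unfolding a b s by simp
  qed
  have "ext_deriv_by D k (\<lambda>y. alternation k (F y)) x v =
    (\<Sum>i\<le>k. (-1) ^ i * (\<Sum>\<tau>\<in>?P k. of_int (sign \<tau>) *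
        D (v i) (\<lambda>y. F y ((\<lambda>j. if j < i then v j else v (Suc j)) \<circ> \<tau>)) x))"
    unfolding ext_deriv_by_def alternation_def
  proof (intro sum.cong refl arg_cong2[where f="(*)"])
    fix i
    let ?v = "\<lambda>j. if j < i then v j else v (Suc j)"
    show "D (v i) (\<lambda>y. \<Sum>\<tau>\<in>?P k. of_int (sign \<tau>) * F y (?v \<circ> \<tau>)) x =
        (\<Sum>\<tau>\<in>?P k. of_int (sign \<tau>) * D (v i) (\<lambda>y. F y (?v \<circ> \<tau>)) x)"
      by (rule linear_operator_sum[where f="\<lambda>\<tau> y. F y (?v \<circ> \<tau>)", OF D finite_permutes_lessThan F])
  qed
  also have "\<dots> = (\<Sum>i\<le>k. \<Sum>\<tau>\<in>?P k. of_int (sign (\<Phi> (i, \<tau>))) * ?K (v \<circ> \<Phi> (i, \<tau>)))"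
    unfolding sum_distrib_left
    by (intro sum.cong refl summand) auto
  also have "\<dots> = (\<Sum>p\<in>{..k} \<times> ?P k. of_int (sign (\<Phi> p)) * ?K (v \<circ> \<Phi> p))"
    by (simp add: sum.cartesian_product)
  also have "\<dots> = (\<Sum>\<sigma>\<in>\<Phi> ` ({..k} \<times> ?P k). of_int (sign \<sigma>) * ?K (v \<circ> \<sigma>))"
    by (simp only: sum.reindex[OF inj] o_def)
  finally show ?thesis unfolding img alternation_def .
qed

lemma alternation_alternating:
  fixes F :: "'n::finite altform"
  assumes loc: "\<And>v w. (\<And>i. i < k \<Longrightarrow> v i = w i) \<Longrightarrow> F v = F w"
    and lin: "\<And>i v. i < k \<Longrightarrow> linear (\<lambda>u. F (v(i := u)))"
  shows "alternating_form k (alternation k F)"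
  unfolding alternating_form_def
proof (intro conjI allI impI)
  fix v w :: "nat \<Rightarrow> complex ^ 'n" assume a: "\<forall>i<k. v i = w i"
  show "alternation k F v = alternation k F w"
    unfolding alternation_def
  proof (intro sum.cong refl arg_cong2[where f="(*)"] loc)
    fix \<sigma> i assume "\<sigma> \<in> {\<sigma>. \<sigma> permutes {..<k}}" "i < k"
    then have "\<sigma> i < k" using permutes_in_image[of \<sigma> "{..<k}" i] by simp
    then show "(v \<circ> \<sigma>) i = (w \<circ> \<sigma>) i" using a by simp
  qed
next
  fix i and v :: "nat \<Rightarrow> complex ^ 'n" assume i: "i < k"
  have e: "v(i := u) \<circ> \<sigma> = (v \<circ> \<sigma>)(inv \<sigma> i := u)" if "\<sigma> permutes {..<k}" for \<sigma> u
  proof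
    fix m
    have "\<sigma> m = i \<longleftrightarrow> m = inv \<sigma> i"
      using permutes_inverses[OF that] by metis
    then show "(v(i := u) \<circ> \<sigma>) m = ((v \<circ> \<sigma>)(inv \<sigma> i := u)) m" by simp
  qed
  have l: "inv \<sigma> i < k" if "\<sigma> permutes {..<k}" for \<sigma>
    using permutes_in_image[OF permutes_inv[OF that], of i] i by simp
  have "linear (\<lambda>u. \<Sum>\<sigma> | \<sigma> permutes {..<k}. of_int (sign \<sigma>) * F ((v \<circ> \<sigma>)(inv \<sigma> i := u)))"
  proof (rule linear_compose_sum, intro ballI)
    fix \<sigma> assume "\<sigma> \<in> {\<sigma>. \<sigma> permutes {..<k}}"
    then have "linear (\<lambda>u. F ((v \<circ> \<sigma>)(inv \<sigma> i := u)))" by (intro lin l) simp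
    then show "linear (\<lambda>u. of_int (sign \<sigma>) * F ((v \<circ> \<sigma>)(inv \<sigma> i := u)))"
      by (auto simp: linear_iff algebra_simps)
  qed
  moreover have "(\<lambda>u. alternation k F (v(i := u))) =
      (\<lambda>u. \<Sum>\<sigma> | \<sigma> permutes {..<k}. of_int (sign \<sigma>) * F ((v \<circ> \<sigma>)(inv \<sigma> i := u)))"
    unfolding alternation_def by (intro ext sum.cong refl arg_cong2[where f="(*)"]) (simp add: e)
  ultimately show "linear (\<lambda>u. alternation k F (v(i := u)))" by simp
next
  fix i j and v :: "nat \<Rightarrow> complex ^ 'n" assume a: "i < k" "j < k" "i \<noteq> j" "v i = v j"
  let ?t = "Transposition.transpose i j"
  have vt: "v \<circ> ?t = v" using a(4) by (auto simp: fun_eq_iff Transposition.transpose_def)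
  have t: "?t permutes {..<k}" using a by (intro permutes_swap_id) auto
  have "alternation k F v = (\<Sum>\<sigma> | \<sigma> permutes {..<k}. of_int (sign (?t \<circ> \<sigma>)) * F (v \<circ> (?t \<circ> \<sigma>)))"
    unfolding alternation_def
    by (rule setum_permutations_compose_left[OF t])
  also have "\<dots> = (\<Sum>\<sigma> | \<sigma> permutes {..<k}. - (of_int (sign \<sigma>) * F (v \<circ> \<sigma>)))"
    using a(3) by (intro sum.cong refl) (auto simp: sign_comp_permutes[OF t] sign_swap_id o_assoc vt)
  also have "\<dots> = - alternation k F v"
    by (simp add: alternation_def sum_negf)
  finally show "alternation k F v = 0" by simp
qed

section \<open>Smooth functions and Wirtinger derivatives\<close>

lemma dderiv_eq: "(f has_derivative f') (at x) \<Longrightarrow> dderiv v f x = f' v"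
  unfolding dderiv_def by (metis frechet_derivative_at)

lemma has_derivative_cong_open:
  assumes "open S" "x \<in> S" "\<And>y. y \<in> S \<Longrightarrow> f y = g y"
  shows "(f has_derivative f') (at x) \<longleftrightarrow> (g has_derivative f') (at x)"
  using has_derivative_transform_within_open[OF _ assms(1,2), of f f' UNIV g]
    has_derivative_transform_within_open[OF _ assms(1,2), of g f' UNIV f] assms(3) by auto

lemma dderiv_cong_open:
  assumes "open S" "x \<in> S" "\<And>y. y \<in> S \<Longrightarrow> f y = g y"
  shows "dderiv v f x = dderiv v g x"
  unfolding dderiv_def frechet_derivative_def
  using has_derivative_cong_open[OF assms] by simp

text \<open>Openness of S makes the derivatives of f and g agree on S. The closure properties below are proved by
  induction on k with this lemma, as the derivatives of sums and products are known on S only.\<close>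

lemma Ck_on_cong:
  assumes "open S" "\<And>y. y \<in> S \<Longrightarrow> f y = g y" "Ck_on k f S"
  shows "Ck_on k g S"
  using assms(2,3)
proof (induction k arbitrary: f g)
  case 0
  then show ?case using continuous_on_cong[of S S f g] by simp
next
  case (Suc k)
  have "g differentiable (at x)" if "x \<in> S" for x
  proof -
    obtain f' where "(f has_derivative f') (at x)"
      using Suc.prems(2) \<open>x \<in> S\<close> by (auto simp: differentiable_def)
    then have "(g has_derivative f') (at x)"
      using has_derivative_cong_open[OF assms(1) that, of f g] Suc.prems(1) by blast
    then show ?thesis by (auto simp: differentiable_def)
  qed
  moreover have "Ck_on k (dderiv v g) S" for v
  proof (rule Suc.IH)
    show "dderiv v f y = dderiv v g y" if "y \<in> S" for y
      by (rule dderiv_cong_open[OF assms(1) that Suc.prems(1)])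
    show "Ck_on k (dderiv v f) S" using Suc.prems(2) by simp
  qed
  ultimately show ?case by simp
qed

lemma Ck_on_lower: "Ck_on (Suc k) f S \<Longrightarrow> Ck_on k f S"
proof (induction k arbitrary: f)
  case 0
  then show ?case
    by (auto intro!: continuous_at_imp_continuous_on differentiable_imp_continuous_within)
next
  case (Suc k)
  then show ?case by simp
qed

lemma Ck_on_subset: "Ck_on k f S \<Longrightarrow> T \<subseteq> S \<Longrightarrow> Ck_on k f T"
  by (induction k arbitrary: f) (auto intro: continuous_on_subset)

lemma smooth_on_subset: "smooth_on f S \<Longrightarrow> T \<subseteq> S \<Longrightarrow> smooth_on f T"
  by (auto simp: smooth_on_def intro: Ck_on_subset)

lemma smooth_on_const: "smooth_on (\<lambda>x. c) S"
proof -
  have "Ck_on k (\<lambda>x. c) S" for k and c :: 'b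
  proof (induction k arbitrary: c)
    case (Suc k)
    have "dderiv v (\<lambda>x::'a. c) = (\<lambda>x. 0)" for v
      by (intro ext dderiv_eq[where f'="\<lambda>v. 0", simplified]) simp
    then show ?case using Suc by simp
  qed simp
  then show ?thesis by (simp add: smooth_on_def)
qed

lemma smooth_on_bounded_linear:
  assumes "bounded_linear f"
  shows "smooth_on f S"
  unfolding smooth_on_def
proof
  fix k show "Ck_on k f S"
  proof (cases k)
    case 0
    then show ?thesis using assms by (simp add: linear_continuous_on)
  next
    case (Suc l)
    have d: "(f has_derivative f) (at x)" for x
      using assms by (rule bounded_linear_imp_has_derivative)
    then have "dderiv v f = (\<lambda>x. f v)" for v
      by (intro ext dderiv_eq)
    then show ?thesis
      using Suc d smooth_on_const[of _ S] by (auto simp: smooth_on_def differentiable_def)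
  qed
qed

lemma Ck_on_add:
  assumes "open S"
  shows "Ck_on k f S \<Longrightarrow> Ck_on k g S \<Longrightarrow> Ck_on k (\<lambda>x. f x + g x) S"
proof (induction k arbitrary: f g)
  case 0
  then show ?case by (simp add: continuous_on_add)
next
  case (Suc k)
  have e: "dderiv v f x + dderiv v g x = dderiv v (\<lambda>x. f x + g x) x" if "x \<in> S" for v x
  proof -
    have "(f has_derivative frechet_derivative f (at x)) (at x)"
      "(g has_derivative frechet_derivative g (at x)) (at x)"
      using Suc.prems that by (auto simp: frechet_derivative_works[symmetric])
    from dderiv_eq[OF has_derivative_add[OF this], of v] show ?thesis by (simp add: dderiv_def)
  qed
  have d: "Ck_on k (dderiv v f) S" "Ck_on k (dderiv v g) S" for v
    using Suc.prems by auto
  have "Ck_on k (dderiv v (\<lambda>x. f x + g x)) S" for v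
    by (rule Ck_on_cong[OF assms e Suc.IH[OF d]])
  moreover have "(\<lambda>x. f x + g x) differentiable (at x)" if "x \<in> S" for x
    using Suc.prems that by (intro differentiable_add) auto
  ultimately show ?case by simp
qed

lemma Ck_on_mult:
  fixes f g :: "'a::euclidean_space \<Rightarrow> complex"
  assumes "open S"
  shows "Ck_on k f S \<Longrightarrow> Ck_on k g S \<Longrightarrow> Ck_on k (\<lambda>x. f x * g x) S"
proof (induction k arbitrary: f g)
  case 0
  then show ?case by (simp add: continuous_on_mult)
next
  case (Suc k)
  have e: "f x * dderiv v g x + dderiv v f x * g x = dderiv v (\<lambda>x. f x * g x) x" if "x \<in> S" for v x
  proof -
    have "(f has_derivative frechet_derivative f (at x)) (at x)"
      "(g has_derivative frechet_derivative g (at x)) (at x)"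
      using Suc.prems that by (auto simp: frechet_derivative_works[symmetric])
    from dderiv_eq[OF has_derivative_mult[OF this], of v] show ?thesis by (simp add: dderiv_def)
  qed
  have d: "Ck_on k (dderiv v f) S" "Ck_on k (dderiv v g) S" for v
    using Suc.prems by auto
  have "Ck_on k (dderiv v (\<lambda>x. f x * g x)) S" for v
    by (rule Ck_on_cong[OF assms e Ck_on_add[OF assms
          Suc.IH[OF Ck_on_lower[OF Suc.prems(1)] d(2)] Suc.IH[OF d(1) Ck_on_lower[OF Suc.prems(2)]]]])
  moreover have "(\<lambda>x. f x * g x) differentiable (at x)" if "x \<in> S" for x
    using Suc.prems that by (intro differentiable_mult) auto
  ultimately show ?case by simp
qed

lemma Ck_on_inverse:
  fixes f :: "'a::euclidean_space \<Rightarrow> complex"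
  assumes "open S" and nz: "\<And>x. x \<in> S \<Longrightarrow> f x \<noteq> 0"
  shows "Ck_on k f S \<Longrightarrow> Ck_on k (\<lambda>x. inverse (f x)) S"
proof (induction k)
  case 0
  then show ?case using nz by (auto intro!: continuous_on_inverse)
next
  case (Suc k)
  have d: "((\<lambda>x. inverse (f x)) has_derivative
      (\<lambda>h. - (inverse (f x) * frechet_derivative f (at x) h * inverse (f x)))) (at x)" if "x \<in> S" for x
    using Suc.prems that nz[OF that]
    by (intro Deriv.has_derivative_inverse) (auto simp: frechet_derivative_works[symmetric])
  have e: "(- 1) * (inverse (f x) * (dderiv v f x * inverse (f x))) = dderiv v (\<lambda>x. inverse (f x)) x"
    if "x \<in> S" for v x
    using dderiv_eq[OF d[OF that], of v] by (simp add: dderiv_def mult.assoc)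
  have I: "Ck_on k (\<lambda>x. inverse (f x)) S" using Suc.IH Ck_on_lower[OF Suc.prems] by blast
  have c: "Ck_on k (\<lambda>x. - 1 :: complex) S" using smooth_on_const smooth_on_def by blast
  have f': "Ck_on k (dderiv v f) S" for v
    using Suc.prems by simp
  have "Ck_on k (dderiv v (\<lambda>x. inverse (f x))) S" for v
    by (rule Ck_on_cong[OF assms(1) e Ck_on_mult[OF assms(1) c Ck_on_mult[OF assms(1) I
          Ck_on_mult[OF assms(1) f' I]]]])
  then show ?case using d by (auto simp: differentiable_def)
qed

lemma smooth_on_add:
  "open S \<Longrightarrow> smooth_on f S \<Longrightarrow> smooth_on g S \<Longrightarrow> smooth_on (\<lambda>x. f x + g x) S"
  by (simp add: smooth_on_def Ck_on_add)

lemma smooth_on_mult: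
  fixes f g :: "'a::euclidean_space \<Rightarrow> complex"
  shows "open S \<Longrightarrow> smooth_on f S \<Longrightarrow> smooth_on g S \<Longrightarrow> smooth_on (\<lambda>x. f x * g x) S"
  by (simp add: smooth_on_def Ck_on_mult)

lemma smooth_on_diff:
  fixes f g :: "'a::euclidean_space \<Rightarrow> complex"
  assumes "open S" "smooth_on f S" "smooth_on g S"
  shows "smooth_on (\<lambda>x. f x - g x) S"
  using smooth_on_add[OF assms(1,2) smooth_on_mult[OF assms(1) smooth_on_const[of "- 1"] assms(3)]] by simp

lemma smooth_on_inverse:
  fixes f :: "'a::euclidean_space \<Rightarrow> complex"
  shows "open S \<Longrightarrow> (\<And>x. x \<in> S \<Longrightarrow> f x \<noteq> 0) \<Longrightarrow> smooth_on f S \<Longrightarrow> smooth_on (\<lambda>x. inverse (f x)) S"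
  by (simp add: smooth_on_def Ck_on_inverse)

text \<open>The derivative of f at x is split into its complex linear part A and its complex antilinear part B. They
  are unique, and are the values of the operators \<open>\<partial>\<close> and dbar on f.\<close>

definition wirtinger ::
    "(complex ^ 'n::finite \<Rightarrow> complex) \<Rightarrow> complex ^ 'n \<Rightarrow>
     (complex ^ 'n \<Rightarrow> complex) \<Rightarrow> (complex ^ 'n \<Rightarrow> complex) \<Rightarrow> bool" where
  "wirtinger f x A B \<longleftrightarrow> (f has_derivative (\<lambda>v. A v + B v)) (at x) \<and>
     (\<forall>v. A (\<i> *s v) = \<i> * A v) \<and> (\<forall>v. B (\<i> *s v) = - (\<i> * B v))"

lemma wirtinger_dderiv: "wirtinger f x A B \<Longrightarrow> dderiv v f x = A v + B v"
  using dderiv_eq[of f "\<lambda>v. A v + B v" x v] by (simp add: wirtinger_def)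

lemma wirtinger_dz: "wirtinger f x A B \<Longrightarrow> dz_deriv v f x = A v"
  unfolding dz_deriv_def using wirtinger_dderiv[of f x A B]
  by (simp add: wirtinger_def field_simps)

lemma wirtinger_dzbar: "wirtinger f x A B \<Longrightarrow> dzbar_deriv v f x = B v"
  unfolding dzbar_deriv_def using wirtinger_dderiv[of f x A B]
  by (simp add: wirtinger_def field_simps)

lemma wirtinger_differentiable: "wirtinger f x A B \<Longrightarrow> f differentiable (at x)"
  by (auto simp: wirtinger_def differentiable_def)

lemma wirtinger_eqI:
  "wirtinger f x A B \<Longrightarrow> (\<And>v. A v = A' v) \<Longrightarrow> (\<And>v. B v = B' v) \<Longrightarrow> wirtinger f x A' B'"
  by (metis ext)

text \<open>For the second of two derivatives only the complex linear part matters, and the antilinear part can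
  remain unspecified.\<close>

lemma wirtinger_exI: "wirtinger f x A B \<Longrightarrow> (\<And>v. A v = A' v) \<Longrightarrow> \<exists>B. wirtinger f x A' B"
  by (metis ext)

lemma wirtinger_const: "wirtinger (\<lambda>x. c) x (\<lambda>v. 0) (\<lambda>v. 0)"
  by (simp add: wirtinger_def)

lemma wirtinger_coord: "wirtinger (\<lambda>x. x $ i) x (\<lambda>v. v $ i) (\<lambda>v. 0)"
  using bounded_linear_imp_has_derivative[OF bounded_linear_vec_nth[of i]] by (simp add: wirtinger_def)

lemma wirtinger_cnj_coord: "wirtinger (\<lambda>x. cnj (x $ i)) x (\<lambda>v. 0) (\<lambda>v. cnj (v $ i))"
  using bounded_linear_imp_has_derivative[OF bounded_linear_compose[OF bounded_linear_cnj bounded_linear_vec_nth[of i]]]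
  by (simp add: wirtinger_def)

lemma wirtinger_add:
  "wirtinger f x A B \<Longrightarrow> wirtinger g x A' B' \<Longrightarrow>
   wirtinger (\<lambda>x. f x + g x) x (\<lambda>v. A v + A' v) (\<lambda>v. B v + B' v)"
  unfolding wirtinger_def
  by (auto intro!: has_derivative_eq_rhs[OF has_derivative_add] simp: algebra_simps)

lemma wirtinger_mult:
  "wirtinger f x A B \<Longrightarrow> wirtinger g x A' B' \<Longrightarrow>
   wirtinger (\<lambda>x. f x * g x) x (\<lambda>v. f x * A' v + A v * g x) (\<lambda>v. f x * B' v + B v * g x)"
  unfolding wirtinger_def
  by (auto intro!: has_derivative_eq_rhs[OF has_derivative_mult] simp: algebra_simps)

lemma wirtinger_cmult:
  "wirtinger f x A B \<Longrightarrow> wirtinger (\<lambda>x. c * f x) x (\<lambda>v. c * A v) (\<lambda>v. c * B v)"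
  using wirtinger_mult[OF wirtinger_const[of c]] by simp

lemma wirtinger_diff:
  "wirtinger f x A B \<Longrightarrow> wirtinger g x A' B' \<Longrightarrow>
   wirtinger (\<lambda>x. f x - g x) x (\<lambda>v. A v - A' v) (\<lambda>v. B v - B' v)"
  unfolding wirtinger_def
  by (auto intro!: has_derivative_eq_rhs[OF has_derivative_diff] simp: algebra_simps)

lemma wirtinger_inverse:
  "wirtinger f x A B \<Longrightarrow> f x \<noteq> 0 \<Longrightarrow>
   wirtinger (\<lambda>x. inverse (f x)) x (\<lambda>v. - (A v * inverse (f x) ^ 2)) (\<lambda>v. - (B v * inverse (f x) ^ 2))"
  unfolding wirtinger_def
  by (auto intro!: has_derivative_eq_rhs[OF Deriv.has_derivative_inverse] simp: algebra_simps power2_eq_square)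

lemma wirtinger_Ln:
  assumes "wirtinger f x A B" "f x \<notin> \<real>\<^sub>\<le>\<^sub>0"
  shows "wirtinger (\<lambda>x. Ln (f x)) x (\<lambda>v. A v * inverse (f x)) (\<lambda>v. B v * inverse (f x))"
proof -
  have "((\<lambda>x. Ln (f x)) has_derivative (\<lambda>v. inverse (f x) * (A v + B v))) (at x)"
    using has_derivative_compose[of f "\<lambda>v. A v + B v" x UNIV Ln "(*) (inverse (f x))"]
      has_field_derivative_Ln[OF assms(2)] assms(1)
    by (simp add: wirtinger_def has_field_derivative_def)
  then show ?thesis using assms(1)
    by (auto simp: wirtinger_def algebra_simps)
qed

lemma wirtinger_sum:
  assumes "finite L" "\<And>l. l \<in> L \<Longrightarrow> wirtinger (f l) x (A l) (B l)"
  shows "wirtinger (\<lambda>x. \<Sum>l\<in>L. f l x) x (\<lambda>v. \<Sum>l\<in>L. A l v) (\<lambda>v. \<Sum>l\<in>L. B l v)"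
  using assms by (induction L rule: finite_induct) (auto intro: wirtinger_const wirtinger_add)

lemma wirtinger_prod:
  assumes "finite L" "\<And>l. l \<in> L \<Longrightarrow> wirtinger (f l) x (A l) (B l)"
  shows "wirtinger (\<lambda>x. \<Prod>l\<in>L. f l x) x (\<lambda>v. \<Sum>l\<in>L. A l v * (\<Prod>k\<in>L - {l}. f k x))
           (\<lambda>v. \<Sum>l\<in>L. B l v * (\<Prod>k\<in>L - {l}. f k x))"
  using assms
proof (induction L rule: finite_induct)
  case empty
  then show ?case by (simp add: wirtinger_const)
next
  case (insert a L)
  have d: "(\<Prod>k\<in>insert a L - {l}. f k x) = f a x * (\<Prod>k\<in>L - {l}. f k x)" if "l \<in> L" for l
  proof -
    have "insert a L - {l} = insert a (L - {l})" using insert.hyps that by auto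
    then show ?thesis using insert.hyps by simp
  qed
  have s: "(\<Sum>l\<in>L. C l * (\<Prod>k\<in>insert a L - {l}. f k x)) = f a x * (\<Sum>l\<in>L. C l * (\<Prod>k\<in>L - {l}. f k x))"
    for C :: "_ \<Rightarrow> complex"
    by (simp add: sum_distrib_left d mult_ac cong: sum.cong)
  have m: "wirtinger (\<lambda>x. f a x * (\<Prod>l\<in>L. f l x)) x
      (\<lambda>v. f a x * (\<Sum>l\<in>L. A l v * (\<Prod>k\<in>L - {l}. f k x)) + A a v * (\<Prod>l\<in>L. f l x))
      (\<lambda>v. f a x * (\<Sum>l\<in>L. B l v * (\<Prod>k\<in>L - {l}. f k x)) + B a v * (\<Prod>l\<in>L. f l x))"
    using insert by (intro wirtinger_mult) auto
  have i: "insert a L - {a} = L" using insert.hyps by auto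
  show ?case using insert.hyps
    by (simp add: i s) (rule wirtinger_eqI[OF m]; simp)
qed

lemma linear_operator_dderiv: "linear_operator (dderiv :: complex ^ 'n::finite \<Rightarrow> _)"
  unfolding linear_operator_def
proof (intro conjI allI impI)
  fix u x and f g :: "complex ^ 'n \<Rightarrow> complex"
  assume "f differentiable (at x)" "g differentiable (at x)"
  then show "dderiv u (\<lambda>y. f y + g y) x = dderiv u f x + dderiv u g x"
    by (subst dderiv_eq[OF has_derivative_add]) (auto simp: dderiv_def frechet_derivative_works)
next
  fix u x c and f :: "complex ^ 'n \<Rightarrow> complex"
  assume "f differentiable (at x)"
  then show "dderiv u (\<lambda>y. c * f y) x = c * dderiv u f x"
    by (subst dderiv_eq[OF has_derivative_mult_right]) (auto simp: dderiv_def frechet_derivative_works)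
qed

lemma linear_operator_dz: "linear_operator (dz_deriv :: complex ^ 'n::finite \<Rightarrow> _)"
  using linear_operator_dderiv[where 'n='n] unfolding linear_operator_def dz_deriv_def
  by (auto simp: algebra_simps add_divide_distrib diff_divide_distrib)

lemma linear_operator_dzbar: "linear_operator (dzbar_deriv :: complex ^ 'n::finite \<Rightarrow> _)"
  using linear_operator_dderiv[where 'n='n] unfolding linear_operator_def dzbar_deriv_def
  by (auto simp: algebra_simps add_divide_distrib diff_divide_distrib)

section \<open>Powers of (1,1)-forms and their derivatives\<close>

definition sesquilinear :: "(complex ^ 'n \<Rightarrow> complex ^ 'n::finite \<Rightarrow> complex) \<Rightarrow> bool" where
  "sesquilinear s \<longleftrightarrow>
     (\<forall>v v' w. s (v + v') w = s v w + s v' w) \<and> (\<forall>c v w. s (c *s v) w = c * s v w) \<and>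
     (\<forall>v w w'. s v (w + w') = s v w + s v w') \<and> (\<forall>c v w. s v (c *s w) = cnj c * s v w)"

text \<open>The coefficient matrix of a sesquilinear map, so that Hermitian metrics can be written and differentiated
  free of coordinates.\<close>

definition gram :: "(complex ^ 'n \<Rightarrow> complex ^ 'n \<Rightarrow> complex) \<Rightarrow> complex ^ 'n ^ 'n::finite" where
  "gram s = (\<chi> i j. s (axis i 1) (axis j 1))"

lemma sesq_gram:
  assumes s: "sesquilinear s"
  shows "sesq (gram s) v w = s v w"
proof -
  have z: "s 0 w = 0" "s v 0 = 0" for v w
    using s unfolding sesquilinear_def by (metis add_cancel_right_left)+
  have l: "s (\<Sum>i\<in>T. f i) w = (\<Sum>i\<in>T. s (f i) w)" if "finite T" for T :: "'a set" and f w
    using that s by (induction T rule: finite_induct) (auto simp: z sesquilinear_def)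
  have r: "s w (\<Sum>i\<in>T. f i) = (\<Sum>i\<in>T. s w (f i))" if "finite T" for T :: "'a set" and f w
    using that s by (induction T rule: finite_induct) (auto simp: z sesquilinear_def)
  have "s v w = s (\<Sum>i\<in>UNIV. v $ i *s axis i 1) (\<Sum>j\<in>UNIV. w $ j *s axis j 1)"
    by (simp add: basis_expansion)
  also have "\<dots> = (\<Sum>i\<in>UNIV. \<Sum>j\<in>UNIV. s (v $ i *s axis i 1) (w $ j *s axis j 1))"
    by (simp add: l r) (rule sum.swap)
  also have "\<dots> = sesq (gram s) v w"
    using s unfolding sesq_def gram_def sesquilinear_def
    by (intro sum.cong refl) simp
  finally show ?thesis by simp
qed

lemma form11_sesq: "form11 m v = sesq m (v 0) (v 1) - sesq m (v 1) (v 0)"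
  by (simp add: form11_def sesq_def right_diff_distrib sum_subtractf mult_ac)

lemma form11_gram:
  assumes "sesquilinear s"
  shows "form11 (gram s) = alternation 2 (\<lambda>w. s (w 0) (w 1))"
  by (rule ext) (simp add: form11_sesq sesq_gram[OF assms] alternation_2)

lemma sesquilinear_cmult: "sesquilinear s \<Longrightarrow> sesquilinear (\<lambda>v w. c * s v w)"
  by (simp add: sesquilinear_def algebra_simps)

lemma alternating_sesquilinear:
  fixes s :: "complex ^ 'n \<Rightarrow> complex ^ 'n::finite \<Rightarrow> complex"
  assumes "sesquilinear s"
  shows "alternating_form 2 (alternation 2 (\<lambda>w. s (w 0) (w 1)))"
proof (rule alternation_alternating)
  have sc: "r *\<^sub>R (v :: complex ^ 'n) = of_real r *s v" for r v
    by (simp add: vec_eq_iff scaleR_conv_of_real[where 'a=complex])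
  fix i :: nat and v :: "nat \<Rightarrow> complex ^ 'n" assume "i < 2"
  then have "i = 0 \<or> i = 1" by auto
  then show "linear (\<lambda>u. s ((v(i := u)) 0) ((v(i := u)) 1))"
    using assms unfolding linear_iff sc by (auto simp: sesquilinear_def scaleR_conv_of_real[where 'a=complex])
qed auto

lemma dz_deriv_cong_open:
  assumes "open S" "x \<in> S" "\<And>y. y \<in> S \<Longrightarrow> f y = g y"
  shows "dz_deriv v f x = dz_deriv v g x"
  using dderiv_cong_open[OF assms] by (simp add: dz_deriv_def)

lemma ext_deriv_by_wirtinger:
  fixes F :: "complex ^ 'n \<Rightarrow> 'n::finite altform"
  assumes "linear_operator D" "\<And>w. wirtinger (\<lambda>y. F y w) x (A w) (B w)"
    and "\<And>f A B v. wirtinger f x A B \<Longrightarrow> D v f x = d (A v) (B v)"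
  shows "ext_deriv_by D k (\<lambda>y. alternation k (F y)) x v =
    alternation (Suc k) (\<lambda>w. d (A (\<lambda>i. w (Suc i)) (w 0)) (B (\<lambda>i. w (Suc i)) (w 0))) v"
proof -
  have "ext_deriv_by D k (\<lambda>y. alternation k (F y)) x v =
      alternation (Suc k) (\<lambda>w. D (w 0) (\<lambda>y. F y (\<lambda>i. w (Suc i))) x) v"
    by (rule ext_deriv_by_alternation[OF assms(1) wirtinger_differentiable[OF assms(2)]])
  also have "\<dots> = alternation (Suc k) (\<lambda>w. d (A (\<lambda>i. w (Suc i)) (w 0)) (B (\<lambda>i. w (Suc i)) (w 0))) v"
    by (rule alternation_cong, rule assms(3)[OF assms(2)])
  finally show ?thesis .
qed

text \<open>Two applications of the rule for the exterior derivative of an alternation. The image under dbar is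
  known on the open set S only; as \<open>\<partial>\<close> is a local operator, this suffices.\<close>

lemma del_delbar_alternation:
  fixes F :: "complex ^ 'n \<Rightarrow> 'n::finite altform"
  assumes "open S" "x \<in> S"
    and F: "\<And>y w. y \<in> S \<Longrightarrow> wirtinger (\<lambda>y. F y w) y (A y w) (B y w)"
    and B: "\<And>w t. \<exists>B'. wirtinger (\<lambda>y. B y w t) x (C w t) B'"
  shows "del_delbar k (\<lambda>y. alternation k (F y)) x v =
    alternation (Suc (Suc k)) (\<lambda>w. C (\<lambda>i. w (Suc (Suc i))) (w 1) (w 0)) v"
proof -
  let ?G = "\<lambda>y w. B y (\<lambda>i. w (Suc i)) (w 0)"
  have delbar: "delbar k (\<lambda>y. alternation k (F y)) y = alternation (Suc k) (?G y)" if "y \<in> S" for y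
    unfolding delbar_def
    by (rule ext, rule ext_deriv_by_wirtinger[where d="\<lambda>a b. b" and A="A y" and B="B y"])
      (auto intro: linear_operator_dzbar F[OF that] wirtinger_dzbar)
  obtain B' where B': "\<And>w t. wirtinger (\<lambda>y. B y w t) x (C w t) (B' w t)"
    using B by metis
  have "del_delbar k (\<lambda>y. alternation k (F y)) x v =
      ext_deriv_by dz_deriv (Suc k) (\<lambda>y. alternation (Suc k) (?G y)) x v"
    unfolding del_delbar_def del_def ext_deriv_by_def[of dz_deriv]
    by (intro sum.cong refl arg_cong2[where f="(*)"] dz_deriv_cong_open[OF assms(1,2)])
      (simp add: delbar)
  also have "\<dots> = alternation (Suc (Suc k)) (\<lambda>w. C (\<lambda>i. w (Suc (Suc i))) (w 1) (w 0)) v"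
    unfolding One_nat_def
    by (rule ext_deriv_by_wirtinger[where d="\<lambda>a b. a"
        and A="\<lambda>w. C (\<lambda>i. w (Suc i)) (w 0)" and B="\<lambda>w. B' (\<lambda>i. w (Suc i)) (w 0)"])
      (auto intro: linear_operator_dz B' wirtinger_dz)
  finally show ?thesis .
qed

text \<open>A 2-form of type (1,1) is the alternation of a sesquilinear map in the two arguments. Its m-th
  power is then the alternation of a plain product.\<close>

lemma wedge_power_alternation:
  fixes a :: "'n::finite altform"
  assumes "a = alternation 2 (\<lambda>w. s (w 0) (w 1))"
  shows "wedge_power a m = alternation (2 * m) (\<lambda>w. \<Prod>l<m. s (w (2 * l)) (w (2 * l + 1)))"
proof (induction m)
  case 0
  then show ?case by (auto simp: alternation_0)
next
  case (Suc m)
  show ?case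
  proof
    fix v
    have "wedge_power a (Suc m) v =
        wedge 2 (2 * m) (alternation 2 (\<lambda>w. s (w 0) (w 1)))
          (alternation (2 * m) (\<lambda>w. \<Prod>l<m. s (w (2 * l)) (w (2 * l + 1)))) v"
      by (simp only: wedge_power.simps Suc.IH) (simp only: assms)
    also have "\<dots> = alternation (2 + 2 * m) (\<lambda>w. s (w 0) (w 1) *
        (\<Prod>l<m. s (w (2 + 2 * l)) (w (2 + (2 * l + 1))))) v"
      by (rule wedge_alternation) simp
    also have "\<dots> = alternation (2 * Suc m) (\<lambda>w. \<Prod>l<Suc m. s (w (2 * l)) (w (2 * l + 1))) v"
      by (simp add: prod.lessThan_Suc_shift del: prod.lessThan_Suc)
    finally show "wedge_power a (Suc m) v = \<dots>" .
  qed
qed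

text \<open>It suffices that the antisymmetrisation over two transpositions vanishes, since this partial
  antisymmetrisation multiplies the alternation by 4. It is applied to the pair of (1,0)-arguments and to
  the pair of (0,1)-arguments of \<open>\<partial>dbar \<omega>\<close>.\<close>

lemma alternation_two_pairs:
  assumes "i < N" "j < N" "i \<noteq> j" "i' < N" "j' < N" "i' \<noteq> j'"
    and z: "\<And>w. F w - F (w \<circ> Transposition.transpose i j) - F (w \<circ> Transposition.transpose i' j')
      + F (w \<circ> Transposition.transpose i j \<circ> Transposition.transpose i' j') = 0"
  shows "alternation N F v = 0"
proof -
  let ?t = "Transposition.transpose i j" and ?t' = "Transposition.transpose i' j'"
  have "0 = alternation N (\<lambda>w. F w - F (w \<circ> ?t) - F (w \<circ> ?t') + F (w \<circ> ?t \<circ> ?t')) v"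
    by (rule alternation_zero[symmetric, OF z])
  also have "\<dots> = alternation N F v - alternation N (\<lambda>w. F (w \<circ> ?t)) v
      - alternation N (\<lambda>w. F (w \<circ> ?t')) v + alternation N (\<lambda>w. F (w \<circ> ?t \<circ> ?t')) v"
    by (simp only: alternation_add alternation_diff)
  also have "\<dots> = 4 * alternation N F v"
    using alternation_transpose[OF assms(1-3), of F v] alternation_transpose[OF assms(4-6), of F v]
      alternation_transpose[OF assms(1-3), of "\<lambda>w. F (w \<circ> ?t')" v] by simp
  finally show ?thesis by simp
qed

text \<open>The analogue for the full symmetric group on three entries, whose six elements are written as products
  of transpositions. It is applied to three (1,0)-arguments.\<close>

lemma alternation_three:
  assumes "i < N" "j < N" "k < N" "i \<noteq> j" "i \<noteq> k" "j \<noteq> k"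
    and z: "\<And>w. F w - F (w \<circ> Transposition.transpose i j) - F (w \<circ> Transposition.transpose i k)
      - F (w \<circ> Transposition.transpose j k)
      + F (w \<circ> Transposition.transpose i j \<circ> Transposition.transpose i k)
      + F (w \<circ> Transposition.transpose i k \<circ> Transposition.transpose i j) = 0"
  shows "alternation N F v = 0"
proof -
  let ?ij = "Transposition.transpose i j" and ?ik = "Transposition.transpose i k"
    and ?jk = "Transposition.transpose j k"
  have "0 = alternation N (\<lambda>w. F w - F (w \<circ> ?ij) - F (w \<circ> ?ik) - F (w \<circ> ?jk)
      + F (w \<circ> ?ij \<circ> ?ik) + F (w \<circ> ?ik \<circ> ?ij)) v"
    by (rule alternation_zero[symmetric, OF z])
  also have "\<dots> = alternation N F v - alternation N (\<lambda>w. F (w \<circ> ?ij)) v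
      - alternation N (\<lambda>w. F (w \<circ> ?ik)) v - alternation N (\<lambda>w. F (w \<circ> ?jk)) v
      + alternation N (\<lambda>w. F (w \<circ> ?ij \<circ> ?ik)) v + alternation N (\<lambda>w. F (w \<circ> ?ik \<circ> ?ij)) v"
    by (simp only: alternation_add alternation_diff)
  also have "\<dots> = 6 * alternation N F v"
    using alternation_transpose[OF assms(1,2,4), of F v] alternation_transpose[OF assms(1,3,5), of F v]
      alternation_transpose[OF assms(2,3,6), of F v]
      alternation_transpose[OF assms(1,2,4), of "\<lambda>w. F (w \<circ> ?ik)" v]
      alternation_transpose[OF assms(1,3,5), of "\<lambda>w. F (w \<circ> ?ij)" v] by simp
  finally show ?thesis by simp
qed

text \<open>The Leibniz rule for \<open>\<partial>dbar \<omega>\<^sup>m\<close>. Its summands contain either \<open>\<partial>dbar \<omega>\<close>, with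
  coefficients C, or a product of a factor \<open>\<partial>\<omega>\<close> with a factor dbar \<open>\<omega>\<close>, with coefficients A
  and B. The hypothesis on C expresses that \<open>\<partial>dbar \<omega> = 0\<close>, and the one on A and B that
  antisymmetrising \<open>\<partial>\<omega> \<and> dbar \<omega>\<close> over its three (1,0)-arguments already gives zero.\<close>

lemma del_delbar_wedge_power:
  fixes s :: "complex ^ 'n \<Rightarrow> complex ^ 'n \<Rightarrow> complex ^ 'n::finite \<Rightarrow> complex"
  assumes S: "open S" "x \<in> S"
    and s: "\<And>y v w. y \<in> S \<Longrightarrow> wirtinger (\<lambda>y. s y v w) y (\<lambda>r. A y r v w) (\<lambda>t. B y t v w)"
    and B: "\<And>t v w. \<exists>B'. wirtinger (\<lambda>y. B y t v w) x (\<lambda>r. C r t v w) B'"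
    and C: "\<And>r t v w. C r t v w - C v t r w - C r w v t + C v w r t = 0"
    and AB: "\<And>t w w' r v v'. A x r v' w' * B x t v w - A x v' r w' * B x t v w - A x v v' w' * B x t r w
        - A x r v w' * B x t v' w + A x v r w' * B x t v' w + A x v' v w' * B x t r w = 0"
  shows "del_delbar (2 * m) (\<lambda>y. alternation (2 * m) (\<lambda>w. \<Prod>l<m. s y (w (2 * l)) (w (2 * l + 1)))) x v = 0"
proof -
  let ?P = "\<lambda>y L w. \<Prod>l\<in>L. s y (w (2 * l)) (w (2 * l + 1))"
  let ?L = "{..<m}"
  define F where "F y w = ?P y ?L w" for y w
  define FA where "FA y w r = (\<Sum>l\<in>?L. A y r (w (2 * l)) (w (2 * l + 1)) * ?P y (?L - {l}) w)" for y w r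
  define FB where "FB y w t = (\<Sum>l\<in>?L. B y t (w (2 * l)) (w (2 * l + 1)) * ?P y (?L - {l}) w)" for y w t
  define FC where "FC w t r = (\<Sum>l\<in>?L. B x t (w (2 * l)) (w (2 * l + 1)) *
      (\<Sum>k\<in>?L - {l}. A x r (w (2 * k)) (w (2 * k + 1)) * ?P x (?L - {l} - {k}) w)
      + C r t (w (2 * l)) (w (2 * l + 1)) * ?P x (?L - {l}) w)" for w t r
  have P: "wirtinger (\<lambda>y. ?P y L w) y (\<lambda>r. \<Sum>l\<in>L. A y r (w (2 * l)) (w (2 * l + 1)) * ?P y (L - {l}) w)
      (\<lambda>t. \<Sum>l\<in>L. B y t (w (2 * l)) (w (2 * l + 1)) * ?P y (L - {l}) w)"
    if "finite L" "y \<in> S" for L y w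
    by (rule wirtinger_prod[where A="\<lambda>l r. A y r (w (2 * l)) (w (2 * l + 1))"
        and B="\<lambda>l t. B y t (w (2 * l)) (w (2 * l + 1))", OF that(1) s[OF that(2)]])
  obtain B' where B': "\<And>t v w. wirtinger (\<lambda>y. B y t v w) x (\<lambda>r. C r t v w) (B' t v w)"
    using B by metis
  have F1: "wirtinger (\<lambda>y. F y w) y (FA y w) (FB y w)" if "y \<in> S" for y w
    unfolding F_def FA_def FB_def by (rule P[OF _ that]) simp
  have F2: "\<exists>B'. wirtinger (\<lambda>y. FB y w t) x (FC w t) B'" for w t
    unfolding FB_def FC_def
    by (rule exI, rule wirtinger_sum, simp, rule wirtinger_mult[OF B' P[OF _ S(2)]], simp)
  have "del_delbar (2 * m) (\<lambda>y. alternation (2 * m) (F y)) x v =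
      alternation (Suc (Suc (2 * m))) (\<lambda>w. FC (\<lambda>i. w (Suc (Suc i))) (w 1) (w 0)) v"
    by (rule del_delbar_alternation[OF S F1 F2])
  also have "\<dots> = (\<Sum>l<m. alternation (Suc (Suc (2 * m))) (\<lambda>w. B x (w 1) (w (2 * l + 2)) (w (2 * l + 3)) *
      (\<Sum>k\<in>?L - {l}. A x (w 0) (w (2 * k + 2)) (w (2 * k + 3)) * ?P x (?L - {l} - {k}) (\<lambda>i. w (Suc (Suc i))))
      + C (w 0) (w 1) (w (2 * l + 2)) (w (2 * l + 3)) * ?P x (?L - {l}) (\<lambda>i. w (Suc (Suc i)))) v)"
    unfolding FC_def alternation_sum by (simp add: eval_nat_numeral)
  also have "\<dots> = 0"
  proof (rule sum.neutral, rule ballI)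
    fix l assume "l \<in> ?L"
    then have l: "l < m" by simp
    let ?N = "Suc (Suc (2 * m))"
    let ?R = "\<lambda>L w. ?P x L (\<lambda>i. w (Suc (Suc i)))"
    have c: "alternation ?N (\<lambda>w. C (w 0) (w 1) (w (2 * l + 2)) (w (2 * l + 3)) * ?R (?L - {l}) w) v = 0"
    proof (rule alternation_two_pairs[of 0 _ "2 * l + 2" 1 "2 * l + 3"])
      let ?t = "Transposition.transpose 0 (2 * l + 2)" and ?t' = "Transposition.transpose 1 (2 * l + 3)"
      fix w :: "nat \<Rightarrow> complex ^ 'n"
      \<comment> \<open>The remaining factors do not involve the permuted arguments.\<close>
      have R: "?R (?L - {l}) (w \<circ> ?t) = ?R (?L - {l}) w" "?R (?L - {l}) (w \<circ> ?t') = ?R (?L - {l}) w" for w :: "nat \<Rightarrow> complex ^ 'n"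
        by (auto intro!: prod.cong arg_cong2[where f="s x"] simp: Transposition.transpose_def; presburger)+
      have R': "?R (?L - {l}) (w \<circ> ?t \<circ> ?t') = ?R (?L - {l}) w" by (simp only: R)
      show "C (w 0) (w 1) (w (2 * l + 2)) (w (2 * l + 3)) * ?R (?L - {l}) w -
        C ((w \<circ> ?t) 0) ((w \<circ> ?t) 1) ((w \<circ> ?t) (2 * l + 2)) ((w \<circ> ?t) (2 * l + 3)) * ?R (?L - {l}) (w \<circ> ?t) -
        C ((w \<circ> ?t') 0) ((w \<circ> ?t') 1) ((w \<circ> ?t') (2 * l + 2)) ((w \<circ> ?t') (2 * l + 3)) * ?R (?L - {l}) (w \<circ> ?t') +
        C ((w \<circ> ?t \<circ> ?t') 0) ((w \<circ> ?t \<circ> ?t') 1) ((w \<circ> ?t \<circ> ?t') (2 * l + 2)) ((w \<circ> ?t \<circ> ?t') (2 * l + 3)) * ?R (?L - {l}) (w \<circ> ?t \<circ> ?t') = 0"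
        unfolding R R' using C[of "w 0" "w 1" "w (2 * l + 2)" "w (2 * l + 3)"]
        by (simp add: Transposition.transpose_def left_diff_distrib[symmetric] distrib_right[symmetric])
    qed (use l in auto)
    have ab: "alternation ?N (\<lambda>w. B x (w 1) (w (2 * l + 2)) (w (2 * l + 3)) *
        (A x (w 0) (w (2 * k + 2)) (w (2 * k + 3)) * ?R (?L - {l} - {k}) w)) v = 0"
      if k: "k < m" "k \<noteq> l" for k
    proof (rule alternation_three[of 0 _ "2 * k + 2" "2 * l + 2"])
      let ?ij = "Transposition.transpose 0 (2 * k + 2)" and ?ik = "Transposition.transpose 0 (2 * l + 2)"
        and ?jk = "Transposition.transpose (2 * k + 2) (2 * l + 2)"
      let ?M = "?L - {l} - {k}"
      fix w :: "nat \<Rightarrow> complex ^ 'n"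
      have R: "?R ?M (w \<circ> ?ij) = ?R ?M w" "?R ?M (w \<circ> ?ik) = ?R ?M w" "?R ?M (w \<circ> ?jk) = ?R ?M w" for w :: "nat \<Rightarrow> complex ^ 'n"
        by (auto intro!: prod.cong arg_cong2[where f="s x"] simp: Transposition.transpose_def; presburger)+
      have R': "?R ?M (w \<circ> ?ij \<circ> ?ik) = ?R ?M w" "?R ?M (w \<circ> ?ik \<circ> ?ij) = ?R ?M w" by (simp_all only: R)
      let ?F = "\<lambda>w. B x (w 1) (w (2 * l + 2)) (w (2 * l + 3)) *
        (A x (w 0) (w (2 * k + 2)) (w (2 * k + 3)) * ?R ?M w)"
      let ?r = "w 0" and ?t = "w 1" and ?v = "w (2 * l + 2)" and ?w = "w (2 * l + 3)"
        and ?v' = "w (2 * k + 2)" and ?w' = "w (2 * k + 3)"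
      have n: "2 * l \<noteq> Suc (2 * k)" "2 * k \<noteq> Suc (2 * l)" by presburger+
      have "?F w - ?F (w \<circ> ?ij) - ?F (w \<circ> ?ik) - ?F (w \<circ> ?jk) + ?F (w \<circ> ?ij \<circ> ?ik) + ?F (w \<circ> ?ik \<circ> ?ij) =
        (A x ?r ?v' ?w' * B x ?t ?v ?w - A x ?v' ?r ?w' * B x ?t ?v ?w - A x ?v ?v' ?w' * B x ?t ?r ?w
        - A x ?r ?v ?w' * B x ?t ?v' ?w + A x ?v ?r ?w' * B x ?t ?v' ?w + A x ?v' ?v ?w' * B x ?t ?r ?w)
        * ?R ?M w"
        unfolding R R' using k n
        by (simp add: Transposition.transpose_def eval_nat_numeral algebra_simps)
      then show "?F w - ?F (w \<circ> ?ij) - ?F (w \<circ> ?ik) - ?F (w \<circ> ?jk) + ?F (w \<circ> ?ij \<circ> ?ik) + ?F (w \<circ> ?ik \<circ> ?ij) = 0"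
        by (simp only: AB mult_zero_left)
    qed (use l k in auto)
    show "alternation ?N (\<lambda>w. B x (w 1) (w (2 * l + 2)) (w (2 * l + 3)) *
      (\<Sum>k\<in>?L - {l}. A x (w 0) (w (2 * k + 2)) (w (2 * k + 3)) * ?R (?L - {l} - {k}) w)
      + C (w 0) (w 1) (w (2 * l + 2)) (w (2 * l + 3)) * ?R (?L - {l}) w) v = 0"
      unfolding alternation_add c sum_distrib_left alternation_sum
      using ab by (auto intro!: sum.neutral)
  qed
  finally show ?thesis by (simp add: F_def[abs_def])
qed

lemma ext_deriv_zero:
  "ext_deriv k (\<lambda>(x :: complex ^ 'm::finite) v. 0) = (\<lambda>x v. 0)"
  "delbar k (\<lambda>(x :: complex ^ 'm::finite) v. 0) = (\<lambda>x v. 0)"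
proof -
  have z: "dderiv v (\<lambda>x. 0 :: complex) x = 0" for v x :: "complex ^ 'm"
    by (rule dderiv_eq[where f'="\<lambda>v. 0"]) simp
  show "ext_deriv k (\<lambda>(x :: complex ^ 'm::finite) v. 0) = (\<lambda>x v. 0)"
    "delbar k (\<lambda>(x :: complex ^ 'm::finite) v. 0) = (\<lambda>x v. 0)"
    by (simp_all add: ext_deriv_def delbar_def ext_deriv_by_def dzbar_deriv_def z fun_eq_iff)
qed

text \<open>A permutation that moves an index outside p and q contributes zero to the Leibniz expansion, so only the
  identity and the transposition of p and q remain.\<close>

lemma det_two_block:
  fixes M :: "complex ^ 'n ^ 'n::finite"
  assumes pq: "p \<noteq> q"
    and M: "\<And>i j. i \<noteq> p \<and> i \<noteq> q \<Longrightarrow> M $ i $ j = (if i = j then 1 else 0)"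
  shows "det M = M $ p $ p * M $ q $ q - M $ p $ q * M $ q $ p"
proof -
  have sub: "{\<sigma>. \<sigma> permutes {p, q}} \<subseteq> {\<sigma>. \<sigma> permutes UNIV}"
    by (auto intro: permutes_subset)
  have "det M = (\<Sum>\<sigma> | \<sigma> permutes {p, q}. of_int (sign \<sigma>) * (\<Prod>i\<in>UNIV. M $ i $ \<sigma> i))"
    unfolding det_def
  proof (rule sum.mono_neutral_right)
    show "finite {\<sigma>. \<sigma> permutes (UNIV :: 'n set)}" by (rule finite_permutations) simp
    show "\<forall>\<sigma>\<in>{\<sigma>. \<sigma> permutes UNIV} - {\<sigma>. \<sigma> permutes {p, q}}. of_int (sign \<sigma>) * (\<Prod>i\<in>UNIV. M $ i $ \<sigma> i) = 0"
    proof
      fix \<sigma> assume s: "\<sigma> \<in> {\<sigma>. \<sigma> permutes UNIV} - {\<sigma>. \<sigma> permutes {p, q}}"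
      then obtain i where "i \<notin> {p, q}" "\<sigma> i \<noteq> i"
        by (auto simp: permutes_def)
      then have "M $ i $ \<sigma> i = 0" by (subst M) auto
      then have "(\<Prod>i\<in>UNIV. M $ i $ \<sigma> i) = 0" by (auto intro: prod_zero)
      then show "of_int (sign \<sigma>) * (\<Prod>i\<in>UNIV. M $ i $ \<sigma> i) = 0" by simp
    qed
  qed (rule sub)
  also have "{\<sigma>. \<sigma> permutes {p, q}} = {id, Transposition.transpose p q}"
    by (auto simp: permutes_doubleton_iff)
  also have "(\<Sum>\<sigma>\<in>{id, Transposition.transpose p q}. of_int (sign \<sigma>) * (\<Prod>i\<in>UNIV. M $ i $ \<sigma> i)) =
      (\<Prod>i\<in>UNIV. M $ i $ i) - (\<Prod>i\<in>UNIV. M $ i $ Transposition.transpose p q i)"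
  proof -
    have "id \<noteq> Transposition.transpose p q" using pq by (metis id_apply transpose_apply_first)
    then show ?thesis using pq by (simp add: sign_swap_id)
  qed
  also have "(\<Prod>i\<in>UNIV. M $ i $ i) = M $ p $ p * M $ q $ q"
  proof -
    have "(\<Prod>i\<in>UNIV. M $ i $ i) = (\<Prod>i\<in>{p, q}. M $ i $ i)"
      by (rule prod.mono_neutral_right) (auto simp: M)
    then show ?thesis using pq by simp
  qed
  also have "(\<Prod>i\<in>UNIV. M $ i $ Transposition.transpose p q i) = M $ p $ q * M $ q $ p"
  proof -
    have "(\<Prod>i\<in>UNIV. M $ i $ Transposition.transpose p q i) = (\<Prod>i\<in>{p, q}. M $ i $ Transposition.transpose p q i)"
      by (rule prod.mono_neutral_right) (auto simp: M Transposition.transpose_def)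
    then show ?thesis using pq by simp
  qed
  finally show ?thesis .
qed

section \<open>The product of a Hopf surface with a torus\<close>

lemma cis_2pi_eqD:
  assumes "cis (2 * pi * a) = cis (2 * pi * b)"
  shows "\<exists>n::int. a = b + of_int n"
proof -
  have "cos (2 * pi * a) = cos (2 * pi * b)" "sin (2 * pi * a) = sin (2 * pi * b)"
    using assms by (auto simp: complex_eq_iff)
  then obtain n :: int where "2 * pi * a = 2 * pi * b + 2 * pi * of_int n"
    using sin_cos_eq_iff[of "2 * pi * a" "2 * pi * b"] by (auto simp: algebra_simps)
  then have "2 * pi * a = 2 * pi * (b + of_int n)" by (simp add: algebra_simps)
  then show ?thesis by auto
qed

lemma cis_add_2pi_int: "cis (2 * pi * (a + of_int n)) = cis (2 * pi * a)"
  by (simp add: distrib_left cis_mult[symmetric] cis_multiple_2pi)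

text \<open>The coordinates p and q span the Hopf plane, all others belong to the torus.\<close>

locale two_axes =
  fixes p q :: "'n::finite"
  assumes p_neq_q: "p \<noteq> q"
begin

text \<open>The universal cover of the manifold, which for the Hopf factor is the punctured plane.\<close>

definition W :: "(complex ^ 'n) set" where
  "W = {z. z $ p \<noteq> 0 \<or> z $ q \<noteq> 0}"

definition radius :: "complex ^ 'n \<Rightarrow> real" where
  "radius z = sqrt ((cmod (z $ p))\<^sup>2 + (cmod (z $ q))\<^sup>2)"

text \<open>The quotient map, realised as a map onto a compact subset of a Euclidean space. Its components are the
  direction of the Hopf part, the logarithm of its radius modulo 1, and the real and imaginary parts of
  the torus coordinates modulo 1. They separate the orbits of the deck group and the image is compact, so the
  quotient topology is the subspace topology.\<close>

definition covering :: "complex ^ 'n \<Rightarrow> (complex ^ 'n) \<times> (complex ^ 'n)" where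
  "covering z =
    (\<chi> i. if i = p \<or> i = q then z $ i / of_real (radius z) else cis (2 * pi * Re (z $ i)),
     \<chi> i. if i = p \<or> i = q then cis (2 * pi * ln (radius z)) else cis (2 * pi * Im (z $ i)))"

definition gaussian :: "complex ^ 'n \<Rightarrow> bool" where
  "gaussian c \<longleftrightarrow> (\<forall>i. Re (c $ i) \<in> \<int> \<and> Im (c $ i) \<in> \<int>)"

text \<open>The linear part of a deck transformation.\<close>

definition dilate :: "int \<Rightarrow> complex ^ 'n \<Rightarrow> complex ^ 'n" where
  "dilate k v = (\<chi> i. if i = p \<or> i = q then of_real (exp (of_int k)) * v $ i else v $ i)"

definition deck :: "int \<Rightarrow> complex ^ 'n \<Rightarrow> complex ^ 'n \<Rightarrow> complex ^ 'n" where
  "deck k c z = dilate k z + (\<chi> i. if i = p \<or> i = q then 0 else c $ i)"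

lemma deck_nth: "deck k c z $ i =
    (if i = p \<or> i = q then of_real (exp (of_int k)) * z $ i else z $ i + c $ i)"
  by (simp add: deck_def dilate_def)

lemma continuous_on_radius [continuous_intros]: "continuous_on S radius"
  unfolding radius_def by (intro continuous_intros)

lemma radius_pos: "z \<in> W \<Longrightarrow> 0 < radius z"
  by (auto simp: radius_def W_def add_nonneg_pos add_pos_nonneg)

lemma W_iff_radius: "z \<in> W \<longleftrightarrow> 0 < radius z"
  using radius_pos[of z] by (auto simp: radius_def W_def)

lemma open_W: "open W"
proof -
  have "W = {z. 0 < radius z}" by (auto simp: W_iff_radius)
  then show ?thesis by (simp add: open_Collect_less continuous_on_radius)
qed

lemma radius_dilate: "radius (dilate k z) = exp (of_int k) * radius z"
proof -
  have "(cmod (of_real (exp (of_int k)) * z $ p))\<^sup>2 + (cmod (of_real (exp (of_int k)) * z $ q))\<^sup>2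
    = (exp (of_int k))\<^sup>2 * ((cmod (z $ p))\<^sup>2 + (cmod (z $ q))\<^sup>2)"
    by (simp add: norm_mult power_mult_distrib algebra_simps)
  then show ?thesis
    by (simp add: radius_def dilate_def real_sqrt_mult)
qed

lemma radius_deck: "radius (deck k c z) = exp (of_int k) * radius z"
  unfolding radius_dilate[symmetric] by (simp add: radius_def deck_nth dilate_def)

lemma bounded_linear_dilate: "bounded_linear (dilate k)"
  unfolding linear_conv_bounded_linear[symmetric]
  by (auto simp: linear_iff dilate_def vec_eq_iff algebra_simps scaleR_conv_of_real)

lemma deck_has_derivative: "(deck k c has_derivative dilate k) (at z)"
proof -
  have "((\<lambda>z. dilate k z + (\<chi> i. if i = p \<or> i = q then 0 else c $ i)) has_derivative (\<lambda>v. dilate k v + 0)) (at z)"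
    by (intro has_derivative_add has_derivative_const bounded_linear_imp_has_derivative bounded_linear_dilate)
  then show ?thesis by (simp add: deck_def[abs_def])
qed

lemma continuous_on_deck: "continuous_on S (deck k c)"
  by (intro continuous_at_imp_continuous_on ballI has_derivative_continuous[OF deck_has_derivative])

lemma linear_dilate: "Vector_Spaces.linear (*s) (*s) (dilate k)"
  by unfold_locales (auto simp: dilate_def vec_eq_iff algebra_simps)

lemma covering_deck:
  assumes "z \<in> W" "gaussian c"
  shows "covering (deck k c z) = covering z"
proof -
  have r: "0 < radius z" using assms by (simp add: radius_pos)
  have l: "ln (radius (deck k c z)) = ln (radius z) + of_int k"
    using r by (simp add: radius_deck ln_mult)
  have g: "\<exists>n::int. Re (c $ i) = of_int n" "\<exists>n::int. Im (c $ i) = of_int n" for i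
    using assms(2) by (auto simp: gaussian_def Ints_def)
  have "cis (2 * pi * Re (deck k c z $ i)) = cis (2 * pi * Re (z $ i))"
    "cis (2 * pi * Im (deck k c z $ i)) = cis (2 * pi * Im (z $ i))" if "i \<noteq> p" "i \<noteq> q" for i
    using g[of i] that by (auto simp: deck_nth cis_add_2pi_int)
  then show ?thesis
    unfolding covering_def l cis_add_2pi_int
    by (auto simp: vec_eq_iff deck_nth radius_deck)
qed

lemma covering_eqD:
  assumes "z \<in> W" "z' \<in> W" "covering z' = covering z"
  obtains k c where "gaussian c" "z' = deck k c z"
proof -
  have r: "0 < radius z" "0 < radius z'" using assms by (simp_all add: radius_pos)
  note e = assms(3)[unfolded covering_def, simplified prod.inject vec_eq_iff, simplified]
  have "cis (2 * pi * ln (radius z')) = cis (2 * pi * ln (radius z))"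
    using e by (metis (full_types))
  then obtain k where k: "ln (radius z') = ln (radius z) + of_int k"
    using cis_2pi_eqD by blast
  then have "exp (ln (radius z')) = exp (ln (radius z)) * exp (of_int k)" by (simp add: exp_add)
  then have rk: "radius z' = exp (of_int k) * radius z" using r by (simp add: mult.commute)
  have "\<exists>n. Re (z' $ i) = Re (z $ i) + of_int n" if "i \<noteq> p" "i \<noteq> q" for i
    using e that by (intro cis_2pi_eqD) (metis (full_types))
  then obtain m where m: "\<And>i. i \<noteq> p \<Longrightarrow> i \<noteq> q \<Longrightarrow> Re (z' $ i) = Re (z $ i) + of_int (m i)"
    by metis
  have "\<exists>n. Im (z' $ i) = Im (z $ i) + of_int n" if "i \<noteq> p" "i \<noteq> q" for i
    using e that by (intro cis_2pi_eqD) (metis (full_types))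
  then obtain l where l: "\<And>i. i \<noteq> p \<Longrightarrow> i \<noteq> q \<Longrightarrow> Im (z' $ i) = Im (z $ i) + of_int (l i)"
    by metis
  define c :: "complex ^ 'n" where "c = (\<chi> i. Complex (of_int (m i)) (of_int (l i)))"
  have "gaussian c" by (simp add: gaussian_def c_def)
  moreover have "z' $ i = deck k c z $ i" for i
  proof (cases "i = p \<or> i = q")
    case True
    then have "z' $ i / of_real (radius z') = z $ i / of_real (radius z)"
      using e by (metis (full_types))
    then have "z' $ i = z $ i / of_real (radius z) * of_real (radius z')"
      using r by (simp add: field_simps)
    also have "\<dots> = of_real (exp (of_int k)) * z $ i" using r by (simp add: rk)
    finally show ?thesis using True by (simp add: deck_nth)
  next
    case False
    then show ?thesis using m[of i] l[of i] by (simp add: deck_nth c_def complex_eq_iff)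
  qed
  ultimately show ?thesis using that by (metis vec_eq_iff)
qed

lemma continuous_on_covering: "continuous_on W covering"
proof -
  have r: "radius z \<noteq> 0" if "z \<in> W" for z using radius_pos[OF that] by simp
  have "continuous_on W (\<lambda>z. if i = p \<or> i = q then z $ i / of_real (radius z) else cis (2 * pi * Re (z $ i)))" for i
    by (cases "i = p \<or> i = q") (auto intro!: continuous_intros simp: r)
  moreover have "continuous_on W (\<lambda>z. if i = p \<or> i = q then cis (2 * pi * ln (radius z)) else cis (2 * pi * Im (z $ i)))" for i
    by (cases "i = p \<or> i = q") (auto intro!: continuous_intros simp: r)
  ultimately show ?thesis
    unfolding covering_def by (intro continuous_on_Pair continuous_on_vec_lambda)
qed

definition fundamental_domain :: "(complex ^ 'n) set" where
  "fundamental_domain = {z. 1 \<le> radius z \<and> radius z \<le> exp 1 \<and>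
     (\<forall>i. i \<noteq> p \<longrightarrow> i \<noteq> q \<longrightarrow> 0 \<le> Re (z $ i) \<and> Re (z $ i) \<le> 1 \<and> 0 \<le> Im (z $ i) \<and> Im (z $ i) \<le> 1)}"

lemma fundamental_domain_subset: "fundamental_domain \<subseteq> W"
  by (auto simp: fundamental_domain_def W_iff_radius)

lemma compact_fundamental_domain: "compact fundamental_domain"
  unfolding compact_eq_bounded_closed
proof
  have "norm z \<le> of_nat CARD('n) * (exp 1 + 2)" if z: "z \<in> fundamental_domain" for z
  proof -
    have "norm (z $ i) \<le> exp 1 + 2" for i
    proof (cases "i = p \<or> i = q")
      case True
      then have "norm (z $ i) \<le> radius z"
        by (auto simp: radius_def intro: real_le_rsqrt)
      then show ?thesis using z by (simp add: fundamental_domain_def)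
    next
      case False
      have "norm (z $ i) \<le> \<bar>Re (z $ i)\<bar> + \<bar>Im (z $ i)\<bar>" by (rule cmod_le)
      also have "\<dots> \<le> 2" using False z by (auto simp: fundamental_domain_def)
      finally show ?thesis using exp_ge_zero[of "1::real"] by linarith
    qed
    then have "(\<Sum>i\<in>UNIV. norm (z $ i)) \<le> of_nat CARD('n) * (exp 1 + 2)"
      using sum_bounded_above[of UNIV "\<lambda>i. norm (z $ i)" "exp 1 + 2"] by simp
    moreover have "norm z \<le> (\<Sum>i\<in>UNIV. norm (z $ i))"
      unfolding norm_vec_def by (rule L2_set_le_sum) simp
    ultimately show ?thesis by linarith
  qed
  then show "bounded fundamental_domain" by (auto simp: bounded_iff)
  have "closed ({z. 1 \<le> radius z} \<inter> {z. radius z \<le> exp 1} \<inter>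
     (\<Inter>i\<in>- {p, q}. {z. 0 \<le> Re (z $ i)} \<inter> {z. Re (z $ i) \<le> 1} \<inter> {z. 0 \<le> Im (z $ i)} \<inter> {z. Im (z $ i) \<le> 1}))"
    by (intro closed_Int closed_INT ballI closed_Collect_le continuous_intros continuous_on_radius)
  also have "({z. 1 \<le> radius z} \<inter> {z. radius z \<le> exp 1} \<inter>
     (\<Inter>i\<in>- {p, q}. {z. 0 \<le> Re (z $ i)} \<inter> {z. Re (z $ i) \<le> 1} \<inter> {z. 0 \<le> Im (z $ i)} \<inter> {z. Im (z $ i) \<le> 1}))
     = fundamental_domain"
    by (auto simp: fundamental_domain_def)
  finally show "closed fundamental_domain" .
qed

lemma covering_fundamental_domain: "covering ` fundamental_domain = covering ` W"
proof
  show "covering ` fundamental_domain \<subseteq> covering ` W" using fundamental_domain_subset by blast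
  show "covering ` W \<subseteq> covering ` fundamental_domain"
  proof
    fix x assume "x \<in> covering ` W"
    then obtain z where z: "z \<in> W" "x = covering z" by auto
    define k where "k = - \<lfloor>ln (radius z)\<rfloor>"
    define c :: "complex ^ 'n" where
      "c = (\<chi> i. Complex (- of_int \<lfloor>Re (z $ i)\<rfloor>) (- of_int \<lfloor>Im (z $ i)\<rfloor>))"
    have g: "gaussian c" by (simp add: gaussian_def c_def)
    have "radius (deck k c z) = exp (of_int k + ln (radius z))"
      using radius_pos[OF z(1)] by (simp add: radius_deck exp_add)
    moreover have "0 \<le> of_int k + ln (radius z)" "of_int k + ln (radius z) \<le> 1"
      unfolding k_def by linarith+
    ultimately have "1 \<le> radius (deck k c z)" "radius (deck k c z) \<le> exp 1" by simp_all
    moreover have "0 \<le> Re (deck k c z $ i) \<and> Re (deck k c z $ i) \<le> 1 \<and>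
        0 \<le> Im (deck k c z $ i) \<and> Im (deck k c z $ i) \<le> 1" if "i \<noteq> p" "i \<noteq> q" for i
      using that by (simp add: deck_nth c_def) linarith
    ultimately have "deck k c z \<in> fundamental_domain" by (simp add: fundamental_domain_def)
    then show "x \<in> covering ` fundamental_domain"
      using covering_deck[OF z(1) g] z(2) by (metis image_eqI)
  qed
qed

text \<open>The image of the compact fundamental domain is everything, so the restriction of the covering map to it is a
  quotient map. The preimage of the image of V is the union of all translates of V, which is open.\<close>

lemma covering_open_map:
  assumes "open V" "V \<subseteq> W"
  shows "openin (top_of_set (covering ` W)) (covering ` V)"
proof -
  let ?K = "fundamental_domain"
  have "?K \<inter> covering -` (covering ` V) = ?K \<inter> (\<Union>k. \<Union>c\<in>Collect gaussian. deck k c -` V)"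
  proof (intro equalityI subsetI)
    fix z assume z: "z \<in> ?K \<inter> covering -` (covering ` V)"
    then obtain v where v: "v \<in> V" "covering v = covering z" by auto
    then obtain k c where "gaussian c" "v = deck k c z"
      using covering_eqD[of z v] z assms(2) fundamental_domain_subset by blast
    then show "z \<in> ?K \<inter> (\<Union>k. \<Union>c\<in>Collect gaussian. deck k c -` V)" using v z by auto
  next
    fix z assume z: "z \<in> ?K \<inter> (\<Union>k. \<Union>c\<in>Collect gaussian. deck k c -` V)"
    then obtain k c where "gaussian c" "deck k c z \<in> V" by auto
    moreover have "z \<in> W" using z fundamental_domain_subset by auto
    ultimately have "covering z \<in> covering ` V"
      using covering_deck[of z c k] by (metis image_eqI)
    then show "z \<in> ?K \<inter> covering -` (covering ` V)" using z by auto
  qed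
  moreover have "open (\<Union>k. \<Union>c\<in>Collect gaussian. deck k c -` V)"
    by (intro open_UN ballI open_vimage assms continuous_on_deck)
  ultimately have "openin (top_of_set ?K) (?K \<inter> covering -` (covering ` V))"
    by (simp add: openin_open_Int)
  then show ?thesis
    using Abstract_Topology_2.continuous_imp_quotient_map[of ?K covering "covering ` W" "covering ` V"] assms(2)
    by (simp add: continuous_on_subset[OF continuous_on_covering fundamental_domain_subset]
        covering_fundamental_domain compact_fundamental_domain image_mono)
qed

text \<open>The cover is an image of the product of the punctured space \<open>\<complex>\<^sup>2\<close>, which is connected, with a
  vector space.\<close>

lemma connected_W: "connected W"
proof -
  let ?P = "(- {0 :: complex \<times> complex}) \<times> (UNIV :: (complex ^ 'n) set)"
  let ?f = "\<lambda>x :: (complex \<times> complex) \<times> (complex ^ 'n).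
      (\<chi> i. if i = p then fst (fst x) else if i = q then snd (fst x) else snd x $ i)"
  have "connected ?P"
    by (intro connected_Times connected_punctured_universe connected_UNIV) simp
  moreover have "continuous_on ?P ?f"
  proof -
    have "continuous_on ?P (\<lambda>x. if i = p then fst (fst x) else if i = q then snd (fst x) else snd x $ i)" for i
      by (cases "i = p"; cases "i = q") (auto intro!: continuous_intros)
    then show ?thesis by (rule continuous_on_vec_lambda)
  qed
  ultimately have "connected (?f ` ?P)" by (rule connected_continuous_image[rotated])
  moreover have "?f ` ?P = W"
  proof (intro equalityI subsetI)
    fix z assume "z \<in> ?f ` ?P"
    then show "z \<in> W" using p_neq_q by (auto simp: W_def zero_prod_def)
  next
    fix z assume "z \<in> W"
    then show "z \<in> ?f ` ?P"
      by (intro image_eqI[of _ _ "((z $ p, z $ q), z)"]) (auto simp: W_def vec_eq_iff zero_prod_def)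
  qed
  ultimately show ?thesis by simp
qed

definition X :: "((complex ^ 'n) \<times> (complex ^ 'n)) topology" where
  "X = top_of_set (covering ` W)"

text \<open>All local inverses of the covering map. Any two of them differ locally by a deck transformation, so
  invariant objects on the cover have the same expression in every chart.\<close>

definition atlas :: "((complex ^ 'n) \<times> (complex ^ 'n), 'n) chart set" where
  "atlas = {(covering ` V, inv_into V covering) | V. open V \<and> V \<subseteq> W \<and> inj_on covering V}"

lemma chart_range_atlas:
  assumes "inj_on covering V"
  shows "chart_range (covering ` V, inv_into V covering) = V"
  using assms by (force simp: chart_range_def)

lemma chart_range_subset_W: "c \<in> atlas \<Longrightarrow> open (chart_range c) \<and> chart_range c \<subseteq> W"
  by (auto simp: atlas_def chart_range_atlas)

text \<open>Near z the transition map agrees with the single deck transformation that takes the point of one sheet to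
  the point of the other sheet.\<close>

lemma transition_deck:
  assumes "c \<in> atlas" "d \<in> atlas" "z \<in> overlap c d"
  obtains k a where "gaussian a" "transition c d z = deck k a z"
    "(transition c d has_derivative dilate k) (at z)" "z \<in> W" "z \<in> chart_range c"
proof -
  obtain V where V: "open V" "V \<subseteq> W" "inj_on covering V" "c = (covering ` V, inv_into V covering)"
    using assms(1) by (auto simp: atlas_def)
  obtain V' where V': "open V'" "V' \<subseteq> W" "inj_on covering V'" "d = (covering ` V', inv_into V' covering)"
    using assms(2) by (auto simp: atlas_def)
  have t: "transition c d y = inv_into V' covering (covering y)" if "y \<in> V" for y
  proof -
    have "inv_into (covering ` V) (inv_into V covering) y = covering y"
      by (rule inv_into_f_eq) (use that V(3) in \<open>auto intro: inj_on_inv_into\<close>)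
    then show ?thesis by (simp add: transition_def V(4) V'(4))
  qed
  have zV: "z \<in> V" and cz: "covering z \<in> covering ` V'"
  proof -
    obtain y where "y \<in> covering ` V \<inter> covering ` V'" "z = inv_into V covering y"
      using assms(3) by (auto simp: overlap_def V(4) V'(4))
    then show "z \<in> V" "covering z \<in> covering ` V'"
      by (auto simp: inv_into_into f_inv_into_f)
  qed
  have z': "transition c d z \<in> V'" "covering (transition c d z) = covering z"
    using cz by (auto simp: t[OF zV] inv_into_into f_inv_into_f)
  have "z \<in> W" "transition c d z \<in> W" using zV V(2) z'(1) V'(2) by auto
  then obtain k a where ka: "gaussian a" "transition c d z = deck k a z"
    using z'(2) by (rule covering_eqD)
  have "deck k a y = transition c d y" if "y \<in> V \<inter> deck k a -` V'" for y
  proof -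
    have "covering (deck k a y) = covering y" using that V(2) ka(1) by (auto intro: covering_deck)
    then show ?thesis using that V'(3) t[of y] by (metis IntD1 IntD2 inv_into_f_f vimageE)
  qed
  moreover have "open (V \<inter> deck k a -` V')"
    by (intro open_Int V open_vimage V' continuous_on_deck)
  moreover have "z \<in> V \<inter> deck k a -` V'" using zV z'(1) ka(2) by simp
  ultimately have "(transition c d has_derivative dilate k) (at z)"
    using has_derivative_transform_within_open[OF deck_has_derivative] by blast
  then show ?thesis using that ka zV V(2) chart_range_atlas[OF V(3)] V(4) by blast
qed

text \<open>A nontrivial deck transformation changes the logarithm of the radius by at least 1 or moves a torus
  coordinate by at least 1, so the covering map is injective on sets of diameter less than 1 in these
  quantities.\<close>

lemma atlas_covers:
  assumes "z \<in> W"
  obtains V where "open V" "V \<subseteq> W" "inj_on covering V" "z \<in> V"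
proof -
  let ?I = "{ln (radius z) - 1/2 <..< ln (radius z) + 1/2}"
  let ?V = "(W \<inter> (\<lambda>y. ln (radius y)) -` ?I) \<inter> ball z (1/2)"
  have "continuous_on W (\<lambda>y. ln (radius y))"
    using radius_pos by (intro continuous_intros) (auto dest: radius_pos)
  then have "open ?V"
    by (intro open_Int continuous_open_preimage open_W) auto
  moreover have "inj_on covering ?V"
  proof (rule inj_onI)
    fix y y' assume y: "y \<in> ?V" and y': "y' \<in> ?V" and e: "covering y = covering y'"
    then obtain k c where kc: "gaussian c" "y' = deck k c y"
      using covering_eqD[of y y'] by (metis IntD1)
    have "ln (radius y') = of_int k + ln (radius y)"
      using y radius_pos[of y] by (simp add: kc(2) radius_deck ln_mult)
    then have "\<bar>of_int k :: real\<bar> < 1" using y y' by auto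
    then have k: "k = 0" by linarith
    have "c $ i = 0" if "i \<noteq> p" "i \<noteq> q" for i
    proof -
      have "dist y y' < 1" using y y' dist_triangle[of y y' z] by (simp add: dist_commute)
      then have "norm ((y' - y) $ i) < 1"
        using Finite_Cartesian_Product.norm_nth_le[of "y' - y" i] by (simp add: dist_norm norm_minus_commute)
      then have "norm (c $ i) < 1" using that by (simp add: kc(2) deck_nth)
      then have "\<bar>Re (c $ i)\<bar> < 1" "\<bar>Im (c $ i)\<bar> < 1"
        using abs_Re_le_cmod[of "c $ i"] abs_Im_le_cmod[of "c $ i"] by linarith+
      then show ?thesis using kc(1) Ints_nonzero_abs_less1 by (auto simp: gaussian_def complex_eq_iff)
    qed
    then show "y = y'" by (auto simp: kc(2) k vec_eq_iff deck_nth)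
  qed
  ultimately show ?thesis using that[of ?V] assms by auto
qed

lemma chart_homeomorphic:
  assumes "open V" "V \<subseteq> W" "inj_on covering V"
  shows "homeomorphic_map (subtopology X (covering ` V)) (top_of_set V) (inv_into V covering)"
proof -
  have "continuous_on (covering ` V) (inv_into V covering)"
  proof (rule continuous_on_inverse_open_map)
    show "continuous_on V covering" by (rule continuous_on_subset[OF continuous_on_covering assms(2)])
    show "openin (top_of_set (covering ` V)) (covering ` U)" if "openin (top_of_set V) U" for U
    proof -
      have U: "open U" "U \<subseteq> V" using that assms(1) by (auto simp: openin_open_eq)
      then have "openin (top_of_set (covering ` W)) (covering ` U)"
        using assms(2) by (intro covering_open_map) auto
      then show ?thesis
        by (rule openin_subset_trans) (use U assms(2) in auto)
    qed
  qed (use assms in auto)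
  then have "homeomorphic_maps (top_of_set (covering ` V)) (top_of_set V) (inv_into V covering) covering"
    using assms continuous_on_subset[OF continuous_on_covering assms(2)]
    by (auto simp: homeomorphic_maps_def inv_into_into f_inv_into_f)
  moreover have "subtopology X (covering ` V) = top_of_set (covering ` V)"
    using assms(2) by (simp add: X_def subtopology_subtopology Int_absorb1 image_mono)
  ultimately show ?thesis by (auto simp: homeomorphic_maps_map)
qed

lemma second_countable_top_of_set:
  "second_countable (top_of_set (S :: 'a::second_countable_topology set))"
proof (rule second_countable_subtopology)
  obtain B :: "'a set set" where "countable B" "\<And>C. C \<in> B \<Longrightarrow> open C"
    "\<And>S. open S \<Longrightarrow> \<exists>U. U \<subseteq> B \<and> S = \<Union>U"
    using univ_second_countable by metis
  note B = this
  have "\<exists>V\<in>B. x \<in> V \<and> V \<subseteq> U" if "open U" "x \<in> U" for U x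
    using B(3)[OF that(1)] that(2) by (metis UnionE Union_upper subsetD)
  then show "second_countable (euclidean :: 'a topology)"
    unfolding second_countable_def using B(1,2) by (intro exI[of _ B]) simp
qed

lemma complex_manifold_X: "complex_manifold X atlas"
  unfolding complex_manifold_def
proof (intro conjI ballI)
  show "Hausdorff_space X" by (simp add: X_def Hausdorff_space_subtopology)
  show "second_countable X" unfolding X_def by (rule second_countable_top_of_set)
  show "connected_space X"
    using connected_continuous_image[OF continuous_on_covering connected_W]
    by (simp add: X_def connectedin_topspace[symmetric] connectedin_subtopology)
  have "axis p 1 \<in> W" by (simp add: W_def)
  then show "topspace X \<noteq> {}" by (auto simp: X_def)
  show "(\<Union>c\<in>atlas. fst c) = topspace X"
  proof (intro equalityI subsetI)
    fix x assume "x \<in> topspace X"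
    then obtain z where z: "z \<in> W" "x = covering z" by (auto simp: X_def)
    obtain V where V: "open V" "V \<subseteq> W" "inj_on covering V" "z \<in> V"
      using z(1) by (rule atlas_covers)
    then have "(covering ` V, inv_into V covering) \<in> atlas" by (auto simp: atlas_def)
    moreover have "x \<in> fst (covering ` V, inv_into V covering)" using V(4) z(2) by simp
    ultimately show "x \<in> (\<Union>c\<in>atlas. fst c)" by (rule UN_I)
  qed (auto simp: atlas_def X_def)
next
  fix c assume "c \<in> atlas"
  then obtain V where V: "open V" "V \<subseteq> W" "inj_on covering V" "c = (covering ` V, inv_into V covering)"
    by (auto simp: atlas_def)
  show "openin X (fst c)" using covering_open_map[OF V(1,2)] by (simp add: X_def V(4))
  show "open (chart_range c)" using V by (simp add: chart_range_atlas)
  show "homeomorphic_map (subtopology X (fst c)) (top_of_set (chart_range c)) (snd c)"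
    using chart_homeomorphic[OF V(1-3)] V(3,4) by (simp add: chart_range_atlas)
next
  fix c d assume cd: "c \<in> atlas" "d \<in> atlas"
  show "holomorphic_map_on (transition c d) (overlap c d)"
    unfolding holomorphic_map_on_def
  proof
    fix z assume "z \<in> overlap c d"
    then show "\<exists>D. (transition c d has_derivative D) (at z) \<and> Vector_Spaces.linear (*s) (*s) D"
      using transition_deck[OF cd] linear_dilate by metis
  qed
qed

lemma compact_X: "compact_space X"
proof -
  have "compact (covering ` W)"
    using compact_continuous_image[OF continuous_on_subset[OF continuous_on_covering fundamental_domain_subset]
        compact_fundamental_domain]
    by (simp add: covering_fundamental_domain)
  then show ?thesis by (simp add: X_def compact_space_subtopology)
qed

text \<open>Compatibility of the local expressions of a form with the transition maps is invariance under the deck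
  group.\<close>

lemma smooth_form_invariant:
  assumes alt: "\<And>x. x \<in> W \<Longrightarrow> alternating_form k (\<alpha> x)"
    and smooth: "\<And>v. smooth_on (\<lambda>x. \<alpha> x v) W"
    and inv: "\<And>m a x v. x \<in> W \<Longrightarrow> gaussian a \<Longrightarrow> \<alpha> (deck m a x) (\<lambda>i. dilate m (v i)) = \<alpha> x v"
  shows "smooth_form atlas k (\<lambda>c. \<alpha>)"
  unfolding smooth_form_def
proof (intro conjI ballI allI)
  fix c x assume "c \<in> atlas" "x \<in> chart_range c"
  then show "alternating_form k (\<alpha> x)" using alt chart_range_subset_W by blast
next
  fix c v assume "c \<in> atlas"
  then show "smooth_on (\<lambda>x. \<alpha> x v) (chart_range c)"
    using smooth chart_range_subset_W smooth_on_subset by blast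
next
  fix c d x v assume cd: "c \<in> atlas" "d \<in> atlas" "x \<in> overlap c d"
  obtain m a where ma: "gaussian a" "transition c d x = deck m a x"
    "(transition c d has_derivative dilate m) (at x)" "x \<in> W"
    using transition_deck[OF cd] by metis
  have "frechet_derivative (transition c d) (at x) = dilate m"
    using frechet_derivative_at[OF ma(3)] by simp
  then show "\<alpha> x v = \<alpha> (transition c d x) (\<lambda>i. frechet_derivative (transition c d) (at x) (v i))"
    using inv[OF ma(4,1)] ma(2) by simp
qed

lemma agree_on_atlasI:
  "(\<And>c x. c \<in> atlas \<Longrightarrow> x \<in> W \<Longrightarrow> \<alpha> c x = \<beta> c x) \<Longrightarrow> agree_on_charts atlas \<alpha> \<beta>"
  using chart_range_subset_W by (fastforce simp: agree_on_charts_def)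

section \<open>A family of invariant Hermitian metrics\<close>

text \<open>The standard Hermitian products on the Hopf plane and on the torus directions.\<close>

definition hp :: "complex ^ 'n \<Rightarrow> complex ^ 'n \<Rightarrow> complex" where
  "hp v w = v $ p * cnj (w $ p) + v $ q * cnj (w $ q)"

definition ht :: "complex ^ 'n \<Rightarrow> complex ^ 'n \<Rightarrow> complex" where
  "ht v w = (\<Sum>i\<in>-{p, q}. v $ i * cnj (w $ i))"

definition weight :: "complex ^ 'n \<Rightarrow> complex" where
  "weight x = inverse (hp x x)"

text \<open>The Levi form \<open>\<partial>dbar log r\<^sup>2\<close> of the logarithm of the squared radius: up to normalisation, the
  pullback of the Fubini-Study form of the projective line.\<close>

definition levi :: "complex ^ 'n \<Rightarrow> complex ^ 'n \<Rightarrow> complex ^ 'n \<Rightarrow> complex" where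
  "levi x v w = weight x * hp v w - weight x ^ 2 * hp v x * hp x w"

text \<open>The form \<open>\<omega>_a\<close> of the introduction as a sesquilinear form of tangent vectors.\<close>

definition herm :: "real \<Rightarrow> complex ^ 'n \<Rightarrow> complex ^ 'n \<Rightarrow> complex ^ 'n \<Rightarrow> complex" where
  "herm a x v w = weight x * hp v w + (of_real a - 1) * levi x v w + ht v w"

lemma hp_self: "hp x x = of_real ((radius x)\<^sup>2)"
  by (simp add: hp_def radius_def complex_norm_square[symmetric])

lemma hp_self_nonzero: "x \<in> W \<Longrightarrow> hp x x \<noteq> 0"
  using radius_pos[of x] by (simp add: hp_self)

lemma weight_hp: "x \<in> W \<Longrightarrow> weight x * hp x x = 1"
  using hp_self_nonzero by (simp add: weight_def)

lemma weight_real: "weight x = of_real (1 / (radius x)\<^sup>2)"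
  by (simp add: weight_def hp_self inverse_eq_divide)

lemma sesquilinear_hp: "sesquilinear hp"
  by (simp add: sesquilinear_def hp_def algebra_simps)

lemma sesquilinear_levi: "sesquilinear (levi x)"
  by (simp add: sesquilinear_def levi_def hp_def algebra_simps)

lemma sesquilinear_herm: "sesquilinear (herm a x)"
proof -
  have "sesquilinear ht"
    by (simp add: sesquilinear_def ht_def algebra_simps sum.distrib sum_distrib_left)
  then show ?thesis using sesquilinear_hp sesquilinear_levi[of x]
    unfolding sesquilinear_def herm_def by (simp add: algebra_simps)
qed

lemma hp_cnj: "cnj (hp v w) = hp w v"
  by (simp add: hp_def mult.commute)

lemma levi_cnj: "cnj (levi x v w) = levi x w v"
  by (simp add: levi_def hp_cnj weight_real mult_ac)

lemma herm_cnj: "cnj (herm a x v w) = herm a x w v"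
  by (simp add: herm_def hp_cnj levi_cnj ht_def weight_real cnj_sum mult_ac)

text \<open>Lagrange's identity, which is the Cauchy-Schwarz inequality on the Hopf plane with its defect. It makes the
  semi-positivity of the Levi form and the positivity of the metrics visible.\<close>

lemma lagrange: "hp v v * hp x x - hp v x * hp x v = of_real ((cmod (v $ p * x $ q - v $ q * x $ p))\<^sup>2)"
  by (simp only: complex_norm_square) (simp add: hp_def algebra_simps)

lemma levi_self:
  assumes "x \<in> W"
  shows "levi x v v = of_real ((cmod (v $ p * x $ q - v $ q * x $ p) / (radius x)\<^sup>2)\<^sup>2)"
proof -
  have "levi x v v = weight x ^ 2 * (hp v v * hp x x - hp v x * hp x v)"
    using weight_hp[OF assms] unfolding levi_def by algebra
  then show ?thesis unfolding lagrange weight_real by (simp add: power_divide)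
qed

text \<open>The decomposition into the parts orthogonal to and along the complex line through x, and the torus part. All
  three are nonnegative, and the parameter a enters in the first one only.\<close>

lemma herm_self:
  assumes "x \<in> W"
  shows "herm a x v v = of_real (a * (cmod (v $ p * x $ q - v $ q * x $ p) / (radius x)\<^sup>2)\<^sup>2 +
     (cmod (hp v x) / (radius x)\<^sup>2)\<^sup>2 + (\<Sum>i\<in>-{p, q}. (cmod (v $ i))\<^sup>2))"
proof -
  have h: "weight x * hp v v = levi x v v + weight x ^ 2 * hp v x * cnj (hp v x)"
    by (simp add: levi_def hp_cnj)
  have n: "weight x ^ 2 * hp v x * cnj (hp v x) = of_real ((cmod (hp v x) / (radius x)\<^sup>2)\<^sup>2)"
    using complex_norm_square[of "hp v x"] by (simp add: weight_real power_divide)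
  have t: "ht v v = of_real (\<Sum>i\<in>-{p, q}. (cmod (v $ i))\<^sup>2)"
    by (simp add: ht_def complex_norm_square[symmetric])
  have "herm a x v v = of_real a * levi x v v + weight x ^ 2 * hp v x * cnj (hp v x) + ht v v"
    by (simp add: herm_def h algebra_simps)
  then show ?thesis unfolding n t levi_self[OF assms] by simp
qed

lemma herm_pos:
  assumes x: "x \<in> W" and a: "a > 0" and v: "v \<noteq> 0"
  shows "0 < Re (herm a x v v)"
proof -
  let ?D = "(cmod (v $ p * x $ q - v $ q * x $ p) / (radius x)\<^sup>2)\<^sup>2"
  let ?H = "(cmod (hp v x) / (radius x)\<^sup>2)\<^sup>2"
  let ?T = "\<Sum>i\<in>-{p, q}. (cmod (v $ i))\<^sup>2"
  have nn: "0 \<le> ?D" "0 \<le> ?H" "0 \<le> ?T" by (auto intro: sum_nonneg)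
  have "?D \<noteq> 0 \<or> ?H \<noteq> 0 \<or> ?T \<noteq> 0"
  proof (rule ccontr)
    assume c: "\<not> ?thesis"
    have r: "radius x \<noteq> 0" using radius_pos[OF x] by simp
    have d: "v $ p * x $ q - v $ q * x $ p = 0" "hp v x = 0" using c r by auto
    have "hp v v * hp x x = 0" using lagrange[of v x] d by simp
    then have "radius v = 0" using hp_self_nonzero[OF x] by (simp add: hp_self)
    then have "v $ p = 0 \<and> v $ q = 0" using W_iff_radius[of v] by (auto simp: W_def)
    moreover have "v $ i = 0" if "i \<notin> {p, q}" for i
      using c that by (simp add: sum_nonneg_eq_0_iff)
    ultimately have "v $ i = 0" for i by (cases "i \<in> {p, q}") auto
    then show False using v by (simp add: vec_eq_iff)
  qed
  then have "0 < a * ?D + ?H + ?T"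
    using nn a by (smt (verit) mult_pos_pos mult_nonneg_nonneg)
  then show ?thesis by (simp only: herm_self[OF x] Re_complex_of_real)
qed

definition metric :: "real \<Rightarrow> ((complex ^ 'n) \<times> (complex ^ 'n), 'n) matrix_family" where
  "metric a c x = gram (herm a x)"

definition levi_matrix :: "complex \<Rightarrow> ((complex ^ 'n) \<times> (complex ^ 'n), 'n) matrix_family" where
  "levi_matrix k c x = gram (\<lambda>v w. k * levi x v w)"

lemma sesq_metric: "sesq (metric a c x) v w = herm a x v w"
  by (simp add: metric_def sesq_gram sesquilinear_herm)

lemma sesq_levi_matrix: "sesq (levi_matrix k c x) v w = k * levi x v w"
  unfolding levi_matrix_def by (rule sesq_gram[OF sesquilinear_cmult[OF sesquilinear_levi]])

lemma pos_metric: "x \<in> W \<Longrightarrow> a > 0 \<Longrightarrow> pos_matrix (metric a c x)"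
  unfolding pos_matrix_def sesq_metric
  by (auto simp: herm_pos hermitian_matrix_def metric_def gram_def herm_cnj)

lemma semipos_levi_matrix: "x \<in> W \<Longrightarrow> k \<ge> 0 \<Longrightarrow> semipos_matrix (levi_matrix (of_real k) c x)"
  unfolding semipos_matrix_def sesq_levi_matrix
  by (auto simp: levi_self hermitian_matrix_def levi_matrix_def gram_def levi_cnj)

lemma form_of_metric: "form_of (metric a) c x = alternation 2 (\<lambda>w. \<i> * herm a x (w 0) (w 1))"
  unfolding form_of_def metric_def form11_gram[OF sesquilinear_herm] by (simp add: alternation_cmult fun_eq_iff)

lemma form_of_levi_matrix: "form_of (levi_matrix k) c x = alternation 2 (\<lambda>w. \<i> * (k * levi x (w 0) (w 1)))"
  unfolding form_of_def levi_matrix_def form11_gram[OF sesquilinear_cmult[OF sesquilinear_levi]]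
  by (simp add: alternation_cmult fun_eq_iff)

lemma smooth_coord: "smooth_on (\<lambda>x. x $ i) S" "smooth_on (\<lambda>x :: complex ^ 'n. cnj (x $ i)) S"
  by (auto intro!: smooth_on_bounded_linear bounded_linear_vec_nth
      bounded_linear_compose[OF bounded_linear_cnj bounded_linear_vec_nth])

lemmas smooth_intros = smooth_coord smooth_on_const smooth_on_add[OF open_W] smooth_on_diff[OF open_W] smooth_on_mult[OF open_W]
  smooth_on_inverse[OF open_W]

lemma smooth_hp: "smooth_on (\<lambda>x. hp v x) W" "smooth_on (\<lambda>x. hp x w) W" "smooth_on (\<lambda>x. hp x x) W"
  unfolding hp_def by (intro smooth_intros)+

lemma smooth_weight: "smooth_on weight W"
  unfolding weight_def[abs_def] by (intro smooth_intros smooth_hp hp_self_nonzero)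

lemma smooth_levi: "smooth_on (\<lambda>x. levi x v w) W"
  unfolding levi_def power2_eq_square by (intro smooth_intros smooth_hp smooth_weight)

lemma smooth_herm: "smooth_on (\<lambda>x. herm a x v w) W"
  unfolding herm_def by (intro smooth_intros smooth_hp smooth_weight smooth_levi)

lemma hp_dilate: "hp (dilate m v) (dilate m w) = of_real (exp (of_int m)) ^ 2 * hp v w"
  by (simp add: hp_def dilate_def algebra_simps power2_eq_square)

lemma hp_deck:
  "hp v (deck m a x) = hp v (dilate m x)" "hp (deck m a x) v = hp (dilate m x) v"
  "weight (deck m a x) = inverse (of_real (exp (of_int m)) ^ 2) * weight x"
  using hp_dilate[of m x x] by (simp_all add: weight_def) (simp_all add: hp_def deck_nth dilate_def)

lemma levi_deck: "levi (deck m a x) (dilate m v) (dilate m w) = levi x v w"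
proof -
  have "of_real (exp (of_int m)) \<noteq> (0 :: complex)" by simp
  then show ?thesis unfolding levi_def hp_deck hp_dilate
    by (simp add: field_simps)
qed

lemma herm_deck: "herm b (deck m a x) (dilate m v) (dilate m w) = herm b x v w"
proof -
  have "of_real (exp (of_int m)) \<noteq> (0 :: complex)" by simp
  moreover have "ht (dilate m v) (dilate m w) = ht v w"
    unfolding ht_def by (intro sum.cong refl) (simp add: dilate_def)
  ultimately show ?thesis unfolding herm_def levi_deck hp_deck hp_dilate by simp
qed

lemma wirtinger_hp:
  "wirtinger (\<lambda>x. hp v x) x (\<lambda>r. 0) (\<lambda>t. hp v t)"
  "wirtinger (\<lambda>x. hp x w) x (\<lambda>r. hp r w) (\<lambda>t. 0)"
  "wirtinger (\<lambda>x. hp x x) x (\<lambda>r. hp r x) (\<lambda>t. hp x t)"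
  unfolding hp_def
proof -
  note rules = wirtinger_add wirtinger_mult wirtinger_const wirtinger_coord wirtinger_cnj_coord
  show "wirtinger (\<lambda>x. v $ p * cnj (x $ p) + v $ q * cnj (x $ q)) x (\<lambda>r. 0)
      (\<lambda>t. v $ p * cnj (t $ p) + v $ q * cnj (t $ q))"
    by (rule wirtinger_eqI, (rule rules)+) simp_all
  show "wirtinger (\<lambda>x. x $ p * cnj (w $ p) + x $ q * cnj (w $ q)) x
      (\<lambda>r. r $ p * cnj (w $ p) + r $ q * cnj (w $ q)) (\<lambda>t. 0)"
    by (rule wirtinger_eqI, (rule rules)+) simp_all
  show "wirtinger (\<lambda>x. x $ p * cnj (x $ p) + x $ q * cnj (x $ q)) x
      (\<lambda>r. r $ p * cnj (x $ p) + r $ q * cnj (x $ q)) (\<lambda>t. x $ p * cnj (t $ p) + x $ q * cnj (t $ q))"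
    by (rule wirtinger_eqI, (rule rules)+) simp_all
qed

lemma wirtinger_weight:
  assumes "x \<in> W"
  shows "wirtinger weight x (\<lambda>r. - (hp r x * weight x ^ 2)) (\<lambda>t. - (hp x t * weight x ^ 2))"
  unfolding weight_def[abs_def] by (rule wirtinger_inverse[OF wirtinger_hp(3) hp_self_nonzero[OF assms]])

lemma wirtinger_weight2:
  assumes "x \<in> W"
  shows "wirtinger (\<lambda>x. weight x ^ 2) x (\<lambda>r. - (2 * hp r x * weight x ^ 3)) (\<lambda>t. - (2 * hp x t * weight x ^ 3))"
  unfolding power2_eq_square
  by (rule wirtinger_eqI[OF wirtinger_mult[OF wirtinger_weight[OF assms] wirtinger_weight[OF assms]]])
    (simp_all add: power2_eq_square power3_eq_cube)

lemma wirtinger_weight3: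
  assumes "x \<in> W"
  shows "wirtinger (\<lambda>x. weight x ^ 3) x (\<lambda>r. - (3 * hp r x * weight x ^ 4)) (\<lambda>t. - (3 * hp x t * weight x ^ 4))"
proof -
  have "wirtinger (\<lambda>x. weight x * weight x ^ 2) x (\<lambda>r. - (3 * hp r x * weight x ^ 4)) (\<lambda>t. - (3 * hp x t * weight x ^ 4))"
    by (rule wirtinger_eqI[OF wirtinger_mult[OF wirtinger_weight[OF assms] wirtinger_weight2[OF assms]]])
      (simp_all add: eval_nat_numeral)
  then show ?thesis by (simp add: eval_nat_numeral)
qed

text \<open>The derivatives of the Levi form \<open>levi x v w\<close>: \<open>\<partial>\<close> in the direction r, dbar in the direction
  t, and both.\<close>

definition levi_dz where
  "levi_dz x r v w = 2 * weight x ^ 3 * hp r x * hp v x * hp x w - weight x ^ 2 * (hp r x * hp v w + hp v x * hp r w)"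

definition levi_dzbar where
  "levi_dzbar x t v w = 2 * weight x ^ 3 * hp x t * hp v x * hp x w - weight x ^ 2 * (hp x t * hp v w + hp v t * hp x w)"

definition levi_dz_dzbar where
  "levi_dz_dzbar x r t v w =
     2 * weight x ^ 3 * (hp r x * (hp x t * hp v w + hp v t * hp x w) + hp v x * (hp r t * hp x w + hp x t * hp r w))
     - weight x ^ 2 * (hp r t * hp v w + hp v t * hp r w) - 6 * weight x ^ 4 * hp r x * hp x t * hp v x * hp x w"

lemma wirtinger_levi:
  assumes "x \<in> W"
  shows "wirtinger (\<lambda>x. levi x v w) x (\<lambda>r. levi_dz x r v w) (\<lambda>t. levi_dzbar x t v w)"
  unfolding levi_def
  by (rule wirtinger_eqI, (rule wirtinger_diff wirtinger_mult wirtinger_const wirtinger_hp(1,2)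
        wirtinger_weight[OF assms] wirtinger_weight2[OF assms])+)
    (simp_all add: levi_dz_def levi_dzbar_def eval_nat_numeral algebra_simps)

lemma wirtinger_levi_dzbar:
  assumes "x \<in> W"
  shows "\<exists>B. wirtinger (\<lambda>x. levi_dzbar x t v w) x (\<lambda>r. levi_dz_dzbar x r t v w) B"
  unfolding levi_dzbar_def
  by (rule wirtinger_exI, (rule wirtinger_diff wirtinger_add wirtinger_mult wirtinger_const wirtinger_hp(1,2)
        wirtinger_weight3[OF assms] wirtinger_weight2[OF assms])+)
    (simp_all add: levi_dz_dzbar_def eval_nat_numeral algebra_simps)

definition herm_dz where
  "herm_dz a x r v w = (of_real a - 1) * levi_dz x r v w - hp r x * weight x ^ 2 * hp v w"

definition herm_dzbar where
  "herm_dzbar a x t v w = (of_real a - 1) * levi_dzbar x t v w - hp x t * weight x ^ 2 * hp v w"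

definition herm_dz_dzbar where
  "herm_dz_dzbar a x r t v w = (of_real a - 1) * levi_dz_dzbar x r t v w
     + (2 * weight x ^ 3 * hp r x * hp x t - weight x ^ 2 * hp r t) * hp v w"

lemma wirtinger_herm:
  assumes "x \<in> W"
  shows "wirtinger (\<lambda>x. herm a x v w) x (\<lambda>r. herm_dz a x r v w) (\<lambda>t. herm_dzbar a x t v w)"
  unfolding herm_def
  by (rule wirtinger_eqI, (rule wirtinger_add wirtinger_mult wirtinger_const
        wirtinger_weight[OF assms] wirtinger_levi[OF assms])+)
    (simp_all add: herm_dz_def herm_dzbar_def algebra_simps)

lemma wirtinger_herm_dzbar:
  assumes "x \<in> W"
  shows "\<exists>B. wirtinger (\<lambda>x. herm_dzbar a x t v w) x (\<lambda>r. herm_dz_dzbar a x r t v w) B"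
proof -
  obtain B where B: "wirtinger (\<lambda>x. levi_dzbar x t v w) x (\<lambda>r. levi_dz_dzbar x r t v w) B"
    using wirtinger_levi_dzbar[OF assms] by blast
  show ?thesis
    unfolding herm_dzbar_def
    by (rule wirtinger_exI, (rule wirtinger_diff wirtinger_mult wirtinger_const wirtinger_hp(2)
        wirtinger_weight2[OF assms] B)+)
      (simp_all add: herm_dz_dzbar_def eval_nat_numeral algebra_simps)
qed

text \<open>The condition \<open>\<partial>dbar \<omega>_a = 0\<close>. The second derivatives of the Levi form are symmetric in r
  and v. For the first summand, antisymmetrisation in the two-dimensional Hopf plane produces the
  Laplacian of \<open>r\<^sup>-\<^sup>2\<close>, which vanishes in real dimension 4.\<close>

lemma herm_dz_dzbar_antisymmetric:
  assumes "x \<in> W"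
  shows "herm_dz_dzbar a x r t v w - herm_dz_dzbar a x v t r w - herm_dz_dzbar a x r w v t + herm_dz_dzbar a x v w r t = 0"
proof -
  have e: "hp x x * (hp r t * hp v w - hp v t * hp r w) =
      hp r x * hp x t * hp v w - hp v x * hp x t * hp r w - hp r x * hp x w * hp v t + hp v x * hp x w * hp r t"
    by (simp add: hp_def algebra_simps)
  have levi: "levi_dz_dzbar x v t r w = levi_dz_dzbar x r t v w" "levi_dz_dzbar x v w r t = levi_dz_dzbar x r w v t"
    by (simp_all add: levi_dz_dzbar_def algebra_simps)
  show ?thesis
    using e weight_hp[OF assms] unfolding herm_dz_dzbar_def levi by algebra
qed

text \<open>An alternating trilinear form in vectors of a plane vanishes.\<close>

lemma three_in_two_dimensions:
  fixes A :: "complex ^ 'n \<Rightarrow> complex ^ 'n \<Rightarrow> complex" and B :: "complex ^ 'n \<Rightarrow> complex"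
  assumes "\<And>r v. A r v = app * r $ p * v $ p + apq * r $ p * v $ q + aqp * r $ q * v $ p + aqq * r $ q * v $ q"
    and "\<And>v. B v = bp * v $ p + bq * v $ q"
  shows "A r v' * B v - A v' r * B v - A v v' * B r - A r v * B v' + A v r * B v' + A v' v * B r = 0"
  unfolding assms by (simp add: algebra_simps)

section \<open>Gauduchon property, Aeppli class and Chern curvature\<close>

text \<open>The (1,0)-arguments r, v' and v of the two factors enter linearly and only through their coordinates p and
  q, since the metric of the torus is constant.\<close>

lemma herm_dz_dzbar_alternating_product:
  "herm_dz a x r v' w' * herm_dzbar a x t v w - herm_dz a x v' r w' * herm_dzbar a x t v w
   - herm_dz a x v v' w' * herm_dzbar a x t r w - herm_dz a x r v w' * herm_dzbar a x t v' w
   + herm_dz a x v r w' * herm_dzbar a x t v' w + herm_dz a x v' v w' * herm_dzbar a x t r w = 0"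
proof -
  let ?b = "of_real a - 1 :: complex" and ?K = "hp x w'" and ?L = "hp x w" and ?T = "hp x t"
  let ?A = "\<lambda>i j. ?b * (2 * weight x ^ 3 * cnj (x $ i) * cnj (x $ j) * ?K
      - weight x ^ 2 * (cnj (x $ i) * cnj (w' $ j) + cnj (x $ j) * cnj (w' $ i))) - weight x ^ 2 * cnj (x $ i) * cnj (w' $ j)"
  let ?B = "\<lambda>j. ?b * (2 * weight x ^ 3 * ?T * cnj (x $ j) * ?L
      - weight x ^ 2 * (?T * cnj (w $ j) + cnj (t $ j) * ?L)) - weight x ^ 2 * ?T * cnj (w $ j)"
  have h: "hp r w = r $ p * cnj (w $ p) + r $ q * cnj (w $ q)" for r w by (simp add: hp_def)
  have A: "herm_dz a x r v w' = ?A p p * r $ p * v $ p + ?A p q * r $ p * v $ q +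
      ?A q p * r $ q * v $ p + ?A q q * r $ q * v $ q" for r v
    unfolding herm_dz_def levi_dz_def h[of r] h[of v] by (simp add: algebra_simps)
  have B: "herm_dzbar a x t v w = ?B p * v $ p + ?B q * v $ q" for v
    unfolding herm_dzbar_def levi_dzbar_def h[of v] by (simp add: algebra_simps)
  show ?thesis by (rule three_in_two_dimensions[OF A B])
qed

lemma del_delbar_metric_power:
  assumes x: "x \<in> W"
  shows "del_delbar (2 * m) (\<lambda>y. alternation (2 * m)
    (\<lambda>w. \<Prod>l<m. \<i> * herm a y (w (2 * l)) (w (2 * l + 1)))) x v = 0"
proof (rule del_delbar_wedge_power[where s="\<lambda>y v w. \<i> * herm a y v w" and A="\<lambda>y r v w. \<i> * herm_dz a y r v w"
      and B="\<lambda>y t v w. \<i> * herm_dzbar a y t v w" and C="\<lambda>r t v w. \<i> * herm_dz_dzbar a x r t v w", OF open_W x])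
  show "wirtinger (\<lambda>y. \<i> * herm a y v w) y (\<lambda>r. \<i> * herm_dz a y r v w) (\<lambda>t. \<i> * herm_dzbar a y t v w)"
    if "y \<in> W" for y v w
    by (rule wirtinger_cmult[OF wirtinger_herm[OF that]])
  show "\<exists>B'. wirtinger (\<lambda>y. \<i> * herm_dzbar a y t v w) x (\<lambda>r. \<i> * herm_dz_dzbar a x r t v w) B'" for t v w
    using wirtinger_herm_dzbar[OF x] wirtinger_cmult by blast
  show "\<i> * herm_dz_dzbar a x r t v w - \<i> * herm_dz_dzbar a x v t r w - \<i> * herm_dz_dzbar a x r w v t +
      \<i> * herm_dz_dzbar a x v w r t = 0" for r t v w
    using herm_dz_dzbar_antisymmetric[OF x, of a r t v w] by algebra
  show "\<i> * herm_dz a x r v' w' * (\<i> * herm_dzbar a x t v w) - \<i> * herm_dz a x v' r w' * (\<i> * herm_dzbar a x t v w) -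
       \<i> * herm_dz a x v v' w' * (\<i> * herm_dzbar a x t r w) - \<i> * herm_dz a x r v w' * (\<i> * herm_dzbar a x t v' w) +
       \<i> * herm_dz a x v r w' * (\<i> * herm_dzbar a x t v' w) + \<i> * herm_dz a x v' v w' * (\<i> * herm_dzbar a x t r w) = 0"
    for t w w' r v v'
    using herm_dz_dzbar_alternating_product[of a x r v' w' t v w] by algebra
qed

lemma smooth_form_sesquilinear:
  assumes b: "\<And>x. sesquilinear (b x)" and sm: "\<And>v w. smooth_on (\<lambda>x. b x v w) W"
    and inv: "\<And>m a x v w. b (deck m a x) (dilate m v) (dilate m w) = b x v w"
    and \<alpha>: "\<And>c x. \<alpha> c x = alternation 2 (\<lambda>w. b x (w 0) (w 1))"
  shows "smooth_form atlas 2 \<alpha>"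
proof -
  have "smooth_form atlas 2 (\<lambda>c x. alternation 2 (\<lambda>w. b x (w 0) (w 1)))"
  proof (rule smooth_form_invariant)
    show "smooth_on (\<lambda>x. alternation 2 (\<lambda>w. b x (w 0) (w 1)) v) W" for v
      unfolding alternation_2 by (intro smooth_on_diff open_W sm)
    show "alternating_form 2 (alternation 2 (\<lambda>w. b x (w 0) (w 1)))" for x
      by (rule alternating_sesquilinear[OF b])
  qed (simp add: alternation_2 inv)
  then show ?thesis unfolding \<alpha>[abs_def] .
qed

lemma smooth_form_metric: "smooth_form atlas 2 (form_of (metric a))"
  by (rule smooth_form_sesquilinear[where b="\<lambda>x v w. \<i> * herm a x v w"])
    (auto intro!: sesquilinear_cmult sesquilinear_herm smooth_intros smooth_herm simp: herm_deck form_of_metric)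

lemma smooth_form_levi_matrix: "smooth_form atlas 2 (form_of (levi_matrix k))"
  by (rule smooth_form_sesquilinear[where b="\<lambda>x v w. \<i> * (k * levi x v w)"])
    (auto intro!: sesquilinear_cmult sesquilinear_levi smooth_intros smooth_levi simp: levi_deck form_of_levi_matrix)

lemma hermitian_metric_metric: "a > 0 \<Longrightarrow> hermitian_metric atlas (metric a)"
  using smooth_form_metric pos_metric chart_range_subset_W by (fastforce simp: hermitian_metric_def)

lemma gauduchon_metric: "a > 0 \<Longrightarrow> gauduchon atlas (metric a)"
  unfolding gauduchon_def
proof (intro conjI agree_on_atlasI ext)
  fix c x v assume "x \<in> W"
  then show "del_delbar (2 * (CARD('n) - 1)) (\<lambda>x. wedge_power (form_of (metric a) c x) (CARD('n) - 1)) x v = 0"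
    unfolding wedge_power_alternation[OF form_of_metric] by (rule del_delbar_metric_power)
qed (rule hermitian_metric_metric)

lemma aeppli_closed_metric: "aeppli_closed atlas (form_of (metric a))"
  unfolding aeppli_closed_def
proof (intro conjI smooth_form_metric agree_on_atlasI ext)
  have "form_of (metric a) c x = form11 (gram (\<lambda>v w. \<i> * herm a x v w))" for c x
    unfolding form_of_metric by (rule form11_gram[symmetric, OF sesquilinear_cmult[OF sesquilinear_herm]])
  then show "type11 atlas (form_of (metric a))" by (auto simp: type11_def)
  fix c x v assume "x \<in> W"
  then show "del_delbar 2 (form_of (metric a) c) x v = 0"
    using del_delbar_metric_power[of x 1 a v] unfolding form_of_metric[abs_def] by simp
qed

text \<open>The 1-form \<open>k dbar log r\<^sup>2\<close>. It is invariant under the deck group because a deck transformation adds a constant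
  to \<open>log r\<^sup>2\<close>.\<close>

definition dbar_log :: "complex \<Rightarrow> ((complex ^ 'n) \<times> (complex ^ 'n), 'n) form_family" where
  "dbar_log k c x = alternation (Suc 0) (\<lambda>w. k * (weight x * hp x (w 0)))"

lemma smooth_form_dbar_log: "smooth_form atlas 1 (dbar_log k)"
proof -
  have "smooth_form atlas 1 (\<lambda>c x. alternation (Suc 0) (\<lambda>w. k * (weight x * hp x (w 0))))"
  proof (rule smooth_form_invariant)
    fix x
    show "alternating_form 1 (alternation (Suc 0) (\<lambda>w. k * (weight x * hp x (w 0))))"
      unfolding One_nat_def
    proof (rule alternation_alternating)
      fix i and v :: "nat \<Rightarrow> complex ^ 'n" assume "i < Suc 0"
      then show "linear (\<lambda>t. k * (weight x * hp x ((v(i := t)) 0)))"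
        by (simp add: linear_iff hp_def algebra_simps scaleR_conv_of_real[where 'a=complex])
    qed simp
    show "smooth_on (\<lambda>x. alternation (Suc 0) (\<lambda>w. k * (weight x * hp x (w 0))) v) W" for v
      unfolding alternation_1 by (intro smooth_intros smooth_weight smooth_hp)
    show "alternation (Suc 0) (\<lambda>w. k * (weight (deck m a x) * hp (deck m a x) (w 0))) (\<lambda>i. dilate m (v i)) =
        alternation (Suc 0) (\<lambda>w. k * (weight x * hp x (w 0))) v" for m a x v
      unfolding alternation_1 hp_deck hp_dilate by simp
  qed
  then show ?thesis unfolding dbar_log_def[abs_def] .
qed

lemma del_dbar_log:
  assumes "x \<in> W"
  shows "del 1 (dbar_log k c) x = alternation 2 (\<lambda>w. k * levi x (w 0) (w 1))"
proof
  fix v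
  have "wirtinger (\<lambda>x. k * (weight x * hp x w)) x (\<lambda>r. k * levi x r w) (\<lambda>t. k * - (hp x t * weight x ^ 2 * hp x w))" for w
    by (rule wirtinger_eqI[OF wirtinger_cmult[OF wirtinger_mult[OF wirtinger_weight[OF assms] wirtinger_hp(2)]]])
      (simp_all add: levi_def algebra_simps)
  then have "ext_deriv_by dz_deriv (Suc 0) (\<lambda>y. alternation (Suc 0) (\<lambda>w. k * (weight y * hp y (w 0)))) x v =
      alternation (Suc (Suc 0)) (\<lambda>w. k * levi x (w 0) (w (Suc 0))) v"
    by (intro ext_deriv_by_wirtinger[where F="\<lambda>y w. k * (weight y * hp y (w 0))" and d="\<lambda>a b. a"
          and A="\<lambda>w r. k * levi x r (w 0)" and B="\<lambda>w t. k * - (hp x t * weight x ^ 2 * hp x (w 0))"]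
        linear_operator_dz wirtinger_dz)
  then show "del 1 (dbar_log k c) x v = alternation 2 (\<lambda>w. k * levi x (w 0) (w 1)) v"
    unfolding del_def dbar_log_def[abs_def] by (simp add: numeral_2_eq_2)
qed

lemma type11_alternation_levi:
  assumes "\<And>c x. x \<in> W \<Longrightarrow> \<alpha> c x = alternation 2 (\<lambda>w. k * levi x (w 0) (w 1))"
  shows "type11 atlas \<alpha>"
  unfolding type11_def
proof (intro ballI)
  fix c x assume "c \<in> atlas" "x \<in> chart_range c"
  then have "x \<in> W" using chart_range_subset_W by blast
  then show "\<exists>m. \<alpha> c x = form11 m"
    using assms form11_gram[OF sesquilinear_cmult[OF sesquilinear_levi], of k x]
    by (intro exI[of _ "gram (\<lambda>v w. k * levi x v w)"]) simp
qed

lemma smooth_form_zero: "smooth_form atlas k (\<lambda>c x v. 0)"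
  by (rule smooth_form_invariant)
    (auto simp: alternating_form_def smooth_on_const linear_iff)

lemma same_aeppli_class_metric: "same_aeppli_class atlas (form_of (metric a)) (form_of (metric b))"
  unfolding same_aeppli_class_def
proof (intro conjI aeppli_closed_metric exI)
  let ?k = "\<i> * (of_real a - of_real b)"
  show "smooth_form atlas 1 (dbar_log ?k)" by (rule smooth_form_dbar_log)
  show "type11 atlas (\<lambda>c. del 1 (dbar_log ?k c))"
    by (rule type11_alternation_levi[OF del_dbar_log])
  show "smooth_form atlas 1 (\<lambda>c x v. 0)" by (rule smooth_form_zero)
  show "type11 atlas (\<lambda>c. delbar 1 (\<lambda>x v. 0))"
    unfolding ext_deriv_zero by (rule type11_alternation_levi[where k=0]) (simp add: alternation_def fun_eq_iff)
  show "agree_on_charts atlas (\<lambda>c x v. form_of (metric a) c x v - form_of (metric b) c x v)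
     (\<lambda>c x v. del 1 (dbar_log ?k c) x v + delbar 1 (\<lambda>x v. 0) x v)"
  proof (intro agree_on_atlasI ext)
    fix c x v assume "x \<in> W"
    then show "form_of (metric a) c x v - form_of (metric b) c x v =
        del 1 (dbar_log ?k c) x v + delbar 1 (\<lambda>x v. 0) x v"
      unfolding ext_deriv_zero del_dbar_log[OF \<open>x \<in> W\<close>] form_of_metric alternation_diff[symmetric]
      by (simp add: herm_def algebra_simps)
  qed
qed

lemma axis_nth: "(axis i 1 :: complex ^ 'n) $ j = (if j = i then 1 else 0)"
  by (simp add: axis_def)

lemma hp_axis: "hp (axis i 1) w = (if i = p then cnj (w $ p) else if i = q then cnj (w $ q) else 0)"
  "hp w (axis i 1) = (if i = p then w $ p else if i = q then w $ q else 0)"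
  using p_neq_q by (auto simp: hp_def axis_def)

lemma ht_axis: "ht (axis i 1) (axis j 1) = (if i = j \<and> i \<noteq> p \<and> i \<noteq> q then 1 else 0)"
proof (cases "i \<in> {p, q}")
  case True
  then have "(axis i 1 :: complex ^ 'n) $ k = 0" if "k \<in> - {p, q}" for k
    using that by (auto simp: axis_def)
  then show ?thesis unfolding ht_def using True by (auto intro!: sum.neutral)
next
  case False
  have "ht (axis i 1) (axis j 1) = (\<Sum>k\<in>{i}. (axis i 1 :: complex ^ 'n) $ k * cnj ((axis j 1 :: complex ^ 'n) $ k))"
    unfolding ht_def using False by (intro sum.mono_neutral_right) (auto simp: axis_def)
  then show ?thesis using False by (auto simp: axis_def)
qed

lemma det_metric:
  assumes "x \<in> W"
  shows "det (metric a c x) = of_real a * weight x ^ 2"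
proof -
  let ?M = "metric a c x"
  have M: "?M $ i $ j = herm a x (axis i 1) (axis j 1)" for i j by (simp add: metric_def gram_def)
  have "det ?M = ?M $ p $ p * ?M $ q $ q - ?M $ p $ q * ?M $ q $ p"
    by (rule det_two_block[OF p_neq_q]) (auto simp: M herm_def levi_def hp_axis ht_axis axis_nth)
  also have "\<dots> = of_real a * weight x ^ 2"
  proof -
    have e: "weight x * (x $ p * cnj (x $ p) + x $ q * cnj (x $ q)) = 1"
      using weight_hp[OF assms] by (simp add: hp_def)
    have "hp (axis p 1) (axis q 1) = 0" "hp (axis q 1) (axis p 1) = 0"
      "hp (axis p 1) (axis p 1) = 1" "hp (axis q 1) (axis q 1) = 1"
      using p_neq_q by (auto simp: hp_def axis_def)
    moreover have "hp (axis p 1) w = cnj (w $ p)" "hp (axis q 1) w = cnj (w $ q)"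
      "hp w (axis p 1) = w $ p" "hp w (axis q 1) = w $ q" for w
      using p_neq_q by (simp_all add: hp_axis)
    ultimately have "?M $ p $ p * ?M $ q $ q - ?M $ p $ q * ?M $ q $ p =
        (weight x + (of_real a - 1) * (weight x - weight x ^ 2 * cnj (x $ p) * x $ p)) *
        (weight x + (of_real a - 1) * (weight x - weight x ^ 2 * cnj (x $ q) * x $ q)) -
        (of_real a - 1) * (weight x ^ 2 * cnj (x $ p) * x $ q) * ((of_real a - 1) * (weight x ^ 2 * cnj (x $ q) * x $ p))"
      using p_neq_q unfolding M herm_def levi_def by (simp only: ht_axis) simp
    also have "\<dots> = of_real a * weight x ^ 2"
      using e by algebra
    finally show ?thesis .
  qed
  finally show ?thesis .
qed

lemma wirtinger_ln_det:
  assumes x: "x \<in> W" and a: "a > 0"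
  shows "wirtinger (\<lambda>x. Ln (of_real a * weight x ^ 2)) x (\<lambda>r. - 2 * (weight x * hp r x)) (\<lambda>t. - 2 * (weight x * hp x t))"
proof -
  have r: "radius x > 0" using x by (rule radius_pos)
  have nz: "weight x \<noteq> 0" using weight_hp[OF x] by auto
  have "of_real a * weight x ^ 2 = of_real (a * (1 / (radius x)\<^sup>2) ^ 2)"
    by (simp add: weight_real)
  moreover have "0 < a * (1 / (radius x)\<^sup>2) ^ 2" using a r by simp
  ultimately have "of_real a * weight x ^ 2 \<notin> \<real>\<^sub>\<le>\<^sub>0"
    by (metis complex_nonpos_Reals_iff Re_complex_of_real not_le)
  from wirtinger_Ln[OF wirtinger_cmult[OF wirtinger_weight2[OF x]] this]
  show ?thesis
    by (rule wirtinger_eqI) (use a nz in \<open>simp_all add: field_simps eval_nat_numeral\<close>)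
qed

text \<open>The parameter a contributes a constant to the logarithm of the determinant, so the Chern-Ricci form is that
  of the conformally flat metric.\<close>

lemma chern_ricci_metric:
  assumes x: "x \<in> W" and a: "a > 0"
  shows "chern_ricci (metric a) c x = levi_matrix 2 c x"
proof -
  have inner: "dzbar_deriv t (\<lambda>y. Ln (det (metric a c y))) y = - 2 * (weight y * hp y t)" if "y \<in> W" for y t
  proof -
    have "dzbar_deriv t (\<lambda>y. Ln (det (metric a c y))) y = dzbar_deriv t (\<lambda>y. Ln (of_real a * weight y ^ 2)) y"
      unfolding dzbar_deriv_def
      using dderiv_cong_open[OF open_W that, of "\<lambda>y. Ln (det (metric a c y))"] by (simp add: det_metric)
    then show ?thesis by (simp only: wirtinger_dzbar[OF wirtinger_ln_det[OF that a]])
  qed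
  have "dz_deriv r (dzbar_deriv t (\<lambda>y. Ln (det (metric a c y)))) x = - 2 * levi x r t" for r t
  proof -
    have "dz_deriv r (dzbar_deriv t (\<lambda>y. Ln (det (metric a c y)))) x = dz_deriv r (\<lambda>y. - 2 * (weight y * hp y t)) x"
      by (rule dz_deriv_cong_open[OF open_W x inner])
    also have "\<dots> = - 2 * levi x r t"
      by (subst wirtinger_dz[OF wirtinger_cmult[OF wirtinger_mult[OF wirtinger_weight[OF x] wirtinger_hp(2)]]])
        (simp add: levi_def algebra_simps)
    finally show ?thesis .
  qed
  then show ?thesis by (simp add: chern_ricci_def levi_matrix_def gram_def vec_eq_iff)
qed

text \<open>Raising an index of the Chern-Ricci form gives 2 / a times the projection Q of the Hopf plane onto
  the complement of the line through x, whose complex trace is 1. Thus the inverse matrix need not be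
  computed.\<close>

lemma chern_scalar_metric:
  assumes x: "x \<in> W" and a: "a > 0"
  shows "chern_scalar (metric a) c x = of_real (2 / a)"
proof -
  let ?h = "metric a c x"
  define Q :: "complex ^ 'n ^ 'n" where
    "Q = (\<chi> k i. of_real (2 / a) * (if k = p \<or> k = q then axis i 1 $ k - weight x * hp (axis i 1) x * x $ k else 0))"
  have nz: "weight x \<noteq> 0" using weight_hp[OF x] by auto
  have "det (transpose ?h) \<noteq> 0" using nz a by (simp add: det_transpose det_metric[OF x])
  then have "invertible (transpose ?h)" by (simp add: invertible_det_nz)
  then have inv: "matrix_inv (transpose ?h) ** transpose ?h = mat 1"
    unfolding invertible_def matrix_inv_def by (rule someI2_ex) simp
  have R: "(\<Sum>k\<in>UNIV. transpose ?h $ j $ k * Q $ k $ i) = levi_matrix 2 c x $ i $ j" for i j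
  proof -
    have e: "weight x * (x $ p * cnj (x $ p) + x $ q * cnj (x $ q)) = 1"
      using weight_hp[OF x] by (simp add: hp_def)
    have "(\<Sum>k\<in>UNIV. transpose ?h $ j $ k * Q $ k $ i) = (\<Sum>k\<in>{p, q}. transpose ?h $ j $ k * Q $ k $ i)"
      by (rule sum.mono_neutral_right) (auto simp: Q_def)
    also have "\<dots> = ?h $ p $ j * Q $ p $ i + ?h $ q $ j * Q $ q $ i"
      using p_neq_q by (simp add: transpose_def)
    also have "\<dots> = levi_matrix 2 c x $ i $ j"
    proof -
      define be :: complex where "be = of_real (2 / a)"
      have ia: "of_real a * be = 2" using a by (simp add: be_def)
      define Ip Iq Ep Eq where E: "Ip = (axis i 1 :: complex ^ 'n) $ p" "Iq = (axis i 1 :: complex ^ 'n) $ q"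
        "Ep = cnj ((axis j 1 :: complex ^ 'n) $ p)" "Eq = cnj ((axis j 1 :: complex ^ 'n) $ q)"
      have h: "hp (axis p 1) (axis j 1) = Ep" "hp (axis q 1) (axis j 1) = Eq" and h0: "hp (axis p 1) w = cnj (w $ p)" "hp (axis q 1) w = cnj (w $ q)" for w
        using p_neq_q by (simp_all add: hp_axis(1) E)
      have h': "hp (axis i 1) w = Ip * cnj (w $ p) + Iq * cnj (w $ q)" "hp w (axis j 1) = w $ p * Ep + w $ q * Eq" for w
        by (simp_all add: hp_def E)
      have hj: "?h $ k $ j = weight x * hp (axis k 1) (axis j 1) + (of_real a - 1) *
          (weight x * hp (axis k 1) (axis j 1) - weight x ^ 2 * hp (axis k 1) x * hp x (axis j 1))" if "k = p \<or> k = q" for k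
        using that by (auto simp: metric_def gram_def herm_def levi_def ht_axis)
      have Q: "Q $ k $ i = be * (axis i 1 $ k - weight x * hp (axis i 1) x * x $ k)" if "k = p \<or> k = q" for k
        using that by (simp add: Q_def be_def)
      have l: "levi_matrix 2 c x $ i $ j = 2 * (weight x * hp (axis i 1) (axis j 1) - weight x ^ 2 * hp (axis i 1) x * hp x (axis j 1))"
        by (simp add: levi_matrix_def gram_def levi_def)
      have hpj: "?h $ p $ j = weight x * Ep + (of_real a - 1) *
          (weight x * Ep - weight x ^ 2 * cnj (x $ p) * (x $ p * Ep + x $ q * Eq))"
        by (simp only: hj[of p, OF disjI1[OF refl]] h0 h'(2)) (simp add: axis_nth p_neq_q p_neq_q[symmetric])
      have hqj: "?h $ q $ j = weight x * Eq + (of_real a - 1) *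
          (weight x * Eq - weight x ^ 2 * cnj (x $ q) * (x $ p * Ep + x $ q * Eq))"
        by (simp only: hj[of q, OF disjI2[OF refl]] h0 h'(2)) (simp add: axis_nth p_neq_q p_neq_q[symmetric])
      have hij: "hp (axis i 1) (axis j 1) = Ip * Ep + Iq * Eq" by (simp add: hp_def E)
      show ?thesis
        unfolding l hij hpj hqj Q[OF disjI1[OF refl]] Q[OF disjI2[OF refl]] h' E(1,2)[symmetric]
        using e ia by algebra
    qed
    finally show ?thesis .
  qed
  have "chern_scalar (metric a) c x =
      (\<Sum>i\<in>UNIV. \<Sum>j\<in>UNIV. matrix_inv (transpose ?h) $ i $ j * (\<Sum>k\<in>UNIV. transpose ?h $ j $ k * Q $ k $ i))"
    unfolding chern_scalar_def chern_ricci_metric[OF assms] R ..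
  also have "\<dots> = (\<Sum>i\<in>UNIV. \<Sum>k\<in>UNIV. (matrix_inv (transpose ?h) ** transpose ?h) $ i $ k * Q $ k $ i)"
    unfolding matrix_matrix_mult_def sum_distrib_left
    by (rule sum.cong[OF refl], subst sum.swap) (simp add: sum_distrib_right mult.assoc)
  also have "\<dots> = (\<Sum>i\<in>UNIV. Q $ i $ i)"
    unfolding inv by (simp add: mat_def if_distrib[of "\<lambda>x. x * _"] cong: if_cong)
  also have "\<dots> = (\<Sum>i\<in>{p, q}. Q $ i $ i)"
    by (rule sum.mono_neutral_right) (auto simp: Q_def)
  also have "\<dots> = of_real (2 / a) * (2 - weight x * hp x x)"
    using p_neq_q by (simp add: Q_def hp_axis(1) axis_nth hp_def[of x x] del: of_real_divide) (simp add: algebra_simps)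
  also have "\<dots> = of_real (2 / a)"
    using weight_hp[OF x] by simp
  finally show ?thesis .
qed

text \<open>The Chern-Ricci form of the metric itself, divided by \<open>2 pi\<close>, is a semi-positive
  representative. It is closed since the coefficients of its image under \<open>\<partial>\<close> are symmetric in the two
  (1,0)-arguments, and those of its image under dbar in the two (0,1)-arguments.\<close>

lemma c1_nonneg_atlas: "c1_nonneg atlas"
  unfolding c1_nonneg_def represents_c1_def
proof (intro exI conjI)
  let ?k = "of_real (1 / pi)"
  let ?m = "levi_matrix ?k"
  show "smooth_form atlas 2 (form_of ?m)" by (rule smooth_form_levi_matrix)
  have "semipos_matrix (?m c x)" if "c \<in> atlas" "x \<in> chart_range c" for c x
    using that chart_range_subset_W[OF that(1)] by (intro semipos_levi_matrix) auto
  then show "\<forall>c\<in>atlas. \<forall>x\<in>chart_range c. hermitian_matrix (?m c x)" "semipositive atlas ?m"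
    by (auto simp: semipos_matrix_def semipositive_def)
  show "hermitian_metric atlas (metric 1)" by (rule hermitian_metric_metric) simp
  show "smooth_form atlas 1 (\<lambda>c x v. 0)" by (rule smooth_form_zero)
  show "\<forall>c\<in>atlas. \<forall>x\<in>chart_range c. \<forall>v. 0 \<in> \<real>" by simp
  show "agree_on_charts atlas (\<lambda>c x v. form_of ?m c x v - form_of (chern_ricci (metric 1)) c x v / (2 * pi))
     (\<lambda>c. ext_deriv 1 (\<lambda>x v. 0))"
  proof (intro agree_on_atlasI ext)
    fix c x v assume x: "x \<in> W"
    have "form_of (chern_ricci (metric 1)) c x = form_of (levi_matrix 2) c x"
      by (rule ext) (simp add: form_of_def chern_ricci_metric[OF x])
    then show "form_of ?m c x v - form_of (chern_ricci (metric 1)) c x v / (2 * pi) = ext_deriv 1 (\<lambda>x v. 0) x v"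
      unfolding ext_deriv_zero by (simp add: form_of_levi_matrix alternation_2 field_simps)
  qed
  show "agree_on_charts atlas (\<lambda>c. ext_deriv 2 (form_of ?m c)) (\<lambda>c x v. 0)"
  proof (intro agree_on_atlasI ext)
    fix c x v assume x: "x \<in> W"
    let ?c = "\<i> * ?k"
    have "wirtinger (\<lambda>y. \<i> * (?k * levi y v w)) x (\<lambda>r. ?c * levi_dz x r v w) (\<lambda>t. ?c * levi_dzbar x t v w)" for v w
      by (rule wirtinger_eqI[OF wirtinger_cmult[OF wirtinger_cmult[OF wirtinger_levi[OF x]]]]) simp_all
    then have "ext_deriv 2 (form_of ?m c) x v = alternation (Suc 2) (\<lambda>w.
        ?c * levi_dz x (w 0) (w (Suc 0)) (w (Suc 1)) + ?c * levi_dzbar x (w 0) (w (Suc 0)) (w (Suc 1))) v"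
      unfolding ext_deriv_def form_of_levi_matrix[abs_def]
      by (intro ext_deriv_by_wirtinger[where F="\<lambda>y w. \<i> * (?k * levi y (w 0) (w 1))" and d="(+)"
          and A="\<lambda>w r. ?c * levi_dz x r (w 0) (w 1)" and B="\<lambda>w t. ?c * levi_dzbar x t (w 0) (w 1)"]
        linear_operator_dderiv wirtinger_dderiv)
    also have "\<dots> = 0"
    proof -
      have "alternation (Suc 2) (\<lambda>w. ?c * levi_dz x (w 0) (w (Suc 0)) (w (Suc 1))) v = 0"
        by (rule alternation_symmetric[of 0 _ 1]) (auto simp: levi_dz_def Transposition.transpose_def algebra_simps)
      moreover have "alternation (Suc 2) (\<lambda>w. ?c * levi_dzbar x (w 0) (w (Suc 0)) (w (Suc 1))) v = 0"
        by (rule alternation_symmetric[of 0 _ 2]) (auto simp: levi_dzbar_def Transposition.transpose_def algebra_simps eval_nat_numeral)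
      ultimately show ?thesis by (simp only: alternation_add add_0)
    qed
    finally show "ext_deriv 2 (form_of ?m c) x v = 0" .
  qed
qed

section \<open>Levi-Civita connection\<close>

definition ip :: "complex ^ 'n \<Rightarrow> complex ^ 'n \<Rightarrow> real" where
  "ip v w = Re (hp v w)"

text \<open>The projection onto the Hopf plane, whose real inner product is \<open>ip\<close>. Everything of interest happens in the
  Hopf plane, as the torus factor is flat.\<close>

definition hpart :: "complex ^ 'n \<Rightarrow> complex ^ 'n" where
  "hpart v = (\<chi> i. if i = p \<or> i = q then v $ i else 0)"

definition J :: "complex ^ 'n \<Rightarrow> complex ^ 'n" where
  "J v = \<i> *s v"

text \<open>The metric \<open>r\<^sup>-\<^sup>2\<close> times the Euclidean metric on the Hopf plane, which is the product metric of the line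
  with the unit 3-sphere. The forms \<open>\<eta>\<close> and \<open>\<theta>\<close> below are its products with the unit vector
  fields x, which is the radial one, and J x, which is tangent to the Hopf fibres.\<close>

definition cyl :: "complex ^ 'n \<Rightarrow> complex ^ 'n \<Rightarrow> complex ^ 'n \<Rightarrow> real" where
  "cyl x v w = ip v w * inverse (ip x x)"

definition \<eta> :: "complex ^ 'n \<Rightarrow> complex ^ 'n \<Rightarrow> real" where
  "\<eta> x v = cyl x v x"

definition \<theta> :: "complex ^ 'n \<Rightarrow> complex ^ 'n \<Rightarrow> real" where
  "\<theta> x v = cyl x v (J x)"

lemma ip_commute: "ip v w = ip w v"
  by (simp add: ip_def hp_def mult.commute)

lemma ip_linear:
  "ip (v + v') w = ip v w + ip v' w" "ip v (w + w') = ip v w + ip v w'"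
  "ip (v - v') w = ip v w - ip v' w" "ip v (w - w') = ip v w - ip v w'"
  "ip (- v) w = - ip v w" "ip v (- w) = - ip v w"
  "ip (r *\<^sub>R v) w = r * ip v w" "ip v (r *\<^sub>R w) = r * ip v w"
  by (simp_all add: ip_def hp_def algebra_simps)

lemma ip_hpart: "ip (hpart v) w = ip v w" "ip v (hpart w) = ip v w"
  using p_neq_q by (simp_all add: ip_def hp_def hpart_def)

lemma ip_J: "ip (J v) w = - ip v (J w)" "ip (J v) (J w) = ip v w"
  by (simp_all add: ip_def hp_def J_def algebra_simps)

lemma ip_J_swap: "ip v (J w) = - ip w (J v)"
  by (simp add: ip_commute[of v "J w"] ip_J)

lemma ip_J_self: "ip v (J v) = 0" "ip (J v) v = 0"
  by (simp_all add: ip_def hp_def J_def algebra_simps)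

lemma J_linear: "J (v + w) = J v + J w" "J (v - w) = J v - J w" "J (- v) = - J v"
  "J (r *\<^sub>R v) = r *\<^sub>R J v" "J (J v) = - v"
  by (simp_all add: J_def vec_eq_iff algebra_simps)

lemma hpart_linear: "hpart (v + w) = hpart v + hpart w" "hpart (v - w) = hpart v - hpart w"
  "hpart (r *\<^sub>R v) = r *\<^sub>R hpart v" "hpart (J v) = J (hpart v)" "hpart (hpart v) = hpart v"
  "hpart (- v) = - hpart v"
  by (simp_all add: hpart_def J_def vec_eq_iff algebra_simps)

lemma inner_hpart: "hpart y \<bullet> e = ip y e" "J (hpart y) \<bullet> e = ip (J y) e"
proof -
  have *: "hpart y \<bullet> e = ip y e" for y
  proof -
    have "hpart y \<bullet> e = (\<Sum>i\<in>UNIV. hpart y $ i \<bullet> e $ i)" by (simp add: inner_vec_def)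
    also have "\<dots> = (\<Sum>i\<in>{p, q}. hpart y $ i \<bullet> e $ i)"
      by (rule sum.mono_neutral_right) (auto simp: hpart_def)
    finally show ?thesis using p_neq_q by (simp add: hpart_def ip_def hp_def inner_complex_def)
  qed
  show "hpart y \<bullet> e = ip y e" by (rule *)
  show "J (hpart y) \<bullet> e = ip (J y) e" using *[of "J y"] by (simp add: hpart_linear)
qed

lemma trace_ip: "(\<Sum>e\<in>Basis. ip P e * ip Q e) = ip P Q"
proof -
  have "ip P Q = hpart P \<bullet> hpart Q" by (simp add: inner_hpart ip_hpart)
  also have "\<dots> = (\<Sum>e\<in>Basis. ip P e * ip Q e)"
    by (subst euclidean_inner) (simp only: inner_hpart)
  finally show ?thesis ..
qed

lemma trace_ip_self: "(\<Sum>e\<in>Basis. ip e e) = 4"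
proof -
  let ?a = "axis p 1 :: complex ^ 'n" and ?c = "axis q 1 :: complex ^ 'n"
  have n: "?a $ p = 1" "?a $ q = 0" "?c $ p = 0" "?c $ q = 1"
    using p_neq_q by (auto simp: axis_def)
  have "ip e e = ip ?a e * ip ?a e + ip (J ?a) e * ip (J ?a) e + ip ?c e * ip ?c e + ip (J ?c) e * ip (J ?c) e" for e
    by (simp add: ip_def hp_def J_def n)
  then have "(\<Sum>e\<in>Basis. ip e e) = (\<Sum>e\<in>Basis. ip ?a e * ip ?a e + ip (J ?a) e * ip (J ?a) e + ip ?c e * ip ?c e + ip (J ?c) e * ip (J ?c) e)"
    by (intro sum.cong refl)
  also have "\<dots> = 4"
    unfolding sum.distrib trace_ip by (simp add: ip_def hp_def J_def n)
  finally show ?thesis .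
qed

lemma ip_self_pos: "x \<in> W \<Longrightarrow> 0 < ip x x"
  using radius_pos[of x] by (simp add: ip_def hp_self)

lemma \<eta>\<theta>_simps:
  assumes "x \<in> W"
  shows "\<eta> x x = 1" "\<theta> x x = 0" "\<eta> x (J v) = - \<theta> x v" "\<theta> x (J v) = \<eta> x v"
    "\<eta> x (hpart v) = \<eta> x v" "\<theta> x (hpart v) = \<theta> x v"
    "cyl x x v = \<eta> x v" "cyl x (J x) v = \<theta> x v" "cyl x v x = \<eta> x v" "cyl x v (J x) = \<theta> x v"
    "cyl x (hpart v) w = cyl x v w" "cyl x v (hpart w) = cyl x v w"
  using ip_self_pos[OF assms]
  by (simp_all add: \<eta>_def \<theta>_def cyl_def ip_hpart ip_J ip_J_self ip_commute[of x v] ip_commute[of "J x" v] ip_J_swap[of x v] J_linear ip_linear)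

lemma cyl_linear:
  "cyl x (v + v') w = cyl x v w + cyl x v' w" "cyl x v (w + w') = cyl x v w + cyl x v w'"
  "cyl x (v - v') w = cyl x v w - cyl x v' w" "cyl x v (w - w') = cyl x v w - cyl x v w'"
  "cyl x (- v) w = - cyl x v w" "cyl x v (- w) = - cyl x v w"
  "cyl x (r *\<^sub>R v) w = r * cyl x v w" "cyl x v (r *\<^sub>R w) = r * cyl x v w"
  "cyl x (J v) w = - cyl x v (J w)"
  by (simp_all add: cyl_def ip_linear algebra_simps ip_J)

lemma \<eta>\<theta>_linear:
  "\<eta> x (v + w) = \<eta> x v + \<eta> x w" "\<eta> x (v - w) = \<eta> x v - \<eta> x w" "\<eta> x (- v) = - \<eta> x v" "\<eta> x (r *\<^sub>R v) = r * \<eta> x v"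
  "\<theta> x (v + w) = \<theta> x v + \<theta> x w" "\<theta> x (v - w) = \<theta> x v - \<theta> x w" "\<theta> x (- v) = - \<theta> x v" "\<theta> x (r *\<^sub>R v) = r * \<theta> x v"
  by (simp_all add: \<eta>_def \<theta>_def cyl_linear)

lemma cyl_commute: "cyl x v w = cyl x w v"
  by (simp add: cyl_def ip_commute)

definition riem_metric :: "real \<Rightarrow> complex ^ 'n \<Rightarrow> complex ^ 'n \<Rightarrow> complex ^ 'n \<Rightarrow> real" where
  "riem_metric a x v w = 2 * (a * cyl x v w + (1 - a) * (\<eta> x v * \<eta> x w + \<theta> x v * \<theta> x w) + Re (ht v w))"

lemma real_metric_metric: "real_metric (metric a c x) v w = riem_metric a x v w"
proof -
  have weight: "weight x = of_real (inverse (ip x x))"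
    by (simp add: weight_def ip_def hp_self)
  have im: "Im (hp v x) = ip v (J x)" for v by (simp add: ip_def hp_def J_def)
  have re: "Re (hp v x) = ip v x" for v by (simp add: ip_def)
  have "weight x ^ 2 * hp v x * hp x w = of_real (inverse (ip x x) ^ 2) * (hp v x * cnj (hp w x))"
    unfolding hp_cnj weight of_real_power by (simp only: mult.assoc)
  then have "Re (weight x ^ 2 * hp v x * hp x w) = inverse (ip x x) ^ 2 * Re (hp v x * cnj (hp w x))"
    by (simp only: times_complex.sel Re_complex_of_real Im_complex_of_real mult_zero_left diff_zero)
  also have "\<dots> = \<eta> x v * \<eta> x w + \<theta> x v * \<theta> x w"
    by (simp add: re im \<eta>_def \<theta>_def cyl_def power2_eq_square algebra_simps)
  finally have 1: "Re (weight x ^ 2 * hp v x * hp x w) = \<eta> x v * \<eta> x w + \<theta> x v * \<theta> x w" .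
  have 2: "Re (weight x * hp v w) = cyl x v w"
    unfolding weight cyl_def ip_def by (simp only: times_complex.sel Re_complex_of_real Im_complex_of_real mult_zero_left diff_zero mult.commute)
  have "herm a x v w = of_real a * (weight x * hp v w) + of_real (1 - a) * (weight x ^ 2 * hp v x * hp x w) + ht v w"
    by (simp add: herm_def levi_def algebra_simps)
  then have "Re (herm a x v w) = a * Re (weight x * hp v w) + (1 - a) * Re (weight x ^ 2 * hp v x * hp x w) + Re (ht v w)"
    by (simp only: plus_complex.sel Re_complex_of_real times_complex.sel Im_complex_of_real mult_zero_left diff_zero)
  then show ?thesis unfolding real_metric_def sesq_metric riem_metric_def 1 2 by simp
qed

text \<open>A vector that represents the linear form \<open>\<phi>\<close> is unique, because the metric is positive definite.\<close>

lemma sharp_riem_metric: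
  assumes "x \<in> W" "a > 0" "\<And>z. riem_metric a x y z = \<phi> z"
  shows "sharp (riem_metric a x) \<phi> = y"
  unfolding sharp_def
proof (rule the_equality)
  fix y' assume y': "\<forall>z. riem_metric a x y' z = \<phi> z"
  have "riem_metric a x (y' - y) z = riem_metric a x y' z - riem_metric a x y z" for z
    by (simp add: riem_metric_def cyl_linear \<eta>\<theta>_linear ht_def sum_subtractf algebra_simps)
  then have "riem_metric a x (y' - y) (y' - y) = 0" using y' assms(3) by simp
  moreover have "riem_metric a x v v = 2 * Re (herm a x v v)" for v
    using real_metric_metric[of a undefined x v v] by (simp add: real_metric_def sesq_metric)
  ultimately show "y' = y" using herm_pos[OF assms(1,2), of "y' - y"] by auto
qed (use assms(3) in blast)

lemma bounded_linear_hpart: "bounded_linear hpart"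
  unfolding linear_conv_bounded_linear[symmetric] linear_iff by (simp add: hpart_linear)

lemma bounded_bilinear_ip: "bounded_bilinear ip"
proof -
  have "ip = (\<lambda>v w. hpart v \<bullet> w)" by (simp add: inner_hpart fun_eq_iff)
  then show ?thesis
    using bounded_bilinear.comp1[OF bounded_bilinear_inner bounded_linear_hpart] by simp
qed

lemma bounded_linear_J: "bounded_linear J"
  unfolding linear_conv_bounded_linear[symmetric] linear_iff by (simp add: J_linear)

lemma has_derivative_inverse_ip:
  assumes "x \<in> W"
  shows "((\<lambda>y. inverse (ip y y)) has_derivative (\<lambda>v. - 2 * \<eta> x v * inverse (ip x x))) (at x)"
proof -
  have "((\<lambda>y. inverse (ip y y)) has_derivative (\<lambda>v. - (inverse (ip x x) * (ip x v + ip v x) * inverse (ip x x)))) (at x)"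
    using ip_self_pos[OF assms]
    by (intro Deriv.has_derivative_inverse bounded_bilinear.FDERIV[OF bounded_bilinear_ip] has_derivative_ident) simp
  then show ?thesis
    by (rule has_derivative_eq_rhs) (simp add: \<eta>_def cyl_def ip_commute fun_eq_iff)
qed

lemma has_derivative_cyl:
  assumes "x \<in> W"
  shows "((\<lambda>y. cyl y w z) has_derivative (\<lambda>v. - 2 * \<eta> x v * cyl x w z)) (at x)"
  unfolding cyl_def
  by (rule has_derivative_eq_rhs[OF has_derivative_mult_right[OF has_derivative_inverse_ip[OF assms]]])
    (simp add: algebra_simps fun_eq_iff)

lemma has_derivative_\<eta>:
  assumes "x \<in> W"
  shows "((\<lambda>y. \<eta> y w) has_derivative (\<lambda>v. cyl x w v - 2 * \<eta> x w * \<eta> x v)) (at x)"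
  unfolding \<eta>_def cyl_def
  by (rule has_derivative_eq_rhs[OF has_derivative_mult[OF
        bounded_bilinear.FDERIV[OF bounded_bilinear_ip has_derivative_const has_derivative_ident]
        has_derivative_inverse_ip[OF assms]]])
    (simp add: \<eta>_def cyl_def ip_linear bounded_bilinear.zero_left[OF bounded_bilinear_ip] algebra_simps fun_eq_iff)

lemma has_derivative_\<theta>:
  assumes "x \<in> W"
  shows "((\<lambda>y. \<theta> y w) has_derivative (\<lambda>v. cyl x w (J v) - 2 * \<theta> x w * \<eta> x v)) (at x)"
  unfolding \<theta>_def cyl_def
  by (rule has_derivative_eq_rhs[OF has_derivative_mult[OF
        bounded_bilinear.FDERIV[OF bounded_bilinear_ip has_derivative_const bounded_linear_imp_has_derivative[OF bounded_linear_J]]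
        has_derivative_inverse_ip[OF assms]]])
    (simp add: \<eta>_def cyl_def ip_linear bounded_bilinear.zero_left[OF bounded_bilinear_ip] algebra_simps fun_eq_iff)

lemma dderiv_riem_metric:
  assumes "x \<in> W"
  shows "dderiv v (\<lambda>y. riem_metric a y w z) x = 2 * (- 2 * a * \<eta> x v * cyl x w z + (1 - a) *
     ((cyl x w v - 2 * \<eta> x w * \<eta> x v) * \<eta> x z + \<eta> x w * (cyl x z v - 2 * \<eta> x z * \<eta> x v) +
      (cyl x w (J v) - 2 * \<theta> x w * \<eta> x v) * \<theta> x z + \<theta> x w * (cyl x z (J v) - 2 * \<theta> x z * \<eta> x v)))"
proof -
  have "((\<lambda>y. riem_metric a y w z) has_derivative (\<lambda>v. 2 * (- 2 * a * \<eta> x v * cyl x w z + (1 - a) *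
     ((cyl x w v - 2 * \<eta> x w * \<eta> x v) * \<eta> x z + \<eta> x w * (cyl x z v - 2 * \<eta> x z * \<eta> x v) +
      (cyl x w (J v) - 2 * \<theta> x w * \<eta> x v) * \<theta> x z + \<theta> x w * (cyl x z (J v) - 2 * \<theta> x z * \<eta> x v))))) (at x)"
    unfolding riem_metric_def
    by (rule has_derivative_eq_rhs, (rule has_derivative_mult_right has_derivative_add has_derivative_mult
          has_derivative_const has_derivative_cyl[OF assms] has_derivative_\<eta>[OF assms] has_derivative_\<theta>[OF assms])+)
      (simp add: algebra_simps fun_eq_iff)
  then show ?thesis by (rule dderiv_eq)
qed

text \<open>The covariant derivative of the constant field w along v. The terms without k are those of the conformally
  flat metric \<open>cyl\<close>. With \<open>v'\<close> and \<open>w'\<close> for the parts of v and w orthogonal to x and J x, the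
  others are \<open>k (\<theta>(w) J v' + \<theta>(v) J w')\<close>, the effect of rescaling the fibres of the Hopf
  fibration against its base; the constant is k = (1 - a) / a.\<close>

definition christoffel :: "real \<Rightarrow> complex ^ 'n \<Rightarrow> complex ^ 'n \<Rightarrow> complex ^ 'n \<Rightarrow> complex ^ 'n" where
  "christoffel k x v w = cyl x v w *\<^sub>R hpart x - \<eta> x v *\<^sub>R hpart w - \<eta> x w *\<^sub>R hpart v +
     k *\<^sub>R (\<theta> x w *\<^sub>R J (hpart v) + \<theta> x v *\<^sub>R J (hpart w)
       - (\<eta> x v * \<theta> x w + \<eta> x w * \<theta> x v) *\<^sub>R J (hpart x) + (2 * (\<theta> x v * \<theta> x w)) *\<^sub>R hpart x)"

lemma ht_hpart: "ht (hpart v) w = 0" "ht (J (hpart v)) w = 0"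
  by (auto simp: ht_def hpart_def J_def intro!: sum.neutral)

lemma ht_linear: "ht (v + v') w = ht v w + ht v' w" "ht (v - v') w = ht v w - ht v' w"
  "ht (r *\<^sub>R v) w = of_real r * ht v w"
  by (simp_all add: ht_def sum.distrib sum_subtractf sum_distrib_left algebra_simps scaleR_conv_of_real[where 'a=complex])

text \<open>The Koszul formula, evaluated with the derivatives of \<open>cyl\<close>, \<open>\<eta>\<close> and \<open>\<theta>\<close>, is
  a polynomial identity in these forms.\<close>

lemma levi_civita_riem_metric:
  assumes x: "x \<in> W" and a: "a > 0"
  shows "levi_civita (riem_metric a) x v w = christoffel ((1 - a) / a) x v w"
  unfolding levi_civita_def
proof (rule sharp_riem_metric[OF x a])
  fix z
  define k where "k = (1 - a) / a"
  have k: "a * k = 1 - a" using a by (simp add: k_def)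
  have bJ: "cyl x v (J w) = - cyl x w (J v)" for v w
    using cyl_commute[of x v "J w"] by (simp add: cyl_linear)
  note c = cyl_commute[of x w v] cyl_commute[of x z v] cyl_commute[of x z w] bJ[of v w] bJ[of v z] bJ[of w z]
  show "riem_metric a x (christoffel ((1 - a) / a) x v w) z =
     (dderiv v (\<lambda>y. riem_metric a y w z) x + dderiv w (\<lambda>y. riem_metric a y v z) x - dderiv z (\<lambda>y. riem_metric a y v w) x) / 2"
    unfolding dderiv_riem_metric[OF x] k_def[symmetric] unfolding riem_metric_def christoffel_def
    by (simp add: cyl_linear \<eta>\<theta>_linear \<eta>\<theta>_simps[OF x] ht_linear ht_hpart c) (use k in algebra)
qed

section \<open>Riemannian scalar curvature\<close>

definition d\<eta> :: "complex ^ 'n \<Rightarrow> complex ^ 'n \<Rightarrow> complex ^ 'n \<Rightarrow> real" where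
  "d\<eta> x t v = cyl x v t - 2 * \<eta> x v * \<eta> x t"

definition d\<theta> :: "complex ^ 'n \<Rightarrow> complex ^ 'n \<Rightarrow> complex ^ 'n \<Rightarrow> real" where
  "d\<theta> x t v = cyl x v (J t) - 2 * \<theta> x v * \<eta> x t"

definition dchristoffel ::
    "real \<Rightarrow> complex ^ 'n \<Rightarrow> complex ^ 'n \<Rightarrow> complex ^ 'n \<Rightarrow> complex ^ 'n \<Rightarrow> complex ^ 'n" where
  "dchristoffel k x t v w =
     cyl x v w *\<^sub>R hpart t - (2 * \<eta> x t * cyl x v w) *\<^sub>R hpart x - d\<eta> x t v *\<^sub>R hpart w - d\<eta> x t w *\<^sub>R hpart v +
     k *\<^sub>R (d\<theta> x t w *\<^sub>R J (hpart v) + d\<theta> x t v *\<^sub>R J (hpart w)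
       - (\<eta> x v * \<theta> x w + \<eta> x w * \<theta> x v) *\<^sub>R J (hpart t)
       - (d\<eta> x t v * \<theta> x w + \<eta> x v * d\<theta> x t w + d\<eta> x t w * \<theta> x v + \<eta> x w * d\<theta> x t v) *\<^sub>R J (hpart x)
       + (2 * (\<theta> x v * \<theta> x w)) *\<^sub>R hpart t
       + (2 * (d\<theta> x t v * \<theta> x w + \<theta> x v * d\<theta> x t w)) *\<^sub>R hpart x)"

lemma christoffel_has_derivative:
  assumes "x \<in> W"
  shows "((\<lambda>y. christoffel k y v w) has_derivative (\<lambda>t. dchristoffel k x t v w)) (at x)"
  unfolding christoffel_def
  by (rule has_derivative_eq_rhs, (rule has_derivative_add has_derivative_diff has_derivative_scaleR
        has_derivative_mult has_derivative_const has_derivative_cyl[OF assms] has_derivative_\<eta>[OF assms] has_derivative_\<theta>[OF assms]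
        bounded_linear_imp_has_derivative[OF bounded_linear_hpart]
        bounded_linear_imp_has_derivative[OF bounded_linear_compose[OF bounded_linear_J bounded_linear_hpart]])+)
    (simp add: dchristoffel_def d\<eta>_def d\<theta>_def fun_eq_iff algebra_simps)

lemma riemann_curv_riem_metric:
  assumes x: "x \<in> W" and a: "a > 0"
  defines "k \<equiv> (1 - a) / a"
  shows "riemann_curv (riem_metric a) x t v w = dchristoffel k x t v w - dchristoffel k x v t w
    + christoffel k x t (christoffel k x v w) - christoffel k x v (christoffel k x t w)"
proof -
  have "dderiv t (\<lambda>y. levi_civita (riem_metric a) y v w) x = dchristoffel k x t v w" for t v
  proof -
    have "dderiv t (\<lambda>y. levi_civita (riem_metric a) y v w) x = dderiv t (\<lambda>y. christoffel k y v w) x"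
      by (rule dderiv_cong_open[OF open_W x]) (simp add: levi_civita_riem_metric[OF _ a] k_def)
    then show ?thesis by (simp add: dderiv_eq[OF christoffel_has_derivative[OF x]])
  qed
  then show ?thesis by (simp add: riemann_curv_def levi_civita_riem_metric[OF x a] k_def)
qed

lemma ip_cyl: "x \<in> W \<Longrightarrow> ip v w = ip x x * cyl x v w"
  using ip_self_pos[of x] by (simp add: cyl_def)

text \<open>Every linear form of e that occurs below is the product \<open>ip\<close> with an explicit vector. A summand of a trace is then
  a combination of products \<open>ip P e * ip Q e\<close>, whose sum over an orthonormal basis is
  \<open>ip P Q\<close>, and of \<open>ip e e\<close>, whose sum is the real dimension 4 of the Hopf plane.\<close>

lemma linear_forms:
  "cyl x e v = inverse (ip x x) * ip v e" "\<eta> x e = inverse (ip x x) * ip x e"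
  "\<theta> x e = inverse (ip x x) * ip (J x) e"
  "d\<eta> x e v = ip (inverse (ip x x) *\<^sub>R (v - (2 * \<eta> x v) *\<^sub>R x)) e"
  "d\<eta> x v e = ip (inverse (ip x x) *\<^sub>R (v - (2 * \<eta> x v) *\<^sub>R x)) e"
  "d\<theta> x e v = ip (- (inverse (ip x x) *\<^sub>R (J v + (2 * \<theta> x v) *\<^sub>R x))) e"
  "d\<theta> x v e = ip (inverse (ip x x) *\<^sub>R (J v - (2 * \<eta> x v) *\<^sub>R J x)) e"
proof -
  note c = ip_commute[of e v] ip_commute[of e x]
  note j = ip_J ip_J_swap[of e v] ip_J_swap[of e x]
  show "cyl x e v = inverse (ip x x) * ip v e" "\<eta> x e = inverse (ip x x) * ip x e"
    "\<theta> x e = inverse (ip x x) * ip (J x) e"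
    by (simp_all add: \<eta>_def \<theta>_def cyl_def c j)
  show "d\<eta> x e v = ip (inverse (ip x x) *\<^sub>R (v - (2 * \<eta> x v) *\<^sub>R x)) e"
    "d\<eta> x v e = ip (inverse (ip x x) *\<^sub>R (v - (2 * \<eta> x v) *\<^sub>R x)) e"
    "d\<theta> x e v = ip (- (inverse (ip x x) *\<^sub>R (J v + (2 * \<theta> x v) *\<^sub>R x))) e"
    "d\<theta> x v e = ip (inverse (ip x x) *\<^sub>R (J v - (2 * \<eta> x v) *\<^sub>R J x)) e"
    by (simp_all add: d\<eta>_def d\<theta>_def \<eta>_def \<theta>_def cyl_def ip_linear c j algebra_simps)
qed

lemma christoffel_ip:
  "ip (christoffel k x v w) z = cyl x v w * ip x z - \<eta> x v * ip w z - \<eta> x w * ip v z +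
     k * (\<theta> x w * ip (J v) z + \<theta> x v * ip (J w) z - (\<eta> x v * \<theta> x w + \<eta> x w * \<theta> x v) * ip (J x) z
       + 2 * \<theta> x v * \<theta> x w * ip x z)"
  by (simp add: christoffel_def ip_linear ip_hpart hpart_linear(4)[symmetric])

lemma christoffel_inner: "christoffel k x v w \<bullet> e = ip (christoffel k x v w) e"
  by (simp add: christoffel_def inner_add_left inner_diff_left inner_hpart ip_linear ip_hpart hpart_linear(4)[symmetric])

lemmas trace_simps = sum.distrib sum_subtractf sum_negf sum_distrib_left[symmetric] trace_ip trace_ip_self

text \<open>The logarithmic derivative of the volume density \<open>r\<^sup>-\<^sup>4\<close>. The next lemma is the derivative of this
  trace.\<close>

lemma trace_christoffel:
  assumes x: "x \<in> W"
  shows "(\<Sum>e\<in>Basis. christoffel k x e y \<bullet> e) = - 4 * \<eta> x y"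
proof -
  define r where "r = inverse (ip x x)"
  have r: "r * ip x x = 1" using ip_self_pos[OF x] by (simp add: r_def)
  have "christoffel k x e y \<bullet> e = r * (ip y e * ip x e) - r * (ip x e * ip y e) - \<eta> x y * ip e e
      + (k * r) * (ip (J x) e * ip (J y) e) - (k * r * \<theta> x y) * (ip x e * ip (J x) e)
      - (k * r * \<eta> x y) * (ip (J x) e * ip (J x) e)
      + (2 * k * \<theta> x y * r) * (ip (J x) e * ip x e)" for e
    unfolding christoffel_inner christoffel_ip linear_forms(1)[of x e y] linear_forms(2,3)[of x e] r_def[symmetric] ip_J_self
    by (simp add: algebra_simps)
  then have "(\<Sum>e\<in>Basis. christoffel k x e y \<bullet> e) = r * ip y x - r * ip x y - \<eta> x y * 4
      + (k * r) * ip (J x) (J y) - (k * r * \<theta> x y) * ip x (J x)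
      - (k * r * \<eta> x y) * ip (J x) (J x) + (2 * k * \<theta> x y * r) * ip (J x) x"
    by (simp only: trace_simps)
  then show ?thesis
    unfolding ip_J(2) ip_J_self ip_cyl[OF x, of x y] ip_cyl[OF x, of y x] \<eta>\<theta>_simps[OF x]
    using r by algebra
qed

lemma trace_dchristoffel_right:
  assumes x: "x \<in> W"
  shows "(\<Sum>e\<in>Basis. dchristoffel k x v e w \<bullet> e) = - 4 * d\<eta> x v w"
proof -
  define r where "r = inverse (ip x x)"
  have r: "r * ip x x = 1" using ip_self_pos[OF x] by (simp add: r_def)
  define H T where "H = r *\<^sub>R (v - (2 * \<eta> x v) *\<^sub>R x)" and "T = r *\<^sub>R (J v - (2 * \<eta> x v) *\<^sub>R J x)"
  have "dchristoffel k x v e w \<bullet> e = r * (ip w e * ip v e) - (2 * \<eta> x v * r) * (ip w e * ip x e)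
      - ip H e * ip w e - d\<eta> x v w * ip e e + k * (ip T e * ip (J w) e)
      - (k * r * \<theta> x w) * (ip x e * ip (J v) e) - (k * r * \<eta> x w) * (ip (J x) e * ip (J v) e)
      - (k * \<theta> x w) * (ip H e * ip (J x) e) - (k * r * d\<theta> x v w) * (ip x e * ip (J x) e)
      - (k * r * d\<eta> x v w) * (ip (J x) e * ip (J x) e) - (k * \<eta> x w) * (ip T e * ip (J x) e)
      + (2 * k * r * \<theta> x w) * (ip (J x) e * ip v e) + (2 * k * \<theta> x w) * (ip T e * ip x e)
      + (2 * k * r * d\<theta> x v w) * (ip (J x) e * ip x e)" for e
    unfolding dchristoffel_def inner_add_left inner_diff_left inner_scaleR_left inner_hpart
      linear_forms(1)[of x e w] linear_forms(2,3)[of x e] linear_forms(5,7)[of x v e]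
      r_def[symmetric] H_def[symmetric] T_def[symmetric] ip_J_self
    by (simp add: algebra_simps)
  then have "(\<Sum>e\<in>Basis. dchristoffel k x v e w \<bullet> e) = r * ip w v - (2 * \<eta> x v * r) * ip w x
      - ip H w - d\<eta> x v w * 4 + k * ip T (J w)
      - (k * r * \<theta> x w) * ip x (J v) - (k * r * \<eta> x w) * ip (J x) (J v)
      - (k * \<theta> x w) * ip H (J x) - (k * r * d\<theta> x v w) * ip x (J x)
      - (k * r * d\<eta> x v w) * ip (J x) (J x) - (k * \<eta> x w) * ip T (J x)
      + (2 * k * r * \<theta> x w) * ip (J x) v + (2 * k * \<theta> x w) * ip T x
      + (2 * k * r * d\<theta> x v w) * ip (J x) x"
    by (simp only: trace_simps)
  then show ?thesis
    unfolding H_def T_def ip_linear ip_J(2) ip_J_self ip_cyl[OF x, of w v] ip_cyl[OF x, of w x] ip_cyl[OF x, of v w]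
      ip_cyl[OF x, of x w] ip_cyl[OF x, of x "J v"] ip_cyl[OF x, of x v] ip_cyl[OF x, of v "J x"] ip_cyl[OF x, of "J x" v]
      ip_cyl[OF x, of v x] ip_cyl[OF x, of "J v" x] \<eta>\<theta>_simps[OF x] cyl_commute[of x w v] d\<eta>_def d\<theta>_def cyl_commute[of x w "J v"]
    unfolding cyl_linear(9) using r by algebra
qed

text \<open>The divergence of the vector field \<open>christoffel k x v w\<close>.\<close>

lemma trace_dchristoffel_left:
  assumes x: "x \<in> W"
  shows "(\<Sum>e\<in>Basis. dchristoffel k x e v w \<bullet> e) = 4 * \<eta> x v * \<eta> x w
    + k * (2 * \<eta> x v * \<eta> x w + 6 * \<theta> x v * \<theta> x w - 2 * cyl x v w)"
proof -
  define r where "r = inverse (ip x x)"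
  have r: "r * ip x x = 1" using ip_self_pos[OF x] by (simp add: r_def)
  define H where "H v = r *\<^sub>R (v - (2 * \<eta> x v) *\<^sub>R x)" for v
  define T where "T v = - (r *\<^sub>R (J v + (2 * \<theta> x v) *\<^sub>R x))" for v
  have "dchristoffel k x e v w \<bullet> e = (cyl x v w + 2 * k * \<theta> x v * \<theta> x w) * ip e e
      - (2 * cyl x v w * r) * (ip x e * ip x e) - ip (H v) e * ip w e - ip (H w) e * ip v e
      + k * (ip (T w) e * ip (J v) e) + k * (ip (T v) e * ip (J w) e)
      - (k * \<theta> x w) * (ip (H v) e * ip (J x) e) - (k * \<eta> x v) * (ip (T w) e * ip (J x) e)
      - (k * \<theta> x v) * (ip (H w) e * ip (J x) e) - (k * \<eta> x w) * (ip (T v) e * ip (J x) e)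
      + (2 * k * \<theta> x w) * (ip (T v) e * ip x e) + (2 * k * \<theta> x v) * (ip (T w) e * ip x e)" for e
    unfolding dchristoffel_def inner_add_left inner_diff_left inner_scaleR_left inner_hpart
      linear_forms(2)[of x e] linear_forms(4,6)[of x e v] linear_forms(4,6)[of x e w]
      r_def[symmetric] H_def[symmetric] T_def[symmetric] ip_J_self
    by (simp add: algebra_simps)
  then have "(\<Sum>e\<in>Basis. dchristoffel k x e v w \<bullet> e) = (cyl x v w + 2 * k * \<theta> x v * \<theta> x w) * 4
      - (2 * cyl x v w * r) * ip x x - ip (H v) w - ip (H w) v
      + k * ip (T w) (J v) + k * ip (T v) (J w)
      - (k * \<theta> x w) * ip (H v) (J x) - (k * \<eta> x v) * ip (T w) (J x)
      - (k * \<theta> x v) * ip (H w) (J x) - (k * \<eta> x w) * ip (T v) (J x)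
      + (2 * k * \<theta> x w) * ip (T v) x + (2 * k * \<theta> x v) * ip (T w) x"
    by (simp only: trace_simps)
  then show ?thesis
    unfolding H_def T_def ip_linear ip_J(2) ip_J_self ip_cyl[OF x, of w v] ip_cyl[OF x, of w x] ip_cyl[OF x, of v w]
      ip_cyl[OF x, of x w] ip_cyl[OF x, of x "J v"] ip_cyl[OF x, of x "J w"] ip_cyl[OF x, of x v] ip_cyl[OF x, of v "J x"]
      ip_cyl[OF x, of v x] ip_cyl[OF x, of w "J x"] ip_cyl[OF x, of "J w" x]
      ip_cyl[OF x, of "J v" x] \<eta>\<theta>_simps[OF x] cyl_commute[of x w v] 
    using r by algebra
qed

text \<open>The trace of the product of two Christoffel operators, the quadratic term of the Ricci curvature that
  survives.\<close>

lemma trace_christoffel_christoffel: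
  assumes x: "x \<in> W"
  shows "(\<Sum>e\<in>Basis. christoffel k x v (christoffel k x e w) \<bullet> e) =
    6 * \<eta> x v * \<eta> x w - 2 * cyl x v w - 2 * k ^ 2 * \<theta> x v * \<theta> x w"
proof -
  define r where "r = inverse (ip x x)"
  have r: "r * ip x x = 1" using ip_self_pos[OF x] by (simp add: r_def)
  \<comment> \<open>The adjoint of the operator \<open>christoffel k x e w\<close> of e with respect to \<open>ip\<close>.\<close>
  define A where "A z = (r * ip x z) *\<^sub>R w - (r * ip w z) *\<^sub>R x - \<eta> x w *\<^sub>R z
      + k *\<^sub>R ((r * ip (J w) z) *\<^sub>R J x - \<theta> x w *\<^sub>R J z
        - ip (J x) z *\<^sub>R ((r * \<theta> x w) *\<^sub>R x + (r * \<eta> x w) *\<^sub>R J x) + (2 * \<theta> x w * r * ip x z) *\<^sub>R J x)" for z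
  have A: "ip (christoffel k x e w) z = ip (A z) e" for e z
  proof -
    have c: "ip e z = ip z e" "ip (J e) z = - ip (J z) e"
      using ip_commute[of e z] ip_J_swap[of z e] by (simp_all add: ip_commute[of "J e" z] ip_J ip_commute[of e "J z"])
    show ?thesis
      unfolding christoffel_ip linear_forms(1)[of x e w] linear_forms(2,3)[of x e] r_def[symmetric] A_def ip_linear c
      by (simp add: algebra_simps)
  qed
  have \<eta>y: "\<eta> x (christoffel k x e w) = r * ip (A x) e" "\<theta> x (christoffel k x e w) = r * ip (A (J x)) e"
    "cyl x v (christoffel k x e w) = r * ip (A v) e" for e
    by (simp_all add: \<eta>_def \<theta>_def cyl_def A r_def cyl_commute[of x v])
       (simp_all add: ip_commute[of v] A)
  have ye: "ip (christoffel k x e w) e = r * (ip w e * ip x e) - r * (ip x e * ip w e) - \<eta> x w * ip e e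
      + (k * r) * (ip (J x) e * ip (J w) e) - (k * r * \<theta> x w) * (ip x e * ip (J x) e)
      - (k * r * \<eta> x w) * (ip (J x) e * ip (J x) e) + (2 * k * \<theta> x w * r) * (ip (J x) e * ip x e)" for e
    unfolding christoffel_ip linear_forms(1)[of x e w] linear_forms(2,3)[of x e] r_def[symmetric] ip_J_self by (simp add: algebra_simps)
  have Jye: "ip (J (christoffel k x e w)) e = r * (ip w e * ip (J x) e) - r * (ip x e * ip (J w) e)
      - (k * \<theta> x w) * ip e e - (k * r) * (ip (J x) e * ip w e) + (k * r * \<theta> x w) * (ip x e * ip x e)
      + (k * r * \<eta> x w) * (ip (J x) e * ip x e) + (2 * k * \<theta> x w * r) * (ip (J x) e * ip (J x) e)" for e
    unfolding ip_J(1)[of "christoffel k x e w"] christoffel_ip linear_forms(1)[of x e w] linear_forms(2,3)[of x e] r_def[symmetric] ip_J(2) ip_J_self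
    by (simp add: ip_J algebra_simps)
  have "christoffel k x v (christoffel k x e w) \<bullet> e = r * (ip (A v) e * ip x e)
      - \<eta> x v * ip (christoffel k x e w) e - r * (ip (A x) e * ip v e)
      + (k * r) * (ip (A (J x)) e * ip (J v) e) + (k * \<theta> x v) * ip (J (christoffel k x e w)) e
      - (k * r * \<eta> x v) * (ip (A (J x)) e * ip (J x) e) - (k * r * \<theta> x v) * (ip (A x) e * ip (J x) e)
      + (2 * k * r * \<theta> x v) * (ip (A (J x)) e * ip x e)" for e
    unfolding christoffel_inner christoffel_ip[of k x v] \<eta>y by (simp add: algebra_simps)
  then have "(\<Sum>e\<in>Basis. christoffel k x v (christoffel k x e w) \<bullet> e) = r * ip (A v) x
      - \<eta> x v * (r * ip w x - r * ip x w - \<eta> x w * 4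
        + (k * r) * ip (J x) (J w) - (k * r * \<theta> x w) * ip x (J x)
        - (k * r * \<eta> x w) * ip (J x) (J x) + (2 * k * \<theta> x w * r) * ip (J x) x)
      - r * ip (A x) v + (k * r) * ip (A (J x)) (J v)
      + (k * \<theta> x v) * (r * ip w (J x) - r * ip x (J w)
        - (k * \<theta> x w) * 4 - (k * r) * ip (J x) w + (k * r * \<theta> x w) * ip x x
        + (k * r * \<eta> x w) * ip (J x) x + (2 * k * \<theta> x w * r) * ip (J x) (J x))
      - (k * r * \<eta> x v) * ip (A (J x)) (J x) - (k * r * \<theta> x v) * ip (A x) (J x)
      + (2 * k * r * \<theta> x v) * ip (A (J x)) x"
    by (simp only: ye Jye trace_simps)
  then show ?thesis
    unfolding A_def ip_linear J_linear ip_J(2) ip_J_self ip_cyl[OF x, of w v] ip_cyl[OF x, of w x] ip_cyl[OF x, of v w]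
      ip_cyl[OF x, of x w] ip_cyl[OF x, of x "J v"] ip_cyl[OF x, of x "J w"] ip_cyl[OF x, of x v] ip_cyl[OF x, of v "J x"]
      ip_cyl[OF x, of v x] ip_cyl[OF x, of w "J x"] ip_cyl[OF x, of "J w" x] ip_cyl[OF x, of w "J v"] ip_cyl[OF x, of "J w" v]
      ip_cyl[OF x, of "J v" x] ip_cyl[OF x, of "J x" w] ip_cyl[OF x, of "J x" v] ip_cyl[OF x, of "J v" w] ip_cyl[OF x, of v "J w"]
      cyl_commute[of x w v] \<eta>\<theta>_simps[OF x]
    using r by algebra
qed

text \<open>The two traces of \<open>trace_dchristoffel_right\<close> and \<open>trace_christoffel\<close> cancel, as \<open>d\<eta>\<close> in the direction
  v and \<open>\<eta>\<close> of the covariant derivative agree. With t = 1 / a, the result is the Ricci curvature of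
  the Berger sphere with fibre length \<open>\<surd>t\<close>: 4 - 2 t on the base and \<open>2 t\<^sup>2 \<theta> \<otimes> \<theta>\<close> on the fibre.\<close>

lemma ricci_curv_riem_metric:
  assumes x: "x \<in> W" and a: "a > 0"
  shows "ricci_curv (riem_metric a) x v w = (4 - 2 / a) * (cyl x v w - \<eta> x v * \<eta> x w - \<theta> x v * \<theta> x w)
    + 2 / a ^ 2 * \<theta> x v * \<theta> x w"
proof -
  define k where "k = (1 - a) / a"
  have ia: "inverse a = k + 1" using a by (simp add: k_def field_simps)
  have "ricci_curv (riem_metric a) x v w = (\<Sum>e\<in>Basis. dchristoffel k x e v w \<bullet> e) - (\<Sum>e\<in>Basis. dchristoffel k x v e w \<bullet> e)
    + (\<Sum>e\<in>Basis. christoffel k x e (christoffel k x v w) \<bullet> e) - (\<Sum>e\<in>Basis. christoffel k x v (christoffel k x e w) \<bullet> e)"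
    unfolding ricci_curv_def riemann_curv_riem_metric[OF x a] k_def[symmetric]
    by (simp add: inner_add_left inner_diff_left sum.distrib sum_subtractf)
  also have "\<dots> = (4 - 2 * (k + 1)) * (cyl x v w - \<eta> x v * \<eta> x w - \<theta> x v * \<theta> x w)
    + 2 * (k + 1) ^ 2 * \<theta> x v * \<theta> x w"
  proof -
    have "\<eta> x (christoffel k x v w) = cyl x v w - 2 * \<eta> x v * \<eta> x w"
      by (simp add: christoffel_def \<eta>\<theta>_linear \<eta>\<theta>_simps[OF x])
    then show ?thesis
      unfolding trace_dchristoffel_left[OF x] trace_dchristoffel_right[OF x] trace_christoffel[OF x]
        trace_christoffel_christoffel[OF x] d\<eta>_def cyl_commute[of x w v] by algebra
  qed
  finally show ?thesis unfolding ia[symmetric] by (simp add: divide_inverse power_inverse)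
qed

text \<open>Raising an index of the Ricci curvature, the two directions of the base have eigenvalue c1 and the fibre
  direction has eigenvalue c2.\<close>

lemma scalar_curv_riem_metric:
  assumes x: "x \<in> W" and a: "a > 0"
  shows "scalar_curv (riem_metric a) x = (4 * a - 1) / a ^ 2"
proof -
  define c1 where "c1 = (2 * a - 1) / a ^ 2"
  define c2 where "c2 = 1 / a ^ 2"
  have c: "2 * a * c1 = 4 - 2 / a" "2 * c2 = 2 / a ^ 2"
    using a by (simp_all add: c1_def c2_def field_simps power2_eq_square)
  have sharp_eq: "sharp (riem_metric a x) (ricci_curv (riem_metric a) x v) =
      c1 *\<^sub>R (hpart v - \<eta> x v *\<^sub>R hpart x - \<theta> x v *\<^sub>R J (hpart x)) + (c2 * \<theta> x v) *\<^sub>R J (hpart x)" for v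
  proof (rule sharp_riem_metric[OF x a])
    fix z
    show "riem_metric a x (c1 *\<^sub>R (hpart v - \<eta> x v *\<^sub>R hpart x - \<theta> x v *\<^sub>R J (hpart x)) + (c2 * \<theta> x v) *\<^sub>R J (hpart x)) z =
        ricci_curv (riem_metric a) x v z"
      unfolding ricci_curv_riem_metric[OF x a] c[symmetric] riem_metric_def ht_linear ht_hpart hpart_linear(4)[symmetric] cyl_linear \<eta>\<theta>_linear \<eta>\<theta>_simps[OF x]
      by (simp add: \<eta>\<theta>_simps[OF x] algebra_simps)
  qed
  have "scalar_curv (riem_metric a) x = (\<Sum>e\<in>Basis. c1 * ip e e - c1 * \<eta> x e * ip x e - (c1 - c2) * \<theta> x e * ip (J x) e)"
    unfolding scalar_curv_def sharp_eq
    by (simp add: inner_add_left inner_diff_left inner_hpart algebra_simps)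
  also have "\<dots> = (\<Sum>e\<in>Basis. c1 * ip e e - (c1 * inverse (ip x x)) * (ip x e * ip x e)
      - ((c1 - c2) * inverse (ip x x)) * (ip (J x) e * ip (J x) e))"
    by (intro sum.cong refl) (simp add: linear_forms(2,3) mult.assoc)
  also have "\<dots> = c1 * 4 - (c1 * inverse (ip x x)) * ip x x - ((c1 - c2) * inverse (ip x x)) * ip (J x) (J x)"
    by (simp only: trace_simps)
  also have "\<dots> = 2 * c1 + c2"
    using ip_self_pos[OF x] by (simp add: ip_J(2) mult.assoc)
  also have "\<dots> = (4 * a - 1) / a ^ 2"
    by (simp add: c1_def c2_def add_divide_distrib[symmetric])
  finally show ?thesis .
qed

section \<open>The three metrics\<close>

text \<open>The determinant recovers the parameter a.\<close>

lemma metric_inject: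
  assumes "agree_on_charts atlas (metric a) (metric a')"
  shows "a = a'"
proof -
  let ?x = "axis p 1 :: complex ^ 'n"
  have x: "?x \<in> W" by (simp add: W_def)
  then obtain V where V: "open V" "V \<subseteq> W" "inj_on covering V" "?x \<in> V" by (rule atlas_covers)
  let ?c = "(covering ` V, inv_into V covering)"
  have "?c \<in> atlas" "?x \<in> chart_range ?c"
    using V by (auto simp: atlas_def chart_range_atlas)
  then have "det (metric a ?c ?x) = det (metric a' ?c ?x)"
    using assms by (simp add: agree_on_charts_def)
  moreover have "weight ?x \<noteq> 0" using weight_hp[OF x] by auto
  ultimately show ?thesis by (simp add: det_metric[OF x])
qed

lemma riemannian_scalar_metric:
  assumes "x \<in> W" "a > 0"
  shows "riemannian_scalar (metric a) c x = (4 * a - 1) / a ^ 2"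
proof -
  have "(\<lambda>x. real_metric (metric a c x)) = riem_metric a"
    by (intro ext) (rule real_metric_metric)
  then show ?thesis using scalar_curv_riem_metric[OF assms] by (simp add: riemannian_scalar_def)
qed

lemma three_gauduchon_metrics:
  defines "h1 \<equiv> metric 1" and "h2 \<equiv> metric (1 / 4)" and "h3 \<equiv> metric (1 / 8)"
  shows "complex_manifold X atlas \<and> compact_space X \<and> c1_nonneg atlas \<and>
      gauduchon atlas h1 \<and> gauduchon atlas h2 \<and> gauduchon atlas h3 \<and>
      \<not> agree_on_charts atlas h1 h2 \<and> \<not> agree_on_charts atlas h1 h3 \<and> \<not> agree_on_charts atlas h2 h3 \<and>
      same_aeppli_class atlas (form_of h1) (form_of h2) \<and>
      same_aeppli_class atlas (form_of h2) (form_of h3) \<and>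
      agree_on_charts atlas (chern_ricci h1) (chern_ricci h2) \<and>
      agree_on_charts atlas (chern_ricci h2) (chern_ricci h3) \<and>
      semipositive atlas (chern_ricci h1) \<and>
      (\<forall>h\<in>{h1, h2, h3}. \<exists>s::real. s > 0 \<and>
         (\<forall>c\<in>atlas. \<forall>x\<in>chart_range c. chern_scalar h c x = complex_of_real s)) \<and>
      (\<exists>s>0. \<forall>c\<in>atlas. \<forall>x\<in>chart_range c. riemannian_scalar h1 c x = s) \<and>
      (\<forall>c\<in>atlas. \<forall>x\<in>chart_range c. riemannian_scalar h2 c x = 0) \<and>
      (\<exists>s<0. \<forall>c\<in>atlas. \<forall>x\<in>chart_range c. riemannian_scalar h3 c x = s)"
proof (intro conjI)
  have W: "x \<in> W" if "c \<in> atlas" "x \<in> chart_range c" for c x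
    using chart_range_subset_W[OF that(1)] that(2) by blast
  have ricci: "agree_on_charts atlas (chern_ricci (metric a)) (chern_ricci (metric a'))"
    if "a > 0" "a' > 0" for a a'
    by (rule agree_on_atlasI) (simp add: chern_ricci_metric that)
  have scalar: "\<exists>s::real. s > 0 \<and>
      (\<forall>c\<in>atlas. \<forall>x\<in>chart_range c. chern_scalar (metric a) c x = complex_of_real s)" if "a > 0" for a
    using W chern_scalar_metric[OF _ that] that by (intro exI[of _ "2 / a"]) simp
  show "complex_manifold X atlas" by (rule complex_manifold_X)
  show "compact_space X" by (rule compact_X)
  show "c1_nonneg atlas" by (rule c1_nonneg_atlas)
  show "gauduchon atlas h1" "gauduchon atlas h2" "gauduchon atlas h3"
    by (simp_all add: h1_def h2_def h3_def gauduchon_metric)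
  show "\<not> agree_on_charts atlas h1 h2" "\<not> agree_on_charts atlas h1 h3" "\<not> agree_on_charts atlas h2 h3"
    unfolding h1_def h2_def h3_def by (auto dest: metric_inject)
  show "same_aeppli_class atlas (form_of h1) (form_of h2)" "same_aeppli_class atlas (form_of h2) (form_of h3)"
    unfolding h1_def h2_def h3_def by (rule same_aeppli_class_metric)+
  show "agree_on_charts atlas (chern_ricci h1) (chern_ricci h2)"
    "agree_on_charts atlas (chern_ricci h2) (chern_ricci h3)"
    unfolding h1_def h2_def h3_def by (rule ricci; simp)+
  have "semipos_matrix (chern_ricci h1 c x)" if "c \<in> atlas" "x \<in> chart_range c" for c x
    using semipos_levi_matrix[OF W[OF that], of 2 c] chern_ricci_metric[OF W[OF that], of 1 c] by (simp add: h1_def)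
  then show "semipositive atlas (chern_ricci h1)" by (simp add: semipositive_def)
  show "\<forall>h\<in>{h1, h2, h3}. \<exists>s::real. s > 0 \<and>
      (\<forall>c\<in>atlas. \<forall>x\<in>chart_range c. chern_scalar h c x = complex_of_real s)"
    using scalar unfolding h1_def h2_def h3_def by simp
  show "\<exists>s>0. \<forall>c\<in>atlas. \<forall>x\<in>chart_range c. riemannian_scalar h1 c x = s"
    using W by (intro exI[of _ 3]) (simp add: h1_def riemannian_scalar_metric)
  show "\<forall>c\<in>atlas. \<forall>x\<in>chart_range c. riemannian_scalar h2 c x = 0"
    using W by (simp add: h2_def riemannian_scalar_metric)
  show "\<exists>s<0. \<forall>c\<in>atlas. \<forall>x\<in>chart_range c. riemannian_scalar h3 c x = s"
    using W by (intro exI[of _ "- 32"]) (simp add: h3_def riemannian_scalar_metric power2_eq_square)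
qed

end

theorem theorem1p14:
  assumes "CARD('n::finite) \<ge> 2"
  shows "\<exists>(X :: ((complex ^ 'n) \<times> (complex ^ 'n)) topology)
          (A :: ((complex ^ 'n) \<times> (complex ^ 'n), 'n) chart set).
    complex_manifold X A \<and> compact_space X \<and> c1_nonneg A \<and>
    (\<exists>h1 h2 h3.
      gauduchon A h1 \<and> gauduchon A h2 \<and> gauduchon A h3 \<and>
      \<not> agree_on_charts A h1 h2 \<and> \<not> agree_on_charts A h1 h3 \<and> \<not> agree_on_charts A h2 h3 \<and>
      same_aeppli_class A (form_of h1) (form_of h2) \<and>
      same_aeppli_class A (form_of h2) (form_of h3) \<and>
      agree_on_charts A (chern_ricci h1) (chern_ricci h2) \<and>
      agree_on_charts A (chern_ricci h2) (chern_ricci h3) \<and>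
      semipositive A (chern_ricci h1) \<and>
      (\<forall>h\<in>{h1, h2, h3}. \<exists>s::real. s > 0 \<and>
         (\<forall>c\<in>A. \<forall>x\<in>chart_range c. chern_scalar h c x = complex_of_real s)) \<and>
      (\<exists>s>0. \<forall>c\<in>A. \<forall>x\<in>chart_range c. riemannian_scalar h1 c x = s) \<and>
      (\<forall>c\<in>A. \<forall>x\<in>chart_range c. riemannian_scalar h2 c x = 0) \<and>
      (\<exists>s<0. \<forall>c\<in>A. \<forall>x\<in>chart_range c. riemannian_scalar h3 c x = s))"
proof -
  obtain p q :: 'n where "p \<noteq> q"
    using assms card_le_Suc0_iff_eq[of "UNIV :: 'n set"] by auto
  then interpret two_axes p q by unfold_locales
  show ?thesis using three_gauduchon_metrics by blast
qed

end
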